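(* Let $n,m\in\mathbb{R}$. There exists $\eta_c=\eta_c(n,m)>0$ such that for any $0<\eta<\eta_c$ there exists $\delta=\delta(\eta,n,m)>0$ such that for any $\phi_0$ with $\phi_0-1\in H^1(\mathbb{R})$ and $$\|\phi_0-1\|_{H^1}\le\delta$$ there exists a unique $\phi$, with $\phi-1\in C^1([0,\infty);H^1(\mathbb{R}))$, that solves $$\phi_t+(\phi^n)_z-(\phi^n(\phi^{-m}\phi_t)_z)_z=0$$ with $\phi(\cdot,0)=\phi_0$. Moreover, $\|\phi(\cdot,t)-1\|_{H^1}\le\eta$ for all $t\ge0$.
   Context: $H^k=W^{k,2}(\mathbb{R})$. A solution with data $\phi_0$ is a function $\phi>0$ with $\phi-1\in C^1([0,\infty);H^1(\mathbb{R}))$ such that $$\phi(\cdot,t)=\phi_0+\int_0^t\phi(\cdot,s)^m u(\cdot,s)\,ds,$$ where for each $s$, $u(\cdot,s)\in H^1(\mathbb{R})$ is the unique weak solution of $-(\phi(\cdot,s)^n u_z)_z+\phi(\cdot,s)^m u=-(\phi(\cdot,s)^n)_z$. *)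

theory Defs
  imports "HOL-Analysis.Analysis"
begin

section \<open>Weak derivatives on the real line\<close>

definition test_function :: "(real \<Rightarrow> real) \<Rightarrow> bool" where
  "test_function \<psi> \<longleftrightarrow>
     (\<forall>k x. (deriv ^^ k) \<psi> differentiable (at x)) \<and> compact (closure {x. \<psi> x \<noteq> 0})"

definition locally_integrable :: "(real \<Rightarrow> real) \<Rightarrow> bool" where
  "locally_integrable f \<longleftrightarrow> (\<forall>a b. f absolutely_integrable_on {a..b})"

definition has_weak_deriv :: "(real \<Rightarrow> real) \<Rightarrow> (real \<Rightarrow> real) \<Rightarrow> bool" where
  "has_weak_deriv f g \<longleftrightarrow> locally_integrable f \<and> locally_integrable g \<and>
     (\<forall>\<psi>. test_function \<psi> \<longrightarrow>
        (LINT x|lebesgue. f x * deriv \<psi> x) = - (LINT x|lebesgue. g x * \<psi> x))"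

text \<open>The weak derivative is determined only almost everywhere (\<open>has_weak_deriv_unique\<close> below).\<close>

definition weak_deriv :: "(real \<Rightarrow> real) \<Rightarrow> real \<Rightarrow> real" where
  "weak_deriv f = (SOME g. has_weak_deriv f g)"

definition square_integrable :: "(real \<Rightarrow> real) \<Rightarrow> bool" where
  "square_integrable f \<longleftrightarrow>
     f \<in> borel_measurable lebesgue \<and> integrable lebesgue (\<lambda>x. (f x)\<^sup>2)"

definition in_H1 :: "(real \<Rightarrow> real) \<Rightarrow> bool" where
  "in_H1 f \<longleftrightarrow> square_integrable f \<and> (\<exists>g. square_integrable g \<and> has_weak_deriv f g)"

subsection \<open>Uniqueness of weak derivatives\<close>

definition flat :: "real \<Rightarrow> nat \<Rightarrow> real \<Rightarrow> real" where
  "flat c i y = (if y > 0 then inverse y ^ i * exp (- (c / y)) else 0)"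

lemma flat_tendsto_0:
  assumes "c > 0" shows "(flat c i \<longlongrightarrow> 0) (at 0)"
proof -
  have "((\<lambda>x::real. x ^ i / exp x) \<longlongrightarrow> 0) at_top"
    by (rule tendsto_power_div_exp_0)
  moreover have "filterlim (\<lambda>y. c * inverse y) at_top (at_right (0::real))"
    by (rule filterlim_tendsto_pos_mult_at_top[OF tendsto_const assms filterlim_inverse_at_top_right])
  ultimately have "((\<lambda>y. (c * inverse y) ^ i / exp (c * inverse y)) \<longlongrightarrow> 0) (at_right 0)"
    by (rule filterlim_compose)
  then have "((\<lambda>y. inverse c ^ i * ((c * inverse y) ^ i / exp (c * inverse y))) \<longlongrightarrow> 0) (at_right 0)"
    by (rule tendsto_mult_right_zero)
  then have R: "(flat c i \<longlongrightarrow> 0) (at_right 0)"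
  proof (rule Lim_transform_eventually)
    show "\<forall>\<^sub>F y in at_right 0. inverse c ^ i * ((c * inverse y) ^ i / exp (c * inverse y)) = flat c i y"
      using eventually_at_right_less[of 0]
      by eventually_elim
        (use assms in \<open>simp add: flat_def power_mult_distrib exp_minus field_simps\<close>)
  qed
  have "(flat c i \<longlongrightarrow> 0) (at_left 0)"
    by (rule Lim_transform_eventually[OF tendsto_const])
      (auto simp: flat_def eventually_at_left_field intro!: exI[of _ "-1"])
  with R show ?thesis by (simp add: filterlim_split_at)
qed

lemma flat_deriv:
  assumes c: "c > 0"
  shows "(flat c i has_real_derivative (c * flat c (i + 2) y - real i * flat c (i + 1) y)) (at y)"
proof (cases y "0::real" rule: linorder_cases)
  case less
  have "((\<lambda>_. 0) has_real_derivative 0) (at y)" by simp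
  then have "(flat c i has_real_derivative 0) (at y)"
    by (rule has_field_derivative_transform_within_open[of _ _ _ "{..<0}"])
      (use less in \<open>auto simp: flat_def\<close>)
  then show ?thesis using less by (simp add: flat_def)
next
  case equal
  have "(\<lambda>h. (flat c i (0 + h) - flat c i 0) / h) = flat c (i + 1)"
    by (auto simp: flat_def fun_eq_iff field_simps)
  then have "(flat c i has_real_derivative 0) (at 0)"
    using flat_tendsto_0[OF c, of "i+1"] by (simp add: DERIV_def)
  then show ?thesis using equal by (simp add: flat_def)
next
  case greater
  have *: "inverse y ^ i * exp (- (c / y)) * (c / (y * y))
          - exp (- (c / y)) * (real i * (inverse y ^ (i - Suc 0) * (inverse y * inverse y)))
       = c * (inverse y ^ (i+2) * exp (- (c / y))) - real i * (inverse y ^ (i+1) * exp (- (c / y)))"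
    by (cases i) (simp_all add: field_simps)
  have "((\<lambda>y. inverse y ^ i * exp (- (c / y))) has_real_derivative
     (inverse y ^ i * exp (- (c / y)) * (c / (y * y))
          - exp (- (c / y)) * (real i * (inverse y ^ (i - Suc 0) * (inverse y * inverse y))))) (at y)"
    using greater by (auto intro!: derivative_eq_intros) (simp add: algebra_simps)?
  then have "(flat c i has_real_derivative (inverse y ^ i * exp (- (c / y)) * (c / (y * y))
          - exp (- (c / y)) * (real i * (inverse y ^ (i - Suc 0) * (inverse y * inverse y))))) (at y)"
    by (rule has_field_derivative_transform_within_open[of _ _ _ "{0<..}"])
      (use greater in \<open>auto simp: flat_def\<close>)
  then show ?thesis unfolding * using greater by (simp add: flat_def)
qed

inductive_set bumps :: "real \<Rightarrow> real \<Rightarrow> real \<Rightarrow> (real \<Rightarrow> real) set" for c a b where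
  prod: "(\<lambda>x. flat c i (x - a) * flat c j (b - x)) \<in> bumps c a b"
| add: "f \<in> bumps c a b \<Longrightarrow> g \<in> bumps c a b \<Longrightarrow> (\<lambda>x. f x + g x) \<in> bumps c a b"
| scale: "f \<in> bumps c a b \<Longrightarrow> (\<lambda>x. r * f x) \<in> bumps c a b"

lemma bumps_deriv:
  assumes "f \<in> bumps c a b" and c: "c > 0"
  shows "\<exists>g\<in>bumps c a b. \<forall>x. (f has_real_derivative g x) (at x)"
  using assms(1)
proof induction
  case (prod i j)
  let ?F = "\<lambda>i j x. flat c i (x - a) * flat c j (b - x)"
  let ?g = "\<lambda>x. (c * ?F (i+2) j x + (- real i) * ?F (i+1) j x)
     + ((- c) * ?F i (j+2) x + real j * ?F i (j+1) x)"
  have "?g \<in> bumps c a b"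
    by (intro bumps.add bumps.scale bumps.prod)
  moreover have "(?F i j has_real_derivative ?g x) (at x)" for x
  proof -
    have 1: "((\<lambda>x. flat c i (x - a)) has_real_derivative
        (c * flat c (i + 2) (x - a) - real i * flat c (i + 1) (x - a)) * 1) (at x)"
      by (rule DERIV_chain2[OF flat_deriv[OF c]]) (auto intro!: derivative_eq_intros)
    have 2: "((\<lambda>x. flat c j (b - x)) has_real_derivative
        (c * flat c (j + 2) (b - x) - real j * flat c (j + 1) (b - x)) * (-1)) (at x)"
      by (rule DERIV_chain2[OF flat_deriv[OF c]]) (auto intro!: derivative_eq_intros)
    show ?thesis
      by (rule DERIV_cong[OF DERIV_mult[OF 1 2]]) (simp add: algebra_simps)
  qed
  ultimately show ?case by (intro bexI[of _ ?g] allI)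
next
  case (add f g)
  then obtain f' g' where "f' \<in> bumps c a b" "g' \<in> bumps c a b"
    "\<forall>x. (f has_real_derivative f' x) (at x)" "\<forall>x. (g has_real_derivative g' x) (at x)" by blast
  then show ?case
    by (intro bexI[of _ "\<lambda>x. f' x + g' x"]) (auto intro: bumps.add DERIV_add)
next
  case (scale f r)
  then obtain f' where "f' \<in> bumps c a b" "\<forall>x. (f has_real_derivative f' x) (at x)" by blast
  then show ?case
    by (intro bexI[of _ "\<lambda>x. r * f' x"]) (auto intro: bumps.scale DERIV_cmult)
qed

lemma test_function_bump:
  assumes c: "c > 0"
  shows "test_function (\<lambda>x. flat c 0 (x - a) * flat c 0 (b - x))" (is "test_function ?f")
proof -
  have D: "(deriv ^^ k) ?f \<in> bumps c a b" for k
  proof (induction k)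
    case 0
    show ?case by (simp add: bumps.prod)
  next
    case (Suc k)
    obtain g where "g \<in> bumps c a b" "\<forall>x. ((deriv ^^ k) ?f has_real_derivative g x) (at x)"
      using bumps_deriv[OF Suc c] by blast
    moreover from this have "deriv ((deriv ^^ k) ?f) = g"
      by (auto simp: fun_eq_iff intro!: DERIV_imp_deriv)
    ultimately show ?case by simp
  qed
  have "(deriv ^^ k) ?f differentiable (at x)" for k x
    using bumps_deriv[OF D c, of k] real_differentiable_def by blast
  moreover have "{x. ?f x \<noteq> 0} \<subseteq> {a..b}"
    by (auto simp: flat_def split: if_splits)
  then have "compact (closure {x. ?f x \<noteq> 0})"
    by (meson bounded_closed_interval bounded_subset compact_closure)
  ultimately show ?thesis by (simp add: test_function_def)
qed

lemma test_function_DERIV: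
  assumes "test_function \<psi>"
  shows "(\<psi> has_real_derivative deriv \<psi> x) (at x)"
    and "continuous_on UNIV \<psi>" and "continuous_on UNIV (deriv \<psi>)"
proof -
  have d: "(deriv ^^ k) \<psi> differentiable (at x)" for k x
    using assms by (auto simp: test_function_def)
  show "(\<psi> has_real_derivative deriv \<psi> x) (at x)"
    using d[of 0 x] by (simp add: DERIV_deriv_iff_real_differentiable)
  show "continuous_on UNIV \<psi>"
    using d[of 0] by (auto intro!: continuous_at_imp_continuous_on differentiable_imp_continuous_within)
  show "continuous_on UNIV (deriv \<psi>)"
    using d[of 1] by (auto intro!: continuous_at_imp_continuous_on differentiable_imp_continuous_within)
qed

lemma test_function_support:
  assumes "test_function \<psi>"
  obtains R where "\<And>x. x \<notin> {-R..R} \<Longrightarrow> \<psi> x = 0" "\<And>x. x \<notin> {-R..R} \<Longrightarrow> deriv \<psi> x = 0"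
proof -
  have "bounded {x. \<psi> x \<noteq> 0}"
    using assms bounded_subset[OF compact_imp_bounded closure_subset]
    by (auto simp: test_function_def)
  then obtain R where R: "\<And>x. \<psi> x \<noteq> 0 \<Longrightarrow> \<bar>x\<bar> \<le> R"
    by (auto simp: bounded_iff)
  have z: "\<psi> x = 0" if "x \<notin> {-R..R}" for x
    using R[of x] that by (cases "\<psi> x = 0") auto
  have "deriv \<psi> x = 0" if "x \<notin> {-R..R}" for x
  proof -
    have "((\<lambda>_. 0) has_real_derivative 0) (at x)" by simp
    then have "(\<psi> has_real_derivative 0) (at x)"
      by (rule has_field_derivative_transform_within_open[of _ _ _ "- {-R..R}"])
        (use that z in auto)
    then show ?thesis by (rule DERIV_imp_deriv)
  qed
  with z that show ?thesis by blast
qed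

lemma locally_integrable_mult:
  assumes f: "locally_integrable f" and h: "continuous_on UNIV h"
    and s: "\<And>x. x \<notin> {-R..R} \<Longrightarrow> h x = (0::real)"
  shows "integrable lebesgue (\<lambda>x. f x * h x)"
proof -
  have "bounded (h ` {-R..R})"
    by (intro compact_imp_bounded compact_continuous_image continuous_on_subset[OF h]) auto
  then obtain B where B: "\<And>x. x \<in> {-R..R} \<Longrightarrow> \<bar>h x\<bar> \<le> B"
    by (metis bounded_iff image_eqI real_norm_def)
  have i: "integrable lebesgue (\<lambda>x. indicator {-R..R} x * f x)"
    using f by (simp add: locally_integrable_def set_integrable_def)
  have m: "h \<in> borel_measurable lebesgue"
    using h by (intro borel_measurable_if_D measurable_completion) (auto intro: borel_measurable_continuous_onI)
  have e: "(\<lambda>x. f x * h x) = (\<lambda>x. (indicator {-R..R} x * f x) * h x)"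
    using s by (auto simp: fun_eq_iff indicator_def)
  show ?thesis unfolding e
  proof (rule Bochner_Integration.integrable_bound[where f = "\<lambda>x. B * (indicator {-R..R} x * f x)"])
    show "integrable lebesgue (\<lambda>x. B * (indicator {-R..R} x * f x))"
      using i by simp
    show "(\<lambda>x. indicator {-R..R} x * f x * h x) \<in> borel_measurable lebesgue"
      by (intro borel_measurable_times m borel_measurable_integrable[OF i])
    show "AE x in lebesgue. norm (indicator {-R..R} x * f x * h x)
        \<le> norm (B * (indicator {-R..R} x * f x))"
      using B by (intro AE_I2) (auto simp: abs_mult indicator_def mult.commute[of "\<bar>f _\<bar>"]
          intro!: mult_right_mono order_trans[OF B abs_ge_self])
  qed
qed

lemma locally_integrable_test:
  assumes "locally_integrable f" "test_function \<psi>"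
  shows "integrable lebesgue (\<lambda>x. f x * \<psi> x)" "integrable lebesgue (\<lambda>x. f x * deriv \<psi> x)"
proof -
  obtain R where "\<And>x. x \<notin> {-R..R} \<Longrightarrow> \<psi> x = 0" "\<And>x. x \<notin> {-R..R} \<Longrightarrow> deriv \<psi> x = 0"
    using test_function_support[OF assms(2)] by blast
  then show "integrable lebesgue (\<lambda>x. f x * \<psi> x)" "integrable lebesgue (\<lambda>x. f x * deriv \<psi> x)"
    using locally_integrable_mult[OF assms(1)] test_function_DERIV[OF assms(2)] by blast+
qed

lemma interval_integrals_zero_imp_AE_zero:
  fixes g :: "real \<Rightarrow> real"
  assumes g: "integrable lborel g"
    and z: "\<And>a b. (LINT x|lborel. indicator {a<..<b} x * g x) = 0"
  shows "AE x in lborel. g x = 0"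
proof (rule sigma_finite_measure.density_zero[OF sigma_finite_lborel g])
  fix A :: "real set" assume A: "A \<in> sets lborel"
  have i: "integrable lborel (\<lambda>x. indicator S x * g x)" if "S \<in> sets borel" for S
    using integrable_mult_indicator[of S lborel g] g that by simp
  have z': "(LINT x|lborel. indicator S x * g x) = 0" if S: "S \<in> range (\<lambda>(a, b). {a<..<b})" for S
    using S z by auto
  have borel_intervals:
    "sets (borel :: real measure) = sigma_sets UNIV (range (\<lambda>(a, b). {a<..<b}))"
  proof -
    have *: "(\<lambda>(a, b). box a b) = (\<lambda>(a, b). {a<..<b::real})"
      by (simp add: fun_eq_iff)
    show ?thesis
      by (subst borel_eq_box, subst *, rule sets_measure_of) simp
  qed
  have total: "(LINT x|lborel. g x) = 0"
  proof -
    have "(\<lambda>k. LINT x|lborel. indicator {- real k<..<real k} x * g x) \<longlonglongrightarrow> (LINT x|lborel. g x)"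
    proof (rule integral_dominated_convergence[where w = "\<lambda>x. \<bar>g x\<bar>"])
      show "AE x in lborel. (\<lambda>k. indicator {- real k<..<real k} x * g x) \<longlonglongrightarrow> g x"
      proof (intro AE_I2 tendsto_eventually)
        fix x :: real
        have "\<forall>\<^sub>F k in sequentially. \<bar>x\<bar> < real k"
          using filterlim_at_top_dense filterlim_real_sequentially by blast
        then show "\<forall>\<^sub>F k in sequentially. indicator {- real k<..<real k} x * g x = g x"
          by eventually_elim (auto simp: indicator_def)
      qed
    qed (use g in \<open>auto simp: indicator_def\<close>)
    with z show ?thesis by (simp add: LIMSEQ_const_iff)
  qed
  have "(LINT x|lborel. indicator A x * g x) = 0"
  proof -
    have A_sigma: "A \<in> sigma_sets UNIV (range (\<lambda>(a, b). {a<..<b::real}))"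
      using A unfolding sets_lborel borel_intervals .
    have stable: "Int_stable (range (\<lambda>(a, b). {a<..<b::real}))"
    proof (rule Int_stableI_image)
      fix p q :: "real \<times> real"
      have "(case p of (a, b) \<Rightarrow> {a<..<b}) \<inter> (case q of (a, b) \<Rightarrow> {a<..<b})
          = (case (max (fst p) (fst q), min (snd p) (snd q)) of (a, b) \<Rightarrow> {a<..<b})"
        by (auto simp: split_beta)
      then show "\<exists>r\<in>UNIV. (case p of (a, b) \<Rightarrow> {a<..<b}) \<inter> (case q of (a, b) \<Rightarrow> {a<..<b})
          = (case r of (a, b) \<Rightarrow> {a<..<b})"
        by blast
    qed
    have sub: "range (\<lambda>(a, b). {a<..<b::real}) \<subseteq> Pow UNIV" by simp
    show ?thesis
      using stable sub A_sigma
    proof (induction rule: sigma_sets_induct_disjoint)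
      case (basic S)
      then show ?case by (rule z')
    next
      case empty
      show ?case by simp
    next
      case (compl S)
      have S: "S \<in> sets borel"
        using compl(1) by (simp add: borel_intervals)
      have "(LINT x|lborel. indicator (UNIV - S) x * g x)
          = (LINT x|lborel. g x - indicator S x * g x)"
        by (intro Bochner_Integration.integral_cong) (auto simp: indicator_def)
      also have "\<dots> = 0"
        using compl(2) total g i[OF S] by simp
      finally show ?case .
    next
      case (union S)
      have S: "S k \<in> sets borel" for k
        using union(2) by (auto simp: borel_intervals)
      have si: "set_integrable lborel (\<Union>k. S k) g"
        using i[of "\<Union>k. S k"] S by (auto simp: set_integrable_def)
      have "set_lebesgue_integral lborel (\<Union>k. S k) g = (\<Sum>k. set_lebesgue_integral lborel (S k) g)"
        by (rule lebesgue_integral_countable_add)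
          (use S union(1) si in \<open>auto simp: disjoint_family_on_def\<close>)
      then show ?case
        using union(3) by (simp add: set_lebesgue_integral_def)
    qed
  qed
  then show "set_lebesgue_integral lborel A g = 0"
    by (simp add: set_lebesgue_integral_def)
qed

text \<open>The fundamental lemma of the calculus of variations: the bumps with \<open>c = 1 / Suc k\<close> converge
  boundedly to the indicator function of \<open>{a<..<b}\<close>.\<close>

lemma test_integrals_zero_imp_AE_zero:
  assumes g: "locally_integrable g"
    and z: "\<And>\<psi>. test_function \<psi> \<Longrightarrow> (LINT x|lebesgue. g x * \<psi> x) = 0"
  shows "AE x in lebesgue. g x = 0"
proof -
  have gi: "integrable lebesgue (\<lambda>x. indicator S x * g x)"
    if "S \<subseteq> {a..b}" "S \<in> sets lebesgue" for a b S
  proof -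
    have "g absolutely_integrable_on S"
      using g that set_integrable_subset unfolding locally_integrable_def by blast
    then show ?thesis by (simp add: set_integrable_def)
  qed
  have Z: "(LINT x|lebesgue. indicator {a<..<b} x * g x) = 0" for a b
  proof -
    let ?e = "\<lambda>k x. flat (1 / Suc k) 0 (x - a) * flat (1 / Suc k) 0 (b - x)"
    have "(\<lambda>k. LINT x|lebesgue. g x * ?e k x) \<longlonglongrightarrow> (LINT x|lebesgue. indicator {a<..<b} x * g x)"
    proof (rule integral_dominated_convergence[where w = "\<lambda>x. \<bar>indicator {a..b} x * g x\<bar>"])
      show "(\<lambda>x. indicator {a<..<b} x * g x) \<in> borel_measurable lebesgue"
        by (rule borel_measurable_integrable, rule gi[of _ a b]) auto
      show "(\<lambda>x. g x * ?e k x) \<in> borel_measurable lebesgue" for k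
        by (rule borel_measurable_integrable, rule locally_integrable_test[OF g test_function_bump]) simp
      show "integrable lebesgue (\<lambda>x. \<bar>indicator {a..b} x * g x\<bar>)"
        by (intro integrable_abs gi) auto
      show "AE x in lebesgue. (\<lambda>k. g x * ?e k x) \<longlonglongrightarrow> indicator {a<..<b} x * g x"
      proof (intro AE_I2)
        fix x
        show "(\<lambda>k. g x * ?e k x) \<longlonglongrightarrow> indicator {a<..<b} x * g x"
        proof (cases "x \<in> {a<..<b}")
          case True
          have l: "(\<lambda>k. exp (- (1 / real (Suc k) / y))) \<longlonglongrightarrow> 1" for y :: real
          proof -
            have "(\<lambda>k. exp (- (1 / real (Suc k) * inverse y))) \<longlonglongrightarrow> exp (- (0 * inverse y))"
              by (intro tendsto_intros LIMSEQ_Suc[OF lim_1_over_n])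
            then show ?thesis by (simp add: divide_inverse)
          qed
          have "(\<lambda>k. g x * (exp (- (1 / real (Suc k) / (x - a))) * exp (- (1 / real (Suc k) / (b - x)))))
              \<longlonglongrightarrow> g x * (1 * 1)"
            by (intro tendsto_mult tendsto_const l)
          then show ?thesis using True by (simp add: flat_def)
        next
          case False
          then have "(\<lambda>k. g x * ?e k x) = (\<lambda>_. indicator {a<..<b} x * g x)"
            by (auto simp: flat_def fun_eq_iff)
          then show ?thesis by simp
        qed
      qed
      show "AE x in lebesgue. norm (g x * ?e k x) \<le> \<bar>indicator {a..b} x * g x\<bar>" for k
      proof (intro AE_I2)
        fix x
        have 1: "\<bar>flat (1 / real (Suc k)) 0 y\<bar> \<le> 1" for y
          by (auto simp: flat_def)
        show "norm (g x * ?e k x) \<le> \<bar>indicator {a..b} x * g x\<bar>"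
        proof (cases "x \<in> {a..b}")
          case True
          have "\<bar>?e k x\<bar> \<le> 1"
            unfolding abs_mult by (rule mult_le_one[OF 1 abs_ge_zero 1])
          then have "\<bar>g x\<bar> * \<bar>?e k x\<bar> \<le> \<bar>g x\<bar> * 1"
            by (rule mult_left_mono) simp
          then show ?thesis using True by (simp only: real_norm_def abs_mult) simp
        next
          case False
          then have "g x * ?e k x = 0" by (auto simp: flat_def)
          then show ?thesis by (simp only:) simp
        qed
      qed
    qed
    moreover have "(LINT x|lebesgue. g x * ?e k x) = 0" for k
      by (rule z[OF test_function_bump]) simp
    ultimately show ?thesis by (simp add: LIMSEQ_const_iff)
  qed
  have "AE x in lebesgue. x \<in> {- real N..real N} \<longrightarrow> g x = 0" for N :: nat
  proof -
    let ?I = "{- real N<..<real N}"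
    have iN: "integrable lebesgue (\<lambda>x. indicator ?I x * g x)"
      by (rule gi[of _ "- real N" "real N"]) auto
    obtain h where h: "h \<in> borel_measurable lborel" "AE x in lborel. indicator ?I x * g x = h x"
      using completion_ex_borel_measurable_real[OF borel_measurable_integrable[OF iN]] by auto
    have h': "AE x in lebesgue. indicator ?I x * g x = h x"
      using h(2) by (rule AE_completion)
    have hm: "h \<in> borel_measurable lebesgue"
      using h(1) by (rule measurable_completion)
    have "integrable lebesgue h"
      using integrable_cong_AE[OF borel_measurable_integrable[OF iN] hm h'] iN by simp
    then have hi: "integrable lborel h"
      using h(1) integrable_completion by blast
    have "(LINT x|lborel. indicator {a<..<b} x * h x) = 0" for a b
    proof -
      have m: "(\<lambda>x. indicator {a<..<b} x * h x) \<in> borel_measurable lborel"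
        using h(1) by measurable
      have "(LINT x|lborel. indicator {a<..<b} x * h x) = (LINT x|lebesgue. indicator {a<..<b} x * h x)"
        using integral_completion[OF m] by simp
      also have "\<dots> = (LINT x|lebesgue. indicator {max a (- real N)<..<min b (real N)} x * g x)"
      proof (rule integral_cong_AE)
        show "(\<lambda>x. indicator {a<..<b} x * h x) \<in> borel_measurable lebesgue"
          using m by (rule measurable_completion)
        show "(\<lambda>x. indicator {max a (- real N)<..<min b (real N)} x * g x) \<in> borel_measurable lebesgue"
          by (rule borel_measurable_integrable, rule gi[of _ "- real N" "real N"]) auto
        show "AE x in lebesgue. indicator {a<..<b} x * h x
            = indicator {max a (- real N)<..<min b (real N)} x * g x"
          using h' by eventually_elim (auto simp: indicator_def split: if_splits)
      qed
      also have "\<dots> = 0" by (rule Z)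
      finally show ?thesis .
    qed
    then have "AE x in lborel. h x = 0"
      by (rule interval_integrals_zero_imp_AE_zero[OF hi])
    then have "AE x in lebesgue. h x = 0"
      by (rule AE_completion)
    moreover have "AE x in lebesgue. x \<noteq> - real N" "AE x in lebesgue. x \<noteq> real N"
      by (auto intro!: AE_completion AE_lborel_singleton)
    ultimately show ?thesis using h'
      by eventually_elim (auto simp: indicator_def split: if_splits)
  qed
  then have "AE x in lebesgue. \<forall>N::nat. x \<in> {- real N..real N} \<longrightarrow> g x = 0"
    unfolding AE_all_countable ..
  then show ?thesis
  proof eventually_elim
    case (elim x)
    obtain N :: nat where "\<bar>x\<bar> \<le> real N" using real_arch_simple by blast
    then have "x \<in> {- real N..real N}" by auto
    with elim show ?case by blast
  qed
qed

lemma locally_integrable_add: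
  "locally_integrable f \<Longrightarrow> locally_integrable g \<Longrightarrow> locally_integrable (\<lambda>x. f x + g x)"
  unfolding locally_integrable_def by (blast intro: set_integral_add(1))

lemma locally_integrable_cmult:
  "locally_integrable f \<Longrightarrow> locally_integrable (\<lambda>x. r * f x)"
  by (auto simp: locally_integrable_def)

lemma has_weak_deriv_add:
  assumes "has_weak_deriv f f'" "has_weak_deriv g g'"
  shows "has_weak_deriv (\<lambda>x. f x + g x) (\<lambda>x. f' x + g' x)"
proof -
  have l: "locally_integrable f" "locally_integrable f'" "locally_integrable g" "locally_integrable g'"
    using assms by (auto simp: has_weak_deriv_def)
  show ?thesis
    unfolding has_weak_deriv_def
  proof (intro conjI allI impI)
    fix \<psi> assume p: "test_function \<psi>"
    show "(LINT x|lebesgue. (f x + g x) * deriv \<psi> x) = - (LINT x|lebesgue. (f' x + g' x) * \<psi> x)"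
      using assms p l[THEN locally_integrable_test(1)[OF _ p]] l[THEN locally_integrable_test(2)[OF _ p]]
      by (simp add: has_weak_deriv_def distrib_right)
  qed (use l in \<open>auto intro: locally_integrable_add\<close>)
qed

lemma has_weak_deriv_cmult:
  assumes "has_weak_deriv f f'"
  shows "has_weak_deriv (\<lambda>x. r * f x) (\<lambda>x. r * f' x)"
  using assms by (auto simp: has_weak_deriv_def mult.assoc locally_integrable_cmult)

lemma has_weak_deriv_unique:
  assumes "has_weak_deriv f g" "has_weak_deriv f h"
  shows "AE x in lebesgue. g x = h x"
proof -
  have d: "has_weak_deriv (\<lambda>x. f x + (-1) * f x) (\<lambda>x. g x + (-1) * h x)"
    by (intro has_weak_deriv_add has_weak_deriv_cmult assms)
  then have "AE x in lebesgue. g x + (-1) * h x = 0"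
    by (intro test_integrals_zero_imp_AE_zero) (auto simp: has_weak_deriv_def)
  then show ?thesis by eventually_elim simp
qed

lemma weak_deriv_has_weak_deriv:
  "has_weak_deriv f g \<Longrightarrow> has_weak_deriv f (weak_deriv f)"
  unfolding weak_deriv_def by (rule someI[of "has_weak_deriv f"])

lemma weak_deriv_AE_eq:
  "has_weak_deriv f g \<Longrightarrow> AE x in lebesgue. weak_deriv f x = g x"
  using has_weak_deriv_unique weak_deriv_has_weak_deriv by blast

lemma locally_integrable_cong_AE:
  assumes "locally_integrable f" "g \<in> borel_measurable lebesgue" "AE x in lebesgue. f x = g x"
  shows "locally_integrable g"
  unfolding locally_integrable_def set_integrable_def
proof (intro allI)
  fix a b :: real
  have i: "integrable lebesgue (\<lambda>x. indicator {a..b} x *\<^sub>R f x)"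
    using assms(1) by (simp add: locally_integrable_def set_integrable_def)
  show "integrable lebesgue (\<lambda>x. indicator {a..b} x *\<^sub>R g x)"
  proof (rule integrable_cong_AE_imp[OF i])
    show "(\<lambda>x. indicator {a..b} x *\<^sub>R g x) \<in> borel_measurable lebesgue"
      using assms(2) by (intro borel_measurable_scaleR borel_measurable_indicator) auto
    show "AE x in lebesgue. indicator {a..b} x *\<^sub>R f x = indicator {a..b} x *\<^sub>R g x"
      using assms(3) by eventually_elim simp
  qed
qed

lemma has_weak_deriv_cong_AE:
  assumes d: "has_weak_deriv f f'" and m: "g \<in> borel_measurable lebesgue"
    and e: "AE x in lebesgue. f x = g x"
  shows "has_weak_deriv g f'"
proof -
  have lf: "locally_integrable f" using d by (simp add: has_weak_deriv_def)
  have lg: "locally_integrable g"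
    by (rule locally_integrable_cong_AE[OF lf m e])
  have "(LINT x|lebesgue. g x * deriv \<psi> x) = (LINT x|lebesgue. f x * deriv \<psi> x)"
    if p: "test_function \<psi>" for \<psi>
  proof (rule integral_cong_AE)
    show "AE x in lebesgue. g x * deriv \<psi> x = f x * deriv \<psi> x"
      using e by eventually_elim simp
  qed (use locally_integrable_test(2)[OF lf p] locally_integrable_test(2)[OF lg p] in
      \<open>auto intro: borel_measurable_integrable\<close>)
  then show ?thesis using d lg by (simp add: has_weak_deriv_def)
qed

subsection \<open>Square integrable functions\<close>

lemma square_integrable_mult:
  assumes "square_integrable f" "square_integrable g"
  shows "integrable lebesgue (\<lambda>x. f x * g x)"
proof (rule Bochner_Integration.integrable_bound[where f = "\<lambda>x. (f x)\<^sup>2 + (g x)\<^sup>2"])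
  show "integrable lebesgue (\<lambda>x. (f x)\<^sup>2 + (g x)\<^sup>2)"
    "(\<lambda>x. f x * g x) \<in> borel_measurable lebesgue"
    using assms by (auto simp: square_integrable_def)
  show "AE x in lebesgue. norm (f x * g x) \<le> norm ((f x)\<^sup>2 + (g x)\<^sup>2)"
  proof (intro AE_I2)
    fix x
    have "0 \<le> (\<bar>f x\<bar> - \<bar>g x\<bar>)\<^sup>2" "0 \<le> \<bar>f x\<bar> * \<bar>g x\<bar>" by simp_all
    then have "\<bar>f x\<bar> * \<bar>g x\<bar> \<le> (f x)\<^sup>2 + (g x)\<^sup>2"
      by (simp add: power2_diff del: zero_le_mult_iff mult_nonneg_nonneg)
    then show "norm (f x * g x) \<le> norm ((f x)\<^sup>2 + (g x)\<^sup>2)"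
      by (simp add: abs_mult)
  qed
qed

lemma square_integrable_add:
  assumes "square_integrable f" "square_integrable g"
  shows "square_integrable (\<lambda>x. f x + g x)"
  using assms square_integrable_mult[OF assms]
  by (auto simp: square_integrable_def power2_sum mult.assoc)

lemma square_integrable_cmult:
  "square_integrable f \<Longrightarrow> square_integrable (\<lambda>x. r * f x)"
  by (auto simp: square_integrable_def power_mult_distrib)

lemma square_integrable_zero: "square_integrable (\<lambda>_. 0)"
  by (simp add: square_integrable_def)

lemma square_integrable_cong_AE:
  assumes "square_integrable f" "g \<in> borel_measurable lebesgue" "AE x in lebesgue. f x = g x"
  shows "square_integrable g"
proof -
  have "integrable lebesgue (\<lambda>x. (g x)\<^sup>2)"
  proof (rule integrable_cong_AE_imp[where g = "\<lambda>x. (f x)\<^sup>2"])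
    show "AE x in lebesgue. (f x)\<^sup>2 = (g x)\<^sup>2"
      using assms(3) by eventually_elim simp
  qed (use assms in \<open>auto simp: square_integrable_def\<close>)
  with assms(2) show ?thesis by (simp add: square_integrable_def)
qed

subsection \<open>The Hilbert space \<open>H\<^sup>1\<close>\<close>

lemma weak_deriv_square_integrable:
  assumes "in_H1 f" shows "square_integrable (weak_deriv f)"
proof -
  obtain g where g: "square_integrable g" "has_weak_deriv f g"
    using assms by (auto simp: in_H1_def)
  have l: "locally_integrable (weak_deriv f)"
    using weak_deriv_has_weak_deriv[OF g(2)] by (simp add: has_weak_deriv_def)
  have m: "weak_deriv f \<in> borel_measurable lebesgue"
  proof (rule borel_measurable_LIMSEQ_real)
    show "(\<lambda>k. indicator {- real k..real k} x *\<^sub>R weak_deriv f x) \<longlonglongrightarrow> weak_deriv f x" for x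
    proof (rule tendsto_eventually)
      have "\<forall>\<^sub>F k in sequentially. \<bar>x\<bar> < real k"
        using filterlim_at_top_dense filterlim_real_sequentially by blast
      then show "\<forall>\<^sub>F k in sequentially. indicator {- real k..real k} x *\<^sub>R weak_deriv f x = weak_deriv f x"
        by eventually_elim (auto simp: indicator_def)
    qed
    show "(\<lambda>x. indicator {- real k..real k} x *\<^sub>R weak_deriv f x) \<in> borel_measurable lebesgue" for k
      using l by (auto simp: locally_integrable_def set_integrable_def intro!: borel_measurable_integrable)
  qed
  show ?thesis
    by (rule square_integrable_cong_AE[OF g(1) m]) (use weak_deriv_AE_eq[OF g(2)] in \<open>eventually_elim, simp\<close>)
qed

lemma in_H1_has_weak_deriv: "in_H1 f \<Longrightarrow> has_weak_deriv f (weak_deriv f)"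
  by (auto simp: in_H1_def intro: weak_deriv_has_weak_deriv)

lemma in_H1_square_integrable: "in_H1 f \<Longrightarrow> square_integrable f"
  by (simp add: in_H1_def)

lemma in_H1_add: "in_H1 f \<Longrightarrow> in_H1 g \<Longrightarrow> in_H1 (\<lambda>x. f x + g x)"
  unfolding in_H1_def by (blast intro: square_integrable_add has_weak_deriv_add)

lemma in_H1_cmult: "in_H1 f \<Longrightarrow> in_H1 (\<lambda>x. r * f x)"
  unfolding in_H1_def by (blast intro: square_integrable_cmult has_weak_deriv_cmult)

lemma in_H1_zero: "in_H1 (\<lambda>_. 0)"
proof -
  have "has_weak_deriv (\<lambda>_. 0) (\<lambda>_. 0)"
    by (simp add: has_weak_deriv_def locally_integrable_def)
  then show ?thesis unfolding in_H1_def using square_integrable_zero by blast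
qed

quotient_type h1 = "real \<Rightarrow> real" / partial:
  "\<lambda>f g. in_H1 f \<and> in_H1 g \<and> (AE x in lebesgue. f x = g x)"
proof (rule part_equivpI)
  show "\<exists>f. in_H1 f \<and> in_H1 f \<and> (AE x in lebesgue. f x = f x)"
    using in_H1_zero by auto
  show "symp (\<lambda>f g. in_H1 f \<and> in_H1 g \<and> (AE x in lebesgue. f x = g x))"
    by (auto simp: symp_def eq_commute)
  show "transp (\<lambda>f g. in_H1 f \<and> in_H1 g \<and> (AE x in lebesgue. f x = g x))"
  proof (rule transpI)
    fix f g h
    assume 1: "in_H1 f \<and> in_H1 g \<and> (AE x in lebesgue. f x = g x)"
      and 2: "in_H1 g \<and> in_H1 h \<and> (AE x in lebesgue. g x = h x)"
    from 1 2 have "AE x in lebesgue. f x = g x" "AE x in lebesgue. g x = h x" by auto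
    then have "AE x in lebesgue. f x = h x" by eventually_elim simp
    with 1 2 show "in_H1 f \<and> in_H1 h \<and> (AE x in lebesgue. f x = h x)" by simp
  qed
qed

text \<open>For \<open>f\<close> with \<open>in_H1 f\<close>, \<^term>\<open>abs_h1 f\<close> is the almost-everywhere class of \<open>f\<close>; outside
  \<^const>\<open>in_H1\<close> the value of \<^const>\<open>abs_h1\<close> is meaningless.\<close>

definition H1_inner :: "(real \<Rightarrow> real) \<Rightarrow> (real \<Rightarrow> real) \<Rightarrow> real" where
  "H1_inner f g = (LINT x|lebesgue. f x * g x) + (LINT x|lebesgue. weak_deriv f x * weak_deriv g x)"

lemma weak_deriv_cong_AE:
  assumes "in_H1 f" "in_H1 g" "AE x in lebesgue. f x = g x"
  shows "AE x in lebesgue. weak_deriv f x = weak_deriv g x"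
proof -
  have "has_weak_deriv g (weak_deriv f)"
    by (rule has_weak_deriv_cong_AE[OF in_H1_has_weak_deriv[OF assms(1)] _ assms(3)])
      (use assms(2) in \<open>simp add: in_H1_def square_integrable_def\<close>)
  then show ?thesis
    using has_weak_deriv_unique in_H1_has_weak_deriv[OF assms(2)] by blast
qed

lemma integral_mult_cong_AE:
  assumes "square_integrable f" "square_integrable g" "square_integrable f'" "square_integrable g'"
    and "AE x in lebesgue. f x = f' x" "AE x in lebesgue. g x = g' x"
  shows "(LINT x|lebesgue. f x * g x) = (LINT x|lebesgue. f' x * g' x)"
proof (rule integral_cong_AE)
  show "AE x in lebesgue. f x * g x = f' x * g' x"
    using assms(5,6) by eventually_elim simp
qed (use assms in \<open>auto simp: square_integrable_def\<close>)

lemma H1_inner_cong_AE: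
  assumes "in_H1 f" "in_H1 f'" "AE x in lebesgue. f x = f' x"
    and "in_H1 g" "in_H1 g'" "AE x in lebesgue. g x = g' x"
  shows "H1_inner f g = H1_inner f' g'"
  unfolding H1_inner_def
  using assms weak_deriv_cong_AE[OF assms(1-3)] weak_deriv_cong_AE[OF assms(4-6)]
  by (intro arg_cong2[where f = "(+)"] integral_mult_cong_AE)
    (auto intro: in_H1_square_integrable weak_deriv_square_integrable)

lemma weak_deriv_add:
  assumes "in_H1 f" "in_H1 g"
  shows "AE x in lebesgue. weak_deriv (\<lambda>x. f x + g x) x = weak_deriv f x + weak_deriv g x"
  by (rule weak_deriv_AE_eq) (intro has_weak_deriv_add in_H1_has_weak_deriv assms)

lemma weak_deriv_cmult:
  assumes "in_H1 f"
  shows "AE x in lebesgue. weak_deriv (\<lambda>x. r * f x) x = r * weak_deriv f x"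
  by (rule weak_deriv_AE_eq) (intro has_weak_deriv_cmult in_H1_has_weak_deriv assms)

lemma H1_inner_add:
  assumes f: "in_H1 f" and g: "in_H1 g" and h: "in_H1 h"
  shows "H1_inner (\<lambda>x. f x + g x) h = H1_inner f h + H1_inner g h"
proof -
  note s = in_H1_square_integrable weak_deriv_square_integrable
  have "(LINT x|lebesgue. weak_deriv (\<lambda>x. f x + g x) x * weak_deriv h x)
      = (LINT x|lebesgue. (weak_deriv f x + weak_deriv g x) * weak_deriv h x)"
    by (rule integral_mult_cong_AE)
      (use weak_deriv_add[OF f g] in \<open>auto intro!: s(2) in_H1_add square_integrable_add f g h\<close>)
  also have "\<dots> = (LINT x|lebesgue. weak_deriv f x * weak_deriv h x)
      + (LINT x|lebesgue. weak_deriv g x * weak_deriv h x)"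
    unfolding distrib_right
    by (intro Bochner_Integration.integral_add square_integrable_mult s f g h)
  finally show ?thesis
    using square_integrable_mult[OF s(1)[OF f] s(1)[OF h]] square_integrable_mult[OF s(1)[OF g] s(1)[OF h]]
    by (simp add: H1_inner_def distrib_right)
qed

lemma H1_inner_cmult:
  assumes f: "in_H1 f" and h: "in_H1 h"
  shows "H1_inner (\<lambda>x. r * f x) h = r * H1_inner f h"
proof -
  note s = in_H1_square_integrable weak_deriv_square_integrable
  have "(LINT x|lebesgue. weak_deriv (\<lambda>x. r * f x) x * weak_deriv h x)
      = (LINT x|lebesgue. (r * weak_deriv f x) * weak_deriv h x)"
    by (rule integral_mult_cong_AE)
      (use weak_deriv_cmult[OF f] in \<open>auto intro!: s(2) in_H1_cmult square_integrable_cmult f h\<close>)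
  then show ?thesis
    by (simp add: H1_inner_def mult.assoc distrib_left)
qed

lemma H1_inner_eq_0:
  assumes f: "in_H1 f" and z: "H1_inner f f = 0"
  shows "AE x in lebesgue. f x = 0"
proof -
  have "(LINT x|lebesgue. f x * f x) \<ge> 0" "(LINT x|lebesgue. weak_deriv f x * weak_deriv f x) \<ge> 0"
    by (auto intro!: Bochner_Integration.integral_nonneg)
  with z have "(LINT x|lebesgue. f x * f x) = 0" unfolding H1_inner_def by linarith
  moreover have "integrable lebesgue (\<lambda>x. f x * f x)"
    using f by (intro square_integrable_mult in_H1_square_integrable)
  ultimately have "AE x in lebesgue. f x * f x = 0"
    by (subst (asm) integral_nonneg_eq_0_iff_AE) auto
  then show ?thesis by simp
qed

instantiation h1 :: real_inner
begin

lift_definition zero_h1 :: h1 is "\<lambda>_. 0"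
  by (simp add: in_H1_zero)

lift_definition plus_h1 :: "h1 \<Rightarrow> h1 \<Rightarrow> h1" is "\<lambda>f g x. f x + g x"
proof -
  fix f f' g g'
  assume 1: "in_H1 f \<and> in_H1 f' \<and> (AE x in lebesgue. f x = f' x)"
    and 2: "in_H1 g \<and> in_H1 g' \<and> (AE x in lebesgue. g x = g' x)"
  from 1 2 have "AE x in lebesgue. f x = f' x" "AE x in lebesgue. g x = g' x" by auto
  then have "AE x in lebesgue. f x + g x = f' x + g' x" by eventually_elim simp
  with 1 2 show "in_H1 (\<lambda>x. f x + g x) \<and> in_H1 (\<lambda>x. f' x + g' x)
      \<and> (AE x in lebesgue. f x + g x = f' x + g' x)"
    by (simp add: in_H1_add)
qed

lift_definition scaleR_h1 :: "real \<Rightarrow> h1 \<Rightarrow> h1" is "\<lambda>r f x. r * f x"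
  by (auto simp: in_H1_cmult elim: eventually_mono)

definition uminus_h1 :: "h1 \<Rightarrow> h1" where "- v = (-1) *\<^sub>R v" for v :: h1

definition minus_h1 :: "h1 \<Rightarrow> h1 \<Rightarrow> h1" where "v - w = v + - w" for v w :: h1

lift_definition inner_h1 :: "h1 \<Rightarrow> h1 \<Rightarrow> real" is H1_inner
  by (blast intro: H1_inner_cong_AE)

definition norm_h1 :: "h1 \<Rightarrow> real" where "norm v = sqrt (inner v v)" for v :: h1

definition sgn_h1 :: "h1 \<Rightarrow> h1" where "sgn v = inverse (norm v) *\<^sub>R v" for v :: h1

definition dist_h1 :: "h1 \<Rightarrow> h1 \<Rightarrow> real" where "dist v w = norm (v - w)" for v w :: h1

definition uniformity_h1 :: "(h1 \<times> h1) filter" where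
  "uniformity_h1 = (INF e\<in>{0<..}. principal {(v, w). dist v w < e})"

definition open_h1 :: "h1 set \<Rightarrow> bool" where
  "open_h1 U = (\<forall>v\<in>U. \<forall>\<^sub>F (v', w) in uniformity. v' = v \<longrightarrow> w \<in> U)"

instance
proof
  fix u v w :: h1 and r s :: real
  show "u + v + w = u + (v + w)"
    by transfer (auto simp: in_H1_add add.assoc)
  show "u + v = v + u"
    by transfer (auto simp: in_H1_add add.commute)
  show "0 + u = u"
    by transfer (auto simp: in_H1_add in_H1_zero)
  show "- u + u = 0"
    unfolding uminus_h1_def
    by transfer (use in_H1_add[OF in_H1_cmult[of _ "-1"]] in \<open>auto simp: in_H1_zero\<close>)
  show "u - v = u + - v"
    by (rule minus_h1_def)
  show "r *\<^sub>R (u + v) = r *\<^sub>R u + r *\<^sub>R v"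
    by transfer (use in_H1_add in_H1_cmult in \<open>auto simp: distrib_left\<close>)
  show "(r + s) *\<^sub>R u = r *\<^sub>R u + s *\<^sub>R u"
    by transfer (use in_H1_add in_H1_cmult in \<open>auto simp: distrib_right\<close>)
  show "r *\<^sub>R s *\<^sub>R u = (r * s) *\<^sub>R u"
    by transfer (use in_H1_cmult in \<open>auto simp: mult.assoc\<close>)
  show "1 *\<^sub>R u = u"
    by transfer auto
  show "sgn u = inverse (norm u) *\<^sub>R u"
    by (rule sgn_h1_def)
  show "dist u v = norm (u - v)"
    by (rule dist_h1_def)
  show "(uniformity :: (h1 \<times> h1) filter) = (INF e\<in>{0<..}. principal {(v, w). dist v w < e})"
    by (rule uniformity_h1_def)
  show "open U \<longleftrightarrow> (\<forall>v\<in>U. \<forall>\<^sub>F (v', w) in uniformity. v' = v \<longrightarrow> w \<in> U)" for U :: "h1 set"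
    by (rule open_h1_def)
  show "inner u v = inner v u"
    by transfer (simp add: H1_inner_def mult.commute)
  show "inner (u + v) w = inner u w + inner v w"
    by transfer (simp add: H1_inner_add)
  show "inner (r *\<^sub>R u) v = r * inner u v"
    by transfer (simp add: H1_inner_cmult)
  show "0 \<le> inner u u"
    by transfer (auto simp: H1_inner_def intro!: add_nonneg_nonneg Bochner_Integration.integral_nonneg)
  have "inner (0::h1) 0 = 0"
    using \<open>inner (r *\<^sub>R u) v = r * inner u v\<close>
    by transfer (use H1_inner_cmult[OF in_H1_zero in_H1_zero, of 0] in simp)
  moreover have "inner u u = 0 \<Longrightarrow> u = 0"
    by transfer (auto simp: in_H1_zero H1_inner_eq_0)
  ultimately show "inner u u = 0 \<longleftrightarrow> u = 0" by blast
  show "norm u = sqrt (inner u u)"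
    by (rule norm_h1_def)
qed

end

lemma norm_abs_h1:
  assumes "in_H1 f"
  shows "norm (abs_h1 f)
    = sqrt ((LINT x|lebesgue. (f x)\<^sup>2) + (LINT x|lebesgue. (weak_deriv f x)\<^sup>2))"
  using assms by (simp add: norm_h1_def inner_h1.abs_eq H1_inner_def power2_eq_square)

section \<open>The magma equation\<close>

text \<open>Weak formulation of \<open>- (\<phi>\<^sup>n u\<^sub>z)\<^sub>z + \<phi>\<^sup>m u = - (\<phi>\<^sup>n)\<^sub>z\<close>.\<close>

definition elliptic_weak_solution ::
    "real \<Rightarrow> real \<Rightarrow> (real \<Rightarrow> real) \<Rightarrow> (real \<Rightarrow> real) \<Rightarrow> bool" where
  "elliptic_weak_solution n m \<phi> u \<longleftrightarrow> in_H1 u \<and>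
     (\<forall>w. in_H1 w \<longrightarrow>
        (LINT z|lebesgue. \<phi> z powr n * weak_deriv u z * weak_deriv w z)
          + (LINT z|lebesgue. \<phi> z powr m * u z * w z)
        = - (LINT z|lebesgue. weak_deriv (\<lambda>z. \<phi> z powr n) z * w z))"

definition C1_on_halfline :: "(real \<Rightarrow> 'a::real_normed_vector) \<Rightarrow> bool" where
  "C1_on_halfline v \<longleftrightarrow>
     (\<exists>v'. continuous_on {0..} v' \<and>
        (\<forall>t\<ge>0. (v has_vector_derivative v' t) (at t within {0..})))"

text \<open>\<open>\<phi> t\<close> is the profile at time \<open>t\<close>, and only \<open>t \<ge> 0\<close> matters. Of the almost-everywhere class of
  \<open>\<phi>(\<cdot>,t)\<close> we take the continuous representative, and \<open>\<phi> > 0\<close> is meant pointwise for it. The time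
  integral is an integral of \<open>H\<^sup>1\<close>-valued functions; \<open>\<phi>\<^sup>m u \<in> H\<^sup>1\<close> is automatic for such \<open>\<phi>\<close> and \<open>u\<close>
  and is stated so that \<^const>\<open>abs_h1\<close> is visibly applied inside its domain. At \<open>t = 0\<close> the integral
  equation is the initial condition.\<close>

definition magma_solution ::
    "real \<Rightarrow> real \<Rightarrow> (real \<Rightarrow> real) \<Rightarrow> (real \<Rightarrow> real \<Rightarrow> real) \<Rightarrow> bool" where
  "magma_solution n m \<phi>\<^sub>0 \<phi> \<longleftrightarrow>
     (\<forall>t\<ge>0. continuous_on UNIV (\<phi> t) \<and> (\<forall>z. \<phi> t z > 0) \<and> in_H1 (\<lambda>z. \<phi> t z - 1)) \<and>
     C1_on_halfline (\<lambda>t. abs_h1 (\<lambda>z. \<phi> t z - 1)) \<and>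
     (\<exists>u. (\<forall>s\<ge>0. elliptic_weak_solution n m (\<phi> s) (u s) \<and>
             (\<forall>v. elliptic_weak_solution n m (\<phi> s) v \<longrightarrow> (AE z in lebesgue. v z = u s z)) \<and>
             in_H1 (\<lambda>z. \<phi> s z powr m * u s z)) \<and>
          (\<forall>t\<ge>0. ((\<lambda>s. abs_h1 (\<lambda>z. \<phi> s z powr m * u s z)) has_integral
                    (abs_h1 (\<lambda>z. \<phi> t z - 1) - abs_h1 (\<lambda>z. \<phi>\<^sub>0 z - 1))) {0..t}))"

end

theory Submission
  imports Defs
begin

text \<open>Write \<open>\<phi> = 1 + v\<close> with \<open>v \<in> H\<^sup>1\<close>. On the ball \<open>\<parallel>v\<parallel> \<le> 1/4\<close> the Sobolev embedding keeps \<open>\<phi>\<close> between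
  \<open>1/2\<close> and \<open>3/2\<close>, so the elliptic problem is uniformly coercive and its solution \<open>u\<close> depends
  Lipschitz continuously on \<open>v\<close>; hence the equation is the ordinary differential equation
  \<open>v' = \<phi>\<^sup>m u\<close> in the Banach space \<open>H\<^sup>1\<close> with a Lipschitz vector field. Let \<open>g(1) = G(1) = 0\<close>,
  \<open>g' = y powr (- n - m)\<close> and \<open>G' = g\<close>. Testing the elliptic equation with \<open>g(\<phi>)\<close> shows that
  \<open>\<integral> G(\<phi>) + \<phi> powr (- 2 m) \<phi>\<^sub>z\<^sup>2 / 2\<close> is conserved. Near \<open>\<phi> = 1\<close> this energy is comparable to
  \<open>\<parallel>v\<parallel>\<^sup>2\<close>, so by continuity a solution with small data never leaves the ball. This gives global
  existence (the vector field is precomposed with the retraction onto the ball, which the solution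
  does not notice) and, by Gronwall's argument, uniqueness among all solutions.\<close>

text \<open>The term (phi^n)_z costs a derivative, but the elliptic problem only needs it in L^2 and
  returns u in H^1. The velocity phi^m u therefore depends Lipschitz continuously on v in H^1
  itself, and no smoother space or approximation enters. The energy is found by cancellation. With
  phi_t = phi^m u, the time derivative of p(phi) phi_z^2 / 2 contains multiples of u phi_z^2, which
  cancel exactly for p = y powr (-2m), leaving phi^(-m) phi_z u_z. This equals phi^n u_z (g(phi))_z
  when g' = y powr (-n-m), and G' = g accounts for phi^m u g(phi). Since phi_z enters quadratically,
  the energy is differentiable on H^1 without further regularity. The obstacle in uniqueness is that
  a competing solution satisfies only an integral equation and might leave the ball, outside which
  the vector field is not controlled. The a priori bound is therefore formulated for any curve that
  solves the differential equation as long as it stays in the ball.\<close>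

lemma continuous_imp_measurable_lebesgue:
  "continuous_on UNIV h \<Longrightarrow> h \<in> borel_measurable lebesgue" for h :: "real \<Rightarrow> real"
  by (intro measurable_completion) (auto intro: borel_measurable_continuous_onI)

lemma locally_integrable_integrable_on:
  assumes "locally_integrable f"
  shows "f integrable_on {a..b}" "(\<lambda>x. \<bar>f x\<bar>) integrable_on {a..b}"
  using assms by (auto simp: locally_integrable_def absolutely_integrable_on_def)

lemma locally_integrable_measurable:
  assumes "locally_integrable f" shows "f \<in> borel_measurable lebesgue"
proof (rule borel_measurable_LIMSEQ_real)
  show "(\<lambda>x. indicator {- real k..real k} x *\<^sub>R f x) \<in> borel_measurable lebesgue" for k
    using assms by (auto simp: locally_integrable_def set_integrable_def intro!: borel_measurable_integrable)
  show "(\<lambda>k. indicator {- real k..real k} x *\<^sub>R f x) \<longlonglongrightarrow> f x" for x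
  proof (rule tendsto_eventually)
    have "\<forall>\<^sub>F k in sequentially. \<bar>x\<bar> < real k"
      using filterlim_at_top_dense filterlim_real_sequentially by blast
    then show "\<forall>\<^sub>F k in sequentially. indicator {- real k..real k} x *\<^sub>R f x = f x"
      by eventually_elim (auto simp: indicator_def)
  qed
qed

lemma locally_integrable_continuous_mult:
  assumes h: "continuous_on UNIV h" and f: "locally_integrable f"
  shows "locally_integrable (\<lambda>x. h x * f x)"
  unfolding locally_integrable_def
proof (intro allI)
  fix a b :: real
  have "bounded (h ` {a..b})"
    by (intro compact_imp_bounded compact_continuous_image continuous_on_subset[OF h]) auto
  then obtain B where B: "\<And>x. x \<in> {a..b} \<Longrightarrow> \<bar>h x\<bar> \<le> B"
    by (metis bounded_iff image_eqI real_norm_def)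
  have i: "integrable lebesgue (\<lambda>x. indicator {a..b} x * f x)"
    using f by (simp add: locally_integrable_def set_integrable_def)
  have "integrable lebesgue (\<lambda>x. h x * (indicator {a..b} x * f x))"
  proof (rule Bochner_Integration.integrable_bound[where f = "\<lambda>x. B * (indicator {a..b} x * f x)"])
    show "AE x in lebesgue. norm (h x * (indicator {a..b} x * f x)) \<le> norm (B * (indicator {a..b} x * f x))"
    proof (intro AE_I2)
      fix x
      have "\<bar>h x\<bar> * \<bar>f x\<bar> \<le> \<bar>B\<bar> * \<bar>f x\<bar>" if "x \<in> {a..b}"
        using B[OF that] by (intro mult_right_mono) auto
      then show "norm (h x * (indicator {a..b} x * f x)) \<le> norm (B * (indicator {a..b} x * f x))"
        by (cases "x \<in> {a..b}") (simp_all add: abs_mult)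
    qed
    show "(\<lambda>x. h x * (indicator {a..b} x * f x)) \<in> borel_measurable lebesgue"
      by (intro borel_measurable_times continuous_imp_measurable_lebesgue[OF h] borel_measurable_integrable[OF i])
  qed (use i in simp)
  moreover have "(\<lambda>x. h x * (indicator {a..b} x * f x)) = (\<lambda>x. indicator {a..b} x *\<^sub>R (h x * f x))"
    by (simp add: fun_eq_iff)
  ultimately show "(\<lambda>x. h x * f x) absolutely_integrable_on {a..b}"
    by (simp only: set_integrable_def)
qed

lemma locally_integrable_continuous:
  "continuous_on UNIV f \<Longrightarrow> locally_integrable f"
  unfolding locally_integrable_def
  using absolutely_integrable_continuous_real continuous_on_subset subset_UNIV by metis

subsection \<open>Primitives of locally integrable functions\<close>

text \<open>These are the locally absolutely continuous functions. Encoding them by increments fixes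
  the density \<open>g\<close> pointwise and avoids almost-everywhere differentiation.\<close>

definition primitive :: "(real \<Rightarrow> real) \<Rightarrow> (real \<Rightarrow> real) \<Rightarrow> bool" where
  "primitive f g \<longleftrightarrow> locally_integrable g \<and> (\<forall>a b. a \<le> b \<longrightarrow> f b - f a = integral {a..b} g)"

lemma primitive_continuous:
  assumes "primitive f g" shows "continuous_on UNIV f"
proof (intro continuous_at_imp_continuous_on ballI)
  fix x :: real
  have "continuous_on {x-1..x+1} (\<lambda>y. f (x-1) + integral {x-1..y} g)"
    using assms by (intro continuous_intros indefinite_integral_continuous_1)
      (auto simp: primitive_def locally_integrable_integrable_on)
  moreover have "f (x-1) + integral {x-1..y} g = f y" if "y \<in> {x-1..x+1}" for y
    using assms that unfolding primitive_def by (smt (verit) atLeastAtMost_iff)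
  ultimately have "continuous_on {x-1..x+1} f"
    by (rule continuous_on_eq)
  then have "continuous_on {x-1<..<x+1} f" by (rule continuous_on_subset) auto
  then show "isCont f x" by (simp add: continuous_on_eq_continuous_at)
qed

text \<open>The error of the chain rule on \<open>{a..b}\<close> is additive in the interval, and on short intervals
  it is at most \<open>\<epsilon>\<close> times the integral of \<open>\<bar>g\<bar>\<close> by the mean value theorem.\<close>

lemma primitive_chain:
  assumes p: "primitive f g"
    and F: "\<And>x. (F has_real_derivative F' (f x)) (at (f x))"
    and F': "continuous_on (range f) F'"
  shows "primitive (\<lambda>x. F (f x)) (\<lambda>x. F' (f x) * g x)"
proof -
  have cf: "continuous_on UNIV f" by (rule primitive_continuous[OF p])
  have lg: "locally_integrable g" and fg: "\<And>a b. a \<le> b \<Longrightarrow> f b - f a = integral {a..b} g"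
    using p by (auto simp: primitive_def)
  have cF': "continuous_on UNIV (\<lambda>x. F' (f x))"
    by (rule continuous_on_compose2[OF F' cf]) auto
  have l: "locally_integrable (\<lambda>x. F' (f x) * g x)"
    by (rule locally_integrable_continuous_mult[OF cF' lg])
  note i = locally_integrable_integrable_on[OF l] locally_integrable_integrable_on[OF lg]
  define D where "D a b = F (f b) - F (f a) - integral {a..b} (\<lambda>x. F' (f x) * g x)" for a b
  have add: "D a c = D a b + D b c" if "a \<le> b" "b \<le> c" for a b c
    using Henstock_Kurzweil_Integration.integral_combine[OF that i(1)] by (simp add: D_def)
  have "\<bar>D a b\<bar> \<le> e * integral {a..b} (\<lambda>x. \<bar>g x\<bar>)" if ab: "a \<le> b" and e: "e > 0" for a b e
    using ab
  proof (induction rule: Bolzano)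
    case (trans a b c)
    have "integral {a..c} (\<lambda>x. \<bar>g x\<bar>) = integral {a..b} (\<lambda>x. \<bar>g x\<bar>) + integral {b..c} (\<lambda>x. \<bar>g x\<bar>)"
      by (rule Henstock_Kurzweil_Integration.integral_combine[symmetric]) (use trans i in auto)
    then show ?case using trans add[of a b c] by (auto simp: distrib_left)
  next
    case (local x)
    have "isCont (\<lambda>x. F' (f x)) x"
      using cF' by (simp add: continuous_on_eq_continuous_at)
    then obtain d where d: "d > 0" "\<And>y. \<bar>y - x\<bar> < d \<Longrightarrow> \<bar>F' (f y) - F' (f x)\<bar> < e/2"
      using e unfolding continuous_at_eps_delta dist_real_def by (metis half_gt_zero)
    have "\<bar>D a b\<bar> \<le> e * integral {a..b} (\<lambda>x. \<bar>g x\<bar>)" if ab: "a \<le> x" "x \<le> b" "b - a < d" for a b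
    proof -
      have cfab: "continuous_on {a..b} f" using cf by (rule continuous_on_subset) auto
      have mem: "y \<in> f ` {a..b}" if "min (f a) (f b) \<le> y" "y \<le> max (f a) (f b)" for y
        using that ab IVT'[of f a y b] IVT2'[of f b y a] cfab by (auto simp: min_def max_def split: if_splits)
      \<comment> \<open>The mean value point of \<open>F\<close> lies between \<open>f a\<close> and
        \<open>f b\<close>; the intermediate value theorem makes it a value of \<open>f\<close> on
        \<open>{a..b}\<close>, where \<open>F' (f y)\<close> is close to \<open>F' (f x)\<close>. No
        monotonicity of \<open>f\<close> is available.\<close>
      have "\<exists>y0\<in>{a..b}. F (f b) - F (f a) = F' (f y0) * (f b - f a)"
      proof (cases "f a" "f b" rule: linorder_cases)
        case equal then show ?thesis using ab by auto
      next
        case less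
        obtain z where z: "f a < z" "z < f b" "F (f b) - F (f a) = (f b - f a) * F' z"
        proof (rule exE[OF MVT2[OF less, of F F']])
          fix y assume "f a \<le> y" "y \<le> f b"
          then obtain w where "y = f w" using mem[of y] less by auto
          then show "(F has_real_derivative F' y) (at y)" using F by simp
        qed auto
        then obtain w where "w \<in> {a..b}" "z = f w" using mem[of z] less by auto
        then show ?thesis using z by (auto simp: mult.commute)
      next
        case greater
        obtain z where z: "f b < z" "z < f a" "F (f a) - F (f b) = (f a - f b) * F' z"
        proof (rule exE[OF MVT2[OF greater, of F F']])
          fix y assume "f b \<le> y" "y \<le> f a"
          then obtain w where "y = f w" using mem[of y] greater by auto
          then show "(F has_real_derivative F' y) (at y)" using F by simp
        qed auto
        then obtain w where "w \<in> {a..b}" "z = f w" using mem[of z] greater by auto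
        moreover have "F (f b) - F (f a) = F' z * (f b - f a)" using z(3) by (simp add: algebra_simps)
        ultimately show ?thesis by auto
      qed
      then obtain y0 where y0: "y0 \<in> {a..b}" "F (f b) - F (f a) = F' (f y0) * (f b - f a)" by blast
      have "D a b = integral {a..b} (\<lambda>y. F' (f y0) * g y) - integral {a..b} (\<lambda>x. F' (f x) * g x)"
        using y0(2) fg[of a b] ab by (simp add: D_def)
      also have "\<dots> = integral {a..b} (\<lambda>y. F' (f y0) * g y - F' (f y) * g y)"
        by (rule Henstock_Kurzweil_Integration.integral_diff[OF locally_integrable_integrable_on(1)[OF locally_integrable_cmult[OF lg]] i(1), symmetric])
      finally have "\<bar>D a b\<bar> = norm (integral {a..b} (\<lambda>y. F' (f y0) * g y - F' (f y) * g y))" by simp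
      also have "\<dots> \<le> integral {a..b} (\<lambda>y. e * \<bar>g y\<bar>)"
      proof (rule Henstock_Kurzweil_Integration.integral_norm_bound_integral)
        show "(\<lambda>y. F' (f y0) * g y - F' (f y) * g y) integrable_on {a..b}"
          by (rule integrable_diff[OF locally_integrable_integrable_on(1)[OF locally_integrable_cmult[OF lg]] i(1)])
        show "(\<lambda>y. e * \<bar>g y\<bar>) integrable_on {a..b}"
          using integrable_cmul[OF i(4), of e] by simp
        fix y assume y: "y \<in> {a..b}"
        have "\<bar>F' (f y0) - F' (f x)\<bar> < e/2" "\<bar>F' (f y) - F' (f x)\<bar> < e/2"
          using d(2)[of y0] d(2)[of y] y y0(1) ab by auto
        then have "\<bar>F' (f y0) - F' (f y)\<bar> \<le> e" by linarith
        then have "\<bar>F' (f y0) - F' (f y)\<bar> * \<bar>g y\<bar> \<le> e * \<bar>g y\<bar>" by (rule mult_right_mono) simp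
        then show "norm (F' (f y0) * g y - F' (f y) * g y) \<le> e * \<bar>g y\<bar>"
          by (simp add: left_diff_distrib[symmetric] abs_mult)
      qed
      finally show ?thesis by simp
    qed
    then show ?case using d(1) by blast
  qed
  then have le: "\<bar>D a b\<bar> \<le> e * integral {a..b} (\<lambda>x. \<bar>g x\<bar>)" if "a \<le> b" "e > 0" for a b e
    using that by blast
  have "D a b = 0" if ab: "a \<le> b" for a b
  proof (rule ccontr)
    assume nz: "D a b \<noteq> 0"
    define I where "I = integral {a..b} (\<lambda>x. \<bar>g x\<bar>)"
    have "I \<ge> 0" unfolding I_def by (intro Henstock_Kurzweil_Integration.integral_nonneg) (use i in auto)
    \<comment> \<open>The tolerance is the defect itself divided by \<open>I + 1\<close>, so that
      the bound falls strictly below the defect even if \<open>I = 0\<close>.\<close>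
    moreover have "\<bar>D a b\<bar> \<le> \<bar>D a b\<bar> / (I + 1) * I"
      unfolding I_def by (rule le[OF ab]) (use nz \<open>I \<ge> 0\<close> in \<open>simp add: I_def\<close>)
    ultimately show False using nz by (simp add: field_simps)
  qed
  then show ?thesis using l by (simp add: primitive_def D_def)
qed

lemma primitive_add:
  assumes "primitive f g" "primitive f' g'"
  shows "primitive (\<lambda>x. f x + f' x) (\<lambda>x. g x + g' x)"
  using assms unfolding primitive_def
  by (auto simp: locally_integrable_add Henstock_Kurzweil_Integration.integral_add locally_integrable_integrable_on algebra_simps) 

lemma primitive_cmult:
  assumes "primitive f g"
  shows "primitive (\<lambda>x. c * f x) (\<lambda>x. c * g x)"
  using assms unfolding primitive_def
  by (auto simp: locally_integrable_cmult right_diff_distrib[symmetric])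

text \<open>Polarization: a product is a combination of squares, so the Leibniz rule reduces to the
  chain rule for squaring.\<close>

lemma primitive_mult:
  assumes "primitive f f'" "primitive g g'"
  shows "primitive (\<lambda>x. f x * g x) (\<lambda>x. f' x * g x + f x * g' x)"
proof -
  have sq: "primitive (\<lambda>x. (h x)\<^sup>2) (\<lambda>x. (2 * h x) * h' x)" if "primitive h h'" for h h'
    by (rule primitive_chain[OF that]) (auto intro!: derivative_eq_intros continuous_intros)
  have "primitive (\<lambda>x. (1/2) * ((f x + g x)\<^sup>2 + (-1) * ((f x)\<^sup>2 + (g x)\<^sup>2)))
     (\<lambda>x. (1/2) * ((2 * (f x + g x)) * (f' x + g' x) + (-1) * ((2 * f x) * f' x + (2 * g x) * g' x)))"
    by (intro primitive_cmult primitive_add sq assms)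
  moreover have "(\<lambda>x. (1/2) * ((f x + g x)\<^sup>2 + (-1) * ((f x)\<^sup>2 + (g x)\<^sup>2))) = (\<lambda>x. f x * g x)"
    by (simp add: power2_sum fun_eq_iff)
  moreover have "(\<lambda>x. (1/2) * ((2 * (f x + g x)) * (f' x + g' x) + (-1) * ((2 * f x) * f' x + (2 * g x) * g' x)))
      = (\<lambda>x. f' x * g x + f x * g' x)"
    by (simp add: algebra_simps fun_eq_iff)
  ultimately show ?thesis by simp
qed

lemma primitive_C1:
  assumes "\<And>x. (f has_real_derivative f' x) (at x)" "continuous_on UNIV f'"
  shows "primitive f f'"
  unfolding primitive_def
proof (intro conjI allI impI)
  fix a b :: real assume "a \<le> b"
  then have "(f' has_integral (f b - f a)) {a..b}"
    by (intro fundamental_theorem_of_calculus)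
      (use assms in \<open>auto simp: has_real_derivative_iff_has_vector_derivative[symmetric] intro: DERIV_subset\<close>)
  then show "f b - f a = integral {a..b} f'" by (simp add: integral_unique)
qed (intro locally_integrable_continuous assms)

lemma primitive_exists:
  assumes "locally_integrable g" shows "\<exists>f. primitive f g"
proof
  let ?f = "\<lambda>x. if x \<ge> 0 then integral {0..x} g else - integral {x..0} g"
  note i = locally_integrable_integrable_on[OF assms]
  have "?f b - ?f a = integral {a..b} g" if "a \<le> b" for a b
  proof -
    have c: "integral {x..y} g + integral {y..z} g = integral {x..z} g" if "x \<le> y" "y \<le> z" for x y z
      using that i(1) by (rule Henstock_Kurzweil_Integration.integral_combine)
    consider "0 \<le> a" | "a < 0" "0 \<le> b" | "b < 0" by linarith
    then show ?thesis
      using that c[of 0 a b] c[of a 0 b] c[of a b 0] by cases (simp_all add: algebra_simps)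
  qed
  then show "primitive ?f g" using assms by (simp add: primitive_def)
qed

section \<open>Weak derivatives and absolutely continuous representatives\<close>

lemma integral_lebesgue_eq_integral_support:
  assumes "locally_integrable f" "\<And>x. x \<notin> {a..b} \<Longrightarrow> f x = 0"
  shows "integrable lebesgue f" "(LINT x|lebesgue. f x) = integral {a..b} f"
proof -
  have e: "(\<lambda>x. indicator {a..b} x *\<^sub>R f x) = f" using assms(2) by (auto simp: fun_eq_iff indicator_def)
  have "set_integrable lebesgue {a..b} f"
    using assms(1) by (simp add: locally_integrable_def)
  then show "integrable lebesgue f" "(LINT x|lebesgue. f x) = integral {a..b} f"
    using set_lebesgue_integral_eq_integral(2)[of "{a..b}" f]
    by (simp_all add: set_integrable_def set_lebesgue_integral_def e del: real_scaleR_def)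
qed

lemma test_function_primitive:
  "test_function \<psi> \<Longrightarrow> primitive \<psi> (deriv \<psi>)"
  by (intro primitive_C1) (auto intro: test_function_DERIV)

lemma primitive_has_weak_deriv:
  assumes p: "primitive f g" shows "has_weak_deriv f g"
  unfolding has_weak_deriv_def
proof (intro conjI allI impI)
  show lf: "locally_integrable f" by (intro locally_integrable_continuous primitive_continuous[OF p])
  show lg: "locally_integrable g" using p by (simp add: primitive_def)
  fix \<psi> assume t: "test_function \<psi>"
  obtain R where R: "\<And>x. x \<notin> {-R..R} \<Longrightarrow> \<psi> x = 0" "\<And>x. x \<notin> {-R..R} \<Longrightarrow> deriv \<psi> x = 0"
    using test_function_support[OF t] by blast
  \<comment> \<open>The test function is known to vanish only strictly outside
    \<open>{-R..R}\<close>, and \<open>R\<close> may be negative; the margin makes it vanish at both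
    endpoints of a genuine interval.\<close>
  define S where "S = \<bar>R\<bar> + 1"
  have S: "S > R" "S > 0" by (auto simp: S_def)
  note q = primitive_mult[OF p test_function_primitive[OF t]]
  have "0 = integral {-S..S} (\<lambda>x. g x * \<psi> x + f x * deriv \<psi> x)"
  proof -
    have "f S * \<psi> S - f (-S) * \<psi> (-S) = integral {-S..S} (\<lambda>x. g x * \<psi> x + f x * deriv \<psi> x)"
      using q S(2) by (simp add: primitive_def)
    then show ?thesis using R(1)[of S] R(1)[of "-S"] S by simp
  qed
  also have "\<dots> = (LINT x|lebesgue. g x * \<psi> x + f x * deriv \<psi> x)"
  proof (rule integral_lebesgue_eq_integral_support(2)[symmetric])
    show "locally_integrable (\<lambda>x. g x * \<psi> x + f x * deriv \<psi> x)"
      using q by (simp add: primitive_def)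
    show "g x * \<psi> x + f x * deriv \<psi> x = 0" if "x \<notin> {-S..S}" for x
      using that R[of x] S by auto
  qed
  also have "\<dots> = (LINT x|lebesgue. g x * \<psi> x) + (LINT x|lebesgue. f x * deriv \<psi> x)"
    by (intro Bochner_Integration.integral_add locally_integrable_test lf lg t)
  finally show "(LINT x|lebesgue. f x * deriv \<psi> x) = - (LINT x|lebesgue. g x * \<psi> x)" by simp
qed

text \<open>A primitive that starts at the left end of the support is constant beyond either end; on
  the right the constant is the total integral, so mean zero is exactly what compact support
  requires.\<close>

lemma test_function_antideriv:
  assumes t: "test_function \<psi>" and z: "(LINT x|lebesgue. \<psi> x) = 0"
  shows "\<exists>\<Psi>. test_function \<Psi> \<and> deriv \<Psi> = \<psi>"
proof -
  obtain R where R: "\<And>x. x \<notin> {-R..R} \<Longrightarrow> \<psi> x = 0"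
    and "\<And>x. x \<notin> {-R..R} \<Longrightarrow> deriv \<psi> x = 0"
    using test_function_support[OF t] by blast
  note c = test_function_DERIV(2)[OF t]
  obtain P where P: "primitive P \<psi>" using primitive_exists[OF locally_integrable_continuous[OF c]] by blast
  define \<Psi> where "\<Psi> x = P x - P (-R)" for x
  have inc: "\<Psi> b - \<Psi> a = integral {a..b} \<psi>" if "a \<le> b" for a b
    using P that by (simp add: primitive_def \<Psi>_def)
  have "(\<Psi> has_real_derivative \<psi> x) (at x)" for x
  proof -
    have "((\<lambda>u. integral {x-1..u} \<psi>) has_vector_derivative \<psi> x) (at x within {x-1..x+1})"
      by (rule integral_has_vector_derivative) (use c in \<open>auto intro: continuous_on_subset\<close>)
    then have "((\<lambda>u. integral {x-1..u} \<psi>) has_real_derivative \<psi> x) (at x)"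
      by (simp add: has_real_derivative_iff_has_vector_derivative at_within_Icc_at)
    then have "((\<lambda>u. \<Psi> (x-1) + integral {x-1..u} \<psi>) has_real_derivative \<psi> x) (at x)"
      by (auto intro!: derivative_eq_intros)
    then show ?thesis
      by (rule has_field_derivative_transform_within_open[of _ _ _ "{x-1<..}"])
       (auto simp: inc[symmetric])
  qed
  then have D: "deriv \<Psi> = \<psi>" and d: "\<Psi> differentiable (at x)" for x
    by (auto simp: fun_eq_iff real_differentiable_def intro!: DERIV_imp_deriv)
  have "(deriv ^^ k) \<Psi> differentiable (at x)" for k x
  proof (cases k)
    case (Suc j)
    then have "(deriv ^^ k) \<Psi> = (deriv ^^ j) \<psi>" by (simp only: funpow_Suc_right comp_def D)
    then show ?thesis using t by (simp add: test_function_def)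
  qed (simp add: d)
  moreover have "\<Psi> x = 0" if "x \<notin> {-\<bar>R\<bar>..\<bar>R\<bar>}" for x
  proof (cases "x \<ge> 0")
    case True
    with that have x: "x > \<bar>R\<bar>" by auto
    have "\<Psi> x = \<Psi> x - \<Psi> (-R)" by (simp add: \<Psi>_def)
    also have "\<dots> = integral {-R..x} \<psi>" using x by (intro inc) auto
    also have "\<dots> = (LINT x|lebesgue. \<psi> x)"
      using x by (intro integral_lebesgue_eq_integral_support(2)[symmetric] locally_integrable_continuous c R) auto
    finally show ?thesis using z by simp
  next
    case False
    with that have x: "x < - \<bar>R\<bar>" by auto
    have "\<Psi> x = - (\<Psi> (-R) - \<Psi> x)" by (simp add: \<Psi>_def)
    also have "\<dots> = - integral {x..-R} \<psi>" using x by (subst inc) auto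
    \<comment> \<open>The endpoint \<open>-R\<close> belongs to \<open>{-R..R}\<close>, where
      nothing is known about the function, and is discarded as a null set.\<close>
    also have "integral {x..-R} \<psi> = integral {x..-R} (\<lambda>_. 0)"
      by (rule integral_spike[of "{-R}"]) (use R in auto)
    finally show ?thesis by simp
  qed
  then have "{x. \<Psi> x \<noteq> 0} \<subseteq> {-\<bar>R\<bar>..\<bar>R\<bar>}" by blast
  then have "compact (closure {x. \<Psi> x \<noteq> 0})"
    by (meson bounded_closed_interval bounded_subset compact_closure)
  ultimately show ?thesis using D by (auto simp: test_function_def)
qed

lemma AE_lebesgue_open_nonempty:
  fixes S :: "real set"
  assumes "AE x in lebesgue. P x" "open S" "S \<noteq> {}"
  shows "\<exists>x\<in>S. P x"
proof (rule ccontr)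
  assume "\<not> (\<exists>x\<in>S. P x)"
  moreover obtain N where N: "{x \<in> space lebesgue. \<not> P x} \<subseteq> N" "emeasure lebesgue N = 0" "N \<in> sets lebesgue"
    using assms(1) by (rule AE_E)
  ultimately have "S \<subseteq> N" by auto
  moreover have "negligible N" using N by (simp add: negligible_iff_null_sets null_sets_def)
  ultimately have "negligible S" using negligible_subset by blast
  then show False using open_not_negligible assms by blast
qed

text \<open>Subtracting from a test function the multiple of a fixed bump with the same integral leaves
  the derivative of a test function.\<close>

lemma weak_deriv_zero_imp_const:
  assumes h: "has_weak_deriv h (\<lambda>_. 0)"
  shows "\<exists>c. AE x in lebesgue. h x = c"
proof -
  have lh: "locally_integrable h" using h by (simp add: has_weak_deriv_def)
  define b where "b x = flat 1 0 (x - 0) * flat 1 0 (1 - x)" for x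
  have tb: "test_function b" unfolding b_def by (rule test_function_bump) simp
  note cb = test_function_DERIV(2)[OF tb]
  have bs: "b x = 0" if "x \<notin> {0..1}" for x using that by (auto simp: b_def flat_def)
  define I where "I = (LINT x|lebesgue. b x)"
  have bp: "b x \<ge> 0" for x by (auto simp: b_def flat_def)
  have ib: "integrable lebesgue b" 
    by (rule integral_lebesgue_eq_integral_support[OF locally_integrable_continuous[OF cb] bs])
  have "I \<noteq> 0"
  proof
    assume "I = 0"
    then have "AE x in lebesgue. b x = 0"
      using integral_nonneg_eq_0_iff_AE[OF ib] bp by (simp add: I_def)
    then obtain x where "x \<in> {0<..<1}" "b x = 0"
      using AE_lebesgue_open_nonempty[of "\<lambda>x. b x = 0" "{0<..<1}"] by auto
    then show False by (auto simp: b_def flat_def)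
  qed
  \<comment> \<open>The only candidate: testing \<open>h - c\<close> with the bump \<open>b\<close>
    has to give 0.\<close>
  define c where "c = (LINT x|lebesgue. h x * b x) / I"
  have "AE x in lebesgue. h x + - c = 0"
  proof (rule test_integrals_zero_imp_AE_zero)
    show l: "locally_integrable (\<lambda>x. h x + - c)"
      by (intro locally_integrable_add lh locally_integrable_continuous) auto
    fix \<psi> assume t: "test_function \<psi>"
    obtain R where R: "\<And>x. x \<notin> {-R..R} \<Longrightarrow> \<psi> x = 0"
      and "\<And>x. x \<notin> {-R..R} \<Longrightarrow> deriv \<psi> x = 0"
      using test_function_support[OF t] by blast
    note i\<psi> = integral_lebesgue_eq_integral_support(1)[OF locally_integrable_continuous[OF test_function_DERIV(2)[OF t]] R]
    define J where "J = (LINT x|lebesgue. \<psi> x)"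
    define \<theta> where "\<theta> x = \<psi> x + (- (J/I)) * b x" for x
    \<comment> \<open>\<open>test_function\<close> speaks of iterated \<open>deriv\<close>, which is
      additive only for differentiable functions, so linearity is carried through the
      induction.\<close>
    have deriv_pow: "(deriv ^^ k) \<theta> = (\<lambda>x. (deriv ^^ k) \<psi> x + (- (J/I)) * (deriv ^^ k) b x)" for k
    proof (induction k)
      case (Suc k)
      have "((\<lambda>x. (deriv ^^ k) \<psi> x + (- (J/I)) * (deriv ^^ k) b x) has_real_derivative
        (deriv ^^ Suc k) \<psi> x + (- (J/I)) * (deriv ^^ Suc k) b x) (at x)" for x
        using t tb unfolding test_function_def
        by (intro DERIV_add DERIV_cmult) (simp_all add: DERIV_deriv_iff_real_differentiable)
      then have "deriv ((deriv ^^ k) \<theta>) x = (deriv ^^ Suc k) \<psi> x + (- (J/I)) * (deriv ^^ Suc k) b x" for x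
        unfolding Suc by (intro DERIV_imp_deriv) 
      then show ?case by (simp add: fun_eq_iff)
    qed (simp add: \<theta>_def fun_eq_iff)
    have "(deriv ^^ k) \<theta> differentiable (at x)" for k x
      unfolding deriv_pow using t tb unfolding test_function_def by (intro derivative_intros) auto
    moreover have "{x. \<theta> x \<noteq> 0} \<subseteq> {-\<bar>R\<bar>..\<bar>R\<bar>+1}"
    proof
      fix x assume "x \<in> {x. \<theta> x \<noteq> 0}"
      then have "\<psi> x \<noteq> 0 \<or> b x \<noteq> 0" by (auto simp: \<theta>_def)
      then have "x \<in> {-R..R} \<or> x \<in> {0..1}" using R[of x] bs[of x] by blast
      then show "x \<in> {-\<bar>R\<bar>..\<bar>R\<bar>+1}" by auto
    qed
    then have "compact (closure {x. \<theta> x \<noteq> 0})"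
      by (meson bounded_closed_interval bounded_subset compact_closure)
    ultimately have t\<theta>: "test_function \<theta>" by (simp add: test_function_def)
    have "(LINT x|lebesgue. \<theta> x) = 0"
      using ib i\<psi> \<open>I \<noteq> 0\<close> by (simp add: \<theta>_def I_def[symmetric] J_def[symmetric])
    then obtain X where X: "test_function X" "deriv X = \<theta>" using test_function_antideriv[OF t\<theta>] by blast
    have "0 = (LINT x|lebesgue. h x * deriv X x)" using h X(1) by (simp add: has_weak_deriv_def)
    also have "\<dots> = (LINT x|lebesgue. h x * \<psi> x + (- (J/I)) * (h x * b x))"
      unfolding X(2) by (rule Bochner_Integration.integral_cong) (auto simp: \<theta>_def algebra_simps)
    also have "\<dots> = (LINT x|lebesgue. h x * \<psi> x) + (- (J/I)) * (LINT x|lebesgue. h x * b x)"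
      using locally_integrable_test(1)[OF lh t] locally_integrable_test(1)[OF lh tb] by simp
    also have "(- (J/I)) * (LINT x|lebesgue. h x * b x) = (LINT x|lebesgue. (-c) * \<psi> x)"
      using i\<psi> by (simp add: c_def J_def)
    also have "(LINT x|lebesgue. h x * \<psi> x) + (LINT x|lebesgue. (-c) * \<psi> x) = (LINT x|lebesgue. (h x + - c) * \<psi> x)"
      using locally_integrable_test(1)[OF lh t] i\<psi> by (simp add: left_diff_distrib)
    finally show "(LINT x|lebesgue. (h x + - c) * \<psi> x) = 0" by simp
  qed
  then have "AE x in lebesgue. h x = c" by eventually_elim simp
  then show ?thesis ..
qed

text \<open>Any primitive of \<open>g\<close> has the same weak derivative as \<open>f\<close>, so
  the difference is almost everywhere constant, and the constant is absorbed into the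
  primitive.\<close>

lemma has_weak_deriv_imp_primitive:
  assumes d: "has_weak_deriv f g"
  shows "\<exists>F. primitive F g \<and> (AE x in lebesgue. f x = F x)"
proof -
  have "locally_integrable g" using d by (simp add: has_weak_deriv_def)
  then obtain F where F: "primitive F g" using primitive_exists by blast
  have "has_weak_deriv (\<lambda>x. f x + (-1) * F x) (\<lambda>x. g x + (-1) * g x)"
    by (intro has_weak_deriv_add has_weak_deriv_cmult d primitive_has_weak_deriv[OF F])
  then obtain c where "AE x in lebesgue. f x + (-1) * F x = c"
    using weak_deriv_zero_imp_const by auto
  then have "AE x in lebesgue. f x = F x + c" by eventually_elim simp
  moreover have "primitive (\<lambda>x. F x + c) g" using F by (simp add: primitive_def)
  ultimately show ?thesis by blast
qed

lemma continuous_AE_eq_imp_eq: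
  fixes f g :: "real \<Rightarrow> real"
  assumes "continuous_on UNIV f" "continuous_on UNIV g" and ae: "AE x in lebesgue. f x = g x"
  shows "f = g"
proof (rule ccontr)
  assume "f \<noteq> g"
  then have "{x. f x \<noteq> g x} \<noteq> {}" by auto
  moreover have "open {x. f x \<noteq> g x}" using assms(1,2) by (intro open_Collect_neq) auto
  ultimately show False using AE_lebesgue_open_nonempty[OF ae] by blast
qed

subsection \<open>The \<open>L\<^sup>2\<close> seminorm\<close>

definition l2 :: "(real \<Rightarrow> real) \<Rightarrow> real" where
  "l2 f = sqrt (LINT x|lebesgue. (f x)\<^sup>2)"

lemma l2_nonneg: "0 \<le> l2 f"
  by (simp add: l2_def)

lemma l2_power2: "(l2 f)\<^sup>2 = (LINT x|lebesgue. (f x)\<^sup>2)"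
  by (simp add: l2_def)

lemma square_integrable_measurable: "square_integrable f \<Longrightarrow> f \<in> borel_measurable lebesgue"
  by (simp add: square_integrable_def)

lemma square_integrable_dominated:
  assumes f: "square_integrable f" and g: "g \<in> borel_measurable lebesgue"
    and le: "AE x in lebesgue. \<bar>g x\<bar> \<le> A * \<bar>f x\<bar>"
  shows "square_integrable g"
proof -
  have "integrable lebesgue (\<lambda>x. (g x)\<^sup>2)"
  proof (rule Bochner_Integration.integrable_bound)
    show "integrable lebesgue (\<lambda>x. A\<^sup>2 * (f x)\<^sup>2)" using f by (simp add: square_integrable_def)
    show "AE x in lebesgue. norm ((g x)\<^sup>2) \<le> norm (A\<^sup>2 * (f x)\<^sup>2)"
      using le
    proof eventually_elim
      case (elim x)
      then have "\<bar>g x\<bar>\<^sup>2 \<le> (A * \<bar>f x\<bar>)\<^sup>2" by (intro power_mono) auto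
      then show ?case by (simp add: power_mult_distrib)
    qed
  qed (use g in simp)
  then show ?thesis using g by (simp add: square_integrable_def)
qed

lemma l2_dominated:
  assumes f: "square_integrable f" and g: "g \<in> borel_measurable lebesgue"
    and le: "AE x in lebesgue. \<bar>g x\<bar> \<le> A * \<bar>f x\<bar>" and A: "A \<ge> 0"
  shows "l2 g \<le> A * l2 f"
proof (rule power2_le_imp_le)
  have "(LINT x|lebesgue. (g x)\<^sup>2) \<le> (LINT x|lebesgue. A\<^sup>2 * (f x)\<^sup>2)"
  proof (rule integral_mono_AE)
    show "AE x in lebesgue. (g x)\<^sup>2 \<le> A\<^sup>2 * (f x)\<^sup>2"
      using le
    proof eventually_elim
      case (elim x)
      then have "\<bar>g x\<bar>\<^sup>2 \<le> (A * \<bar>f x\<bar>)\<^sup>2" by (intro power_mono) auto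
      then show ?case by (simp add: power_mult_distrib)
    qed
  qed (use f square_integrable_dominated[OF f g le] in \<open>auto simp: square_integrable_def\<close>)
  then show "(l2 g)\<^sup>2 \<le> (A * l2 f)\<^sup>2" by (simp add: power_mult_distrib l2_power2)
qed (simp add: A l2_nonneg)

lemma l2_cong_AE:
  assumes "square_integrable f" "square_integrable g" "AE x in lebesgue. f x = g x"
  shows "l2 f = l2 g"
proof -
  have "(LINT x|lebesgue. (f x)\<^sup>2) = (LINT x|lebesgue. (g x)\<^sup>2)"
  proof (rule integral_cong_AE)
    show "AE x in lebesgue. (f x)\<^sup>2 = (g x)\<^sup>2" using assms(3) by eventually_elim simp
  qed (use assms in \<open>auto simp: square_integrable_def\<close>)
  then show ?thesis by (simp add: l2_def)
qed

text \<open>The squared norm of \<open>f + t * g\<close> is a nonnegative quadratic in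
  \<open>t\<close>, evaluated at its minimum. For \<open>b = 0\<close> it is affine in
  \<open>t\<close>, and the chosen \<open>t\<close> would give it the value -1 unless
  \<open>c = 0\<close>.\<close>

lemma l2_Cauchy_Schwarz:
  assumes f: "square_integrable f" and g: "square_integrable g"
  shows "\<bar>LINT x|lebesgue. f x * g x\<bar> \<le> l2 f * l2 g"
proof -
  define a b c where "a = (LINT x|lebesgue. (f x)\<^sup>2)" and "b = (LINT x|lebesgue. (g x)\<^sup>2)"
    and "c = (LINT x|lebesgue. f x * g x)"
  have i: "integrable lebesgue (\<lambda>x. (f x)\<^sup>2)" "integrable lebesgue (\<lambda>x. (g x)\<^sup>2)"
    "integrable lebesgue (\<lambda>x. f x * g x)"
    using f g square_integrable_mult[OF f g] by (auto simp: square_integrable_def)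
  have ab: "a \<ge> 0" "b \<ge> 0" by (auto simp: a_def b_def)
  have q: "0 \<le> a + 2 * t * c + t\<^sup>2 * b" for t
  proof -
    have "0 \<le> (LINT x|lebesgue. (f x + t * g x)\<^sup>2)" by simp
    also have "\<dots> = (LINT x|lebesgue. (f x)\<^sup>2 + (2 * t * (f x * g x) + t\<^sup>2 * (g x)\<^sup>2))"
      by (rule Bochner_Integration.integral_cong) (auto simp: power2_sum power_mult_distrib algebra_simps)
    also have "\<dots> = a + (2 * t * c + t\<^sup>2 * b)" using i by (simp add: a_def b_def c_def)
    finally show ?thesis by simp
  qed
  have "c\<^sup>2 \<le> a * b"
  proof (cases "b = 0")
    case True
    have "c = 0"
    proof (rule ccontr)
      assume "c \<noteq> 0"
      then show False using q[of "- (a + 1) / (2 * c)"] True by (simp add: field_simps)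
    qed
    then show ?thesis using ab by simp
  next
    case False
    with ab have "b > 0" by simp
    then show ?thesis using q[of "- c / b"] by (simp add: field_simps power2_eq_square)
  qed
  then have "\<bar>c\<bar> \<le> sqrt (a * b)" by (simp add: real_le_rsqrt)
  then show ?thesis by (simp add: l2_def a_def b_def c_def real_sqrt_mult)
qed

lemma l2_add_le:
  assumes f: "square_integrable f" and g: "square_integrable g"
  shows "l2 (\<lambda>x. f x + g x) \<le> l2 f + l2 g"
proof (rule power2_le_imp_le)
  have i: "integrable lebesgue (\<lambda>x. (f x)\<^sup>2)" "integrable lebesgue (\<lambda>x. (g x)\<^sup>2)"
    "integrable lebesgue (\<lambda>x. f x * g x)"
    using f g square_integrable_mult[OF f g] by (auto simp: square_integrable_def)
  have "(l2 (\<lambda>x. f x + g x))\<^sup>2 = (LINT x|lebesgue. (f x)\<^sup>2 + (g x)\<^sup>2 + 2 * (f x * g x))"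
    by (simp add: l2_power2 power2_sum mult.assoc)
  also have "\<dots> = (l2 f)\<^sup>2 + (l2 g)\<^sup>2 + 2 * (LINT x|lebesgue. f x * g x)"
    using i by (simp add: l2_power2)
  also have "\<dots> \<le> (l2 f + l2 g)\<^sup>2"
    using l2_Cauchy_Schwarz[OF f g] by (simp add: power2_sum)
  finally show "(l2 (\<lambda>x. f x + g x))\<^sup>2 \<le> (l2 f + l2 g)\<^sup>2" .
qed (simp add: l2_nonneg)

lemma square_integrable_diff:
  assumes "square_integrable f" "square_integrable g"
  shows "square_integrable (\<lambda>x. f x - g x)"
  using square_integrable_add[OF assms(1) square_integrable_cmult[OF assms(2), of "-1"]] by simp

lemma square_integrable_test:
  assumes "continuous_on UNIV h" "\<And>x. x \<notin> {-R..R} \<Longrightarrow> h x = 0"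
  shows "square_integrable h"
  unfolding square_integrable_def
proof
  show "h \<in> borel_measurable lebesgue" by (rule continuous_imp_measurable_lebesgue[OF assms(1)])
  show "integrable lebesgue (\<lambda>x. (h x)\<^sup>2)"
    by (rule integral_lebesgue_eq_integral_support(1)[of _ "-R" R])
      (use assms in \<open>auto intro!: locally_integrable_continuous continuous_intros\<close>)
qed

lemma square_integrable_locally_integrable:
  assumes f: "square_integrable f" shows "locally_integrable f"
  unfolding locally_integrable_def
proof (intro allI)
  fix a b :: real
  have "square_integrable (indicator {a..b})"
    unfolding square_integrable_def
  proof
    have "(\<lambda>x. (indicator {a..b} x)\<^sup>2) = (indicator {a..b} :: real \<Rightarrow> real)"
      by (auto simp: fun_eq_iff indicator_def)
    moreover have "integrable lebesgue (indicator {a..b} :: real \<Rightarrow> real)"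
      by (rule integrable_real_indicator) (auto simp: emeasure_lborel_Icc_eq)
    ultimately show "integrable lebesgue (\<lambda>x. (indicator {a..b} x)\<^sup>2 :: real)"
      by simp
  qed (rule borel_measurable_indicator, simp)
  from square_integrable_mult[OF this f] show "f absolutely_integrable_on {a..b}"
    by (simp add: set_integrable_def)
qed

text \<open>Riesz-Fischer. Increments of a fast subsequence need not be integrable, so instead of
  their absolute values the weighted squares \<open>2 ^ k * (d k x)\<^sup>2\<close> are summed and
  integrated; a finite integral forces pointwise convergence almost everywhere.\<close>

lemma l2_complete:
  assumes f: "\<And>k. square_integrable (f k)"
    and c: "\<And>e. e > 0 \<Longrightarrow> \<exists>N. \<forall>i\<ge>N. \<forall>j\<ge>N. l2 (\<lambda>x. f i x - f j x) < e"
  shows "\<exists>g. square_integrable g \<and> (\<lambda>k. l2 (\<lambda>x. f k x - g x)) \<longlonglongrightarrow> 0"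
proof -
  have "\<exists>r. strict_mono r \<and> (\<forall>k. \<forall>i\<ge>r k. \<forall>j\<ge>r k. l2 (\<lambda>x. f i x - f j x) < (1/2)^k)"
  proof -
    obtain N where N: "\<And>k i j. i \<ge> N k \<Longrightarrow> j \<ge> N k \<Longrightarrow> l2 (\<lambda>x. f i x - f j x) < (1/2)^k"
      using c[of "(1/2)^k" for k] by (metis zero_less_divide_1_iff zero_less_numeral zero_less_power)
    \<comment> \<open>The partial sums dominate every \<open>N k\<close>, and the added 1 in each
      term makes them strictly increasing.\<close>
    define r where "r k = (\<Sum>l\<le>k. N l + 1)" for k
    have "strict_mono r" by (rule strict_mono_Suc_iff[THEN iffD2]) (simp add: r_def)
    moreover have "N k \<le> r k" for k by (cases k) (auto simp: r_def)
    ultimately show ?thesis using N by (meson order_trans)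
  qed
  then obtain r where r: "strict_mono r" "\<And>k i j. i \<ge> r k \<Longrightarrow> j \<ge> r k \<Longrightarrow> l2 (\<lambda>x. f i x - f j x) < (1/2)^k"
    by blast
  define d where "d k x = f (r (Suc k)) x - f (r k) x" for k x
  have d: "square_integrable (d k)" for k
    unfolding d_def by (intro square_integrable_diff f)
  note m = square_integrable_measurable[OF f]
  have md: "d k \<in> borel_measurable lebesgue" for k by (rule square_integrable_measurable[OF d])
  \<comment> \<open>The squared norms decay like 4^(-k), which leaves room for the weight
    2^k.\<close>
  have ld: "(LINT x|lebesgue. 2 ^ k * (d k x)\<^sup>2) \<le> (1/2)^k" for k
  proof -
    have "l2 (d k) < (1/2)^k" unfolding d_def
      by (rule r(2)) (use r(1) in \<open>auto simp: strict_mono_less_eq\<close>)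
    then have "(l2 (d k))\<^sup>2 \<le> ((1/2)^k)\<^sup>2" by (intro power_mono) (auto simp: l2_nonneg)
    then have "2 ^ k * (l2 (d k))\<^sup>2 \<le> 2 ^ k * ((1/2)^k)\<^sup>2" by (intro mult_left_mono) auto
    also have "\<dots> = (1/2::real)^k" by (simp add: power_divide power2_eq_square)
    finally show ?thesis by (simp add: l2_power2)
  qed
  have "(\<integral>\<^sup>+x. (\<Sum>k. ennreal (2 ^ k * (d k x)\<^sup>2)) \<partial>lebesgue) = (\<Sum>k. \<integral>\<^sup>+x. ennreal (2 ^ k * (d k x)\<^sup>2) \<partial>lebesgue)"
    by (rule nn_integral_suminf) (use md in simp)
  also have "\<dots> = (\<Sum>k. ennreal (LINT x|lebesgue. 2 ^ k * (d k x)\<^sup>2))"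
    by (intro suminf_cong nn_integral_eq_integral) (use d in \<open>auto simp: square_integrable_def\<close>)
  also have "\<dots> \<le> (\<Sum>k. ennreal ((1/2)^k))"
    by (intro suminf_le summableI ennreal_leI ld)
  also have "\<dots> = ennreal (\<Sum>k. (1/2)^k)"
    by (intro suminf_ennreal2 summable_geometric) auto
  finally have "(\<integral>\<^sup>+x. (\<Sum>k. ennreal (2 ^ k * (d k x)\<^sup>2)) \<partial>lebesgue) \<noteq> \<infinity>"
    by (auto simp: top_unique)
  then have "AE x in lebesgue. (\<Sum>k. ennreal (2 ^ k * (d k x)\<^sup>2)) \<noteq> \<infinity>"
    by (intro nn_integral_noteq_infinite) (use md in simp)
  then have conv: "AE x in lebesgue. convergent (\<lambda>k. f (r k) x)"
  proof eventually_elim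
    case (elim x)
    then have s: "summable (\<lambda>k. 2 ^ k * (d k x)\<^sup>2)"
      by (intro summable_suminf_not_top) auto
    have "summable (\<lambda>k. (1/2::real)^k + 2 ^ k * (d k x)\<^sup>2)"
      by (intro summable_add summable_geometric s) auto
    then have "summable (\<lambda>k. d k x)"
    proof (rule summable_comparison_test')
      fix k :: nat
      \<comment> \<open>Expanding the square gives 2|d| <= 2^(-k) + 2^k d^2, which turns summable
        weighted squares into absolute summability of the increments.\<close>
      have "0 \<le> (1/2::real)^k * (1 - 2^k * \<bar>d k x\<bar>)\<^sup>2" by simp
      also have "\<dots> = (1/2)^k + 2 ^ k * (d k x)\<^sup>2 - 2 * \<bar>d k x\<bar>"
        by (simp add: power2_diff field_simps power2_eq_square power_divide)
      finally show "norm (d k x) \<le> (1/2)^k + 2 ^ k * (d k x)\<^sup>2" by simp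
    qed
    then have "convergent (\<lambda>k. \<Sum>i<k. d i x)" by (simp add: summable_iff_convergent)
    then have "convergent (\<lambda>k. f (r 0) x + (\<Sum>i<k. d i x))" by (intro convergent_add convergent_const)
    moreover have "f (r 0) x + (\<Sum>i<k. d i x) = f (r k) x" for k
      unfolding d_def by (subst sum_lessThan_telescope) simp
    ultimately show ?case by simp
  qed
  define g where "g x = lim (\<lambda>k. f (r k) x)" for x
  have mg: "g \<in> borel_measurable lebesgue"
    unfolding g_def by (intro borel_measurable_lim_metric m)
  have lim: "AE x in lebesgue. (\<lambda>k. f (r k) x) \<longlonglongrightarrow> g x"
    using conv by eventually_elim (simp add: g_def convergent_LIMSEQ_iff)
  \<comment> \<open>Fatou in the second index only: with \<open>i\<close> fixed the Cauchy bound
    passes to \<open>f i - g\<close>. This yields both the square integrability of \<open>g\<close>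
    and the convergence of the whole sequence.\<close>
  have fatou: "(\<integral>\<^sup>+x. ennreal ((f i x - g x)\<^sup>2) \<partial>lebesgue) \<le> ennreal (e\<^sup>2)"
    if e: "e \<ge> 0" and le: "\<And>j. j \<ge> N \<Longrightarrow> l2 (\<lambda>x. f i x - f j x) \<le> e" for i e N
  proof -
    have "(\<integral>\<^sup>+x. ennreal ((f i x - g x)\<^sup>2) \<partial>lebesgue)
       = (\<integral>\<^sup>+x. liminf (\<lambda>k. ennreal ((f i x - f (r k) x)\<^sup>2)) \<partial>lebesgue)"
    proof (rule nn_integral_cong_AE)
      show "AE x in lebesgue. ennreal ((f i x - g x)\<^sup>2) = liminf (\<lambda>k. ennreal ((f i x - f (r k) x)\<^sup>2))"
        using lim
      proof eventually_elim
        case (elim x)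
        then have "(\<lambda>k. ennreal ((f i x - f (r k) x)\<^sup>2)) \<longlonglongrightarrow> ennreal ((f i x - g x)\<^sup>2)"
          by (intro tendsto_ennrealI tendsto_intros)
        then show ?case by (rule lim_imp_Liminf[symmetric, rotated]) simp
      qed
    qed
    also have "\<dots> \<le> liminf (\<lambda>k. \<integral>\<^sup>+x. ennreal ((f i x - f (r k) x)\<^sup>2) \<partial>lebesgue)"
      by (rule nn_integral_liminf) (use m in simp)
    also have "\<dots> \<le> liminf (\<lambda>k. ennreal (e\<^sup>2))"
    proof (rule Liminf_mono)
      have "\<forall>\<^sub>F k in sequentially. N \<le> r k"
        using filterlim_subseq[OF r(1)] by (simp add: filterlim_at_top)
      then show "\<forall>\<^sub>F k in sequentially. (\<integral>\<^sup>+x. ennreal ((f i x - f (r k) x)\<^sup>2) \<partial>lebesgue) \<le> ennreal (e\<^sup>2)"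
      proof eventually_elim
        case (elim k)
        have "(\<integral>\<^sup>+x. ennreal ((f i x - f (r k) x)\<^sup>2) \<partial>lebesgue) = ennreal ((l2 (\<lambda>x. f i x - f (r k) x))\<^sup>2)"
          unfolding l2_power2
          by (rule nn_integral_eq_integral) (use square_integrable_diff[OF f f] in \<open>auto simp: square_integrable_def\<close>)
        also have "\<dots> \<le> ennreal (e\<^sup>2)"
          by (intro ennreal_leI power_mono le elim l2_nonneg)
        finally show ?case .
      qed
    qed
    finally show ?thesis by (simp add: Liminf_const)
  qed
  have sq: "square_integrable (\<lambda>x. f i x - g x) \<and> l2 (\<lambda>x. f i x - g x) \<le> e"
    if e: "e \<ge> 0" and le: "\<And>j. j \<ge> N \<Longrightarrow> l2 (\<lambda>x. f i x - f j x) \<le> e" for i e N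
  proof
    have mm: "(\<lambda>x. f i x - g x) \<in> borel_measurable lebesgue" using m mg by simp
    have "integrable lebesgue (\<lambda>x. (f i x - g x)\<^sup>2)"
    proof (rule integrableI_bounded)
      show "(\<integral>\<^sup>+x. ennreal (norm ((f i x - g x)\<^sup>2)) \<partial>lebesgue) < \<infinity>"
        using fatou[OF e le] by (auto simp: less_top[symmetric] top_unique)
    qed (use mm in simp)
    then show s: "square_integrable (\<lambda>x. f i x - g x)" using mm by (simp add: square_integrable_def)
    have "ennreal ((l2 (\<lambda>x. f i x - g x))\<^sup>2) = (\<integral>\<^sup>+x. ennreal ((f i x - g x)\<^sup>2) \<partial>lebesgue)"
      unfolding l2_power2
      by (rule nn_integral_eq_integral[symmetric]) (use s in \<open>auto simp: square_integrable_def\<close>)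
    also have "\<dots> \<le> ennreal (e\<^sup>2)" by (rule fatou[OF that])
    finally have "(l2 (\<lambda>x. f i x - g x))\<^sup>2 \<le> e\<^sup>2" by simp
    then show "l2 (\<lambda>x. f i x - g x) \<le> e" using e by (rule power2_le_imp_le)
  qed
  have "l2 (\<lambda>x. f (r 0) x - f j x) \<le> 1" if "j \<ge> r 0" for j
    using r(2)[of 0 "r 0" j] that by simp
  then have "square_integrable (\<lambda>x. f (r 0) x - g x)"
    using sq[of 1 "r 0" "r 0"] by auto
  from square_integrable_diff[OF f[of "r 0"] this]
  have "square_integrable g" by simp
  moreover have "(\<lambda>k. l2 (\<lambda>x. f k x - g x)) \<longlonglongrightarrow> 0"
  proof (rule LIMSEQ_I)
    fix e :: real assume e: "e > 0"
    obtain N where N: "\<forall>i\<ge>N. \<forall>j\<ge>N. l2 (\<lambda>x. f i x - f j x) < e/2" using c[of "e/2"] e by auto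
    have "norm (l2 (\<lambda>x. f k x - g x) - 0) < e" if "k \<ge> N" for k
    proof -
      have "l2 (\<lambda>x. f k x - f j x) \<le> e/2" if "j \<ge> N" for j
        using N \<open>k \<ge> N\<close> that by (auto intro: less_imp_le)
      then have "l2 (\<lambda>x. f k x - g x) \<le> e/2"
        using sq[of "e/2" N k] e by auto
      then show ?thesis using e l2_nonneg[of "\<lambda>x. f k x - g x"] by simp
    qed
    then show "\<exists>N. \<forall>k\<ge>N. norm (l2 (\<lambda>x. f k x - g x) - 0) < e" by blast
  qed
  ultimately show ?thesis by blast
qed

text \<open>Closedness of weak differentiation: a test function and its derivative are square
  integrable, so both sides of the defining identity are continuous in the L^2 seminorm.\<close>

lemma has_weak_deriv_l2_limit:
  assumes f: "\<And>k. square_integrable (f k)" "square_integrable g" "(\<lambda>k. l2 (\<lambda>x. f k x - g x)) \<longlonglongrightarrow> 0"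
    and f': "\<And>k. square_integrable (f' k)" "square_integrable g'" "(\<lambda>k. l2 (\<lambda>x. f' k x - g' x)) \<longlonglongrightarrow> 0"
    and w: "\<And>k. has_weak_deriv (f k) (f' k)"
  shows "has_weak_deriv g g'"
  unfolding has_weak_deriv_def
proof (intro conjI allI impI)
  show "locally_integrable g" "locally_integrable g'"
    using f f' by (auto intro: square_integrable_locally_integrable)
  fix \<psi> assume t: "test_function \<psi>"
  obtain R where R: "\<And>x. x \<notin> {-R..R} \<Longrightarrow> \<psi> x = 0" "\<And>x. x \<notin> {-R..R} \<Longrightarrow> deriv \<psi> x = 0"
    using test_function_support[OF t] by blast
  note s = square_integrable_test[OF test_function_DERIV(2)[OF t] R(1)]
    square_integrable_test[OF test_function_DERIV(3)[OF t] R(2)]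
  have lim: "(\<lambda>k. LINT x|lebesgue. F k x * h x) \<longlonglongrightarrow> (LINT x|lebesgue. G x * h x)"
    if F: "\<And>k. square_integrable (F k)" "square_integrable G" "(\<lambda>k. l2 (\<lambda>x. F k x - G x)) \<longlonglongrightarrow> 0"
    and h: "square_integrable h" for F G h
  proof (rule LIM_zero_cancel, rule Lim_null_comparison)
    show "(\<lambda>k. l2 (\<lambda>x. F k x - G x) * l2 h) \<longlonglongrightarrow> 0" using F(3) by (rule tendsto_mult_left_zero)
    show "\<forall>\<^sub>F k in sequentially. norm ((LINT x|lebesgue. F k x * h x) - (LINT x|lebesgue. G x * h x)) \<le> l2 (\<lambda>x. F k x - G x) * l2 h"
    proof (intro always_eventually allI)
      fix k
      have "(LINT x|lebesgue. F k x * h x) - (LINT x|lebesgue. G x * h x) = (LINT x|lebesgue. (F k x - G x) * h x)"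
        using square_integrable_mult[OF F(1) h, of k] square_integrable_mult[OF F(2) h] by (simp add: left_diff_distrib)
      then show "norm ((LINT x|lebesgue. F k x * h x) - (LINT x|lebesgue. G x * h x)) \<le> l2 (\<lambda>x. F k x - G x) * l2 h"
        using l2_Cauchy_Schwarz[OF square_integrable_diff[OF F(1,2)] h, of k] by simp
    qed
  qed
  have "(\<lambda>k. LINT x|lebesgue. f k x * deriv \<psi> x) \<longlonglongrightarrow> (LINT x|lebesgue. g x * deriv \<psi> x)"
    by (rule lim[OF f s(2)])
  moreover have "(\<lambda>k. LINT x|lebesgue. f k x * deriv \<psi> x) \<longlonglongrightarrow> - (LINT x|lebesgue. g' x * \<psi> x)"
    using tendsto_minus[OF lim[OF f' s(1)]] w t by (simp add: has_weak_deriv_def)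
  ultimately show "(LINT x|lebesgue. g x * deriv \<psi> x) = - (LINT x|lebesgue. g' x * \<psi> x)"
    by (rule LIMSEQ_unique)
qed

subsection \<open>Continuous representatives\<close>

lemma h1_rel_imp_abs_eq:
  "in_H1 f \<Longrightarrow> in_H1 g \<Longrightarrow> AE x in lebesgue. f x = g x \<Longrightarrow> abs_h1 f = abs_h1 g"
  using Quotient_rel_abs[OF Quotient_h1] by blast

lemma abs_h1_eq_imp_AE:
  "in_H1 f \<Longrightarrow> in_H1 g \<Longrightarrow> abs_h1 f = abs_h1 g \<Longrightarrow> AE x in lebesgue. f x = g x"
  using Quotient_rel[OF Quotient_h1, of f g] by auto

lemma h1_representative: "\<exists>f. in_H1 f \<and> abs_h1 f = v"
  using Quotient_abs_rep[OF Quotient_h1, of v] Quotient_rep_reflp[OF Quotient_h1, of v] by blast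

lemma in_H1_primitive:
  assumes "primitive f g" "square_integrable f" "square_integrable g"
  shows "in_H1 f"
  using assms primitive_has_weak_deriv by (auto simp: in_H1_def)

lemma in_H1_cong_AE:
  assumes "in_H1 f" "g \<in> borel_measurable lebesgue" "AE x in lebesgue. f x = g x"
  shows "in_H1 g"
  using assms has_weak_deriv_cong_AE[OF _ assms(2,3)] square_integrable_cong_AE[OF _ assms(2,3)]
  by (auto simp: in_H1_def)

lemma h1_continuous_representative:
  "\<exists>f. in_H1 f \<and> continuous_on UNIV f \<and> abs_h1 f = v"
proof -
  obtain f where f: "in_H1 f" "abs_h1 f = v" using h1_representative by blast
  obtain F where F: "primitive F (weak_deriv f)" "AE x in lebesgue. f x = F x"
    using has_weak_deriv_imp_primitive[OF in_H1_has_weak_deriv[OF f(1)]] by blast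
  have c: "continuous_on UNIV F" by (rule primitive_continuous[OF F(1)])
  have "in_H1 F" by (rule in_H1_cong_AE[OF f(1) continuous_imp_measurable_lebesgue[OF c] F(2)])
  then show ?thesis using c f h1_rel_imp_abs_eq[OF f(1) _ F(2)] by auto
qed

text \<open>The choice is forced, because continuous functions that agree almost everywhere
  coincide. Point values of an H^1 class are thus defined, and \<open>ev\<close> is linear
  everywhere, not merely almost everywhere.\<close>

definition ev :: "h1 \<Rightarrow> real \<Rightarrow> real" where
  "ev v = (SOME f. in_H1 f \<and> continuous_on UNIV f \<and> abs_h1 f = v)"

text \<open>In contrast to \<open>ev\<close> this is a genuine choice within an almost-everywhere
  class, so its linearity holds only almost everywhere.\<close>

definition dv :: "h1 \<Rightarrow> real \<Rightarrow> real" where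
  "dv v = weak_deriv (ev v)"

lemma in_H1_ev: "in_H1 (ev v)" and continuous_ev: "continuous_on UNIV (ev v)"
  and abs_h1_ev: "abs_h1 (ev v) = v"
  using someI_ex[OF h1_continuous_representative[of v]] unfolding ev_def by blast+

lemma has_weak_deriv_dv: "has_weak_deriv (ev v) (dv v)"
  unfolding dv_def by (rule in_H1_has_weak_deriv[OF in_H1_ev])

lemma primitive_ev: "primitive (ev v) (dv v)"
proof -
  obtain F where F: "primitive F (dv v)" "AE x in lebesgue. ev v x = F x"
    using has_weak_deriv_imp_primitive[OF has_weak_deriv_dv] by blast
  then show ?thesis
    using continuous_AE_eq_imp_eq[OF continuous_ev primitive_continuous[OF F(1)] F(2)] by simp
qed

lemma square_integrable_ev: "square_integrable (ev v)"
  by (rule in_H1_square_integrable[OF in_H1_ev])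

lemma square_integrable_dv: "square_integrable (dv v)"
  unfolding dv_def by (rule weak_deriv_square_integrable[OF in_H1_ev])

lemmas measurable_ev = square_integrable_measurable[OF square_integrable_ev]

lemma ev_abs_h1_AE:
  "in_H1 f \<Longrightarrow> AE x in lebesgue. ev (abs_h1 f) x = f x"
  by (rule abs_h1_eq_imp_AE[OF in_H1_ev _ abs_h1_ev])

lemma ev_abs_h1:
  "in_H1 f \<Longrightarrow> continuous_on UNIV f \<Longrightarrow> ev (abs_h1 f) = f"
  by (rule continuous_AE_eq_imp_eq[OF continuous_ev _ ev_abs_h1_AE])

lemma dv_abs_h1_AE:
  assumes "in_H1 f" "has_weak_deriv f g"
  shows "AE x in lebesgue. dv (abs_h1 f) x = g x"
proof -
  have "has_weak_deriv (ev (abs_h1 f)) g"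
    by (rule has_weak_deriv_cong_AE[OF assms(2) measurable_ev])
      (use ev_abs_h1_AE[OF assms(1)] in \<open>auto elim: eventually_mono\<close>)
  then show ?thesis unfolding dv_def by (rule weak_deriv_AE_eq)
qed

lemma abs_h1_add: "in_H1 f \<Longrightarrow> in_H1 g \<Longrightarrow> abs_h1 f + abs_h1 g = abs_h1 (\<lambda>x. f x + g x)"
  by (rule plus_h1.abs_eq) auto

lemma abs_h1_scaleR: "in_H1 f \<Longrightarrow> r *\<^sub>R abs_h1 f = abs_h1 (\<lambda>x. r * f x)"
  by (rule scaleR_h1.abs_eq) auto

lemma abs_h1_diff: "in_H1 f \<Longrightarrow> in_H1 g \<Longrightarrow> abs_h1 f - abs_h1 g = abs_h1 (\<lambda>x. f x - g x)"
  using abs_h1_add[of f "\<lambda>x. (-1) * g x"] abs_h1_scaleR[of g "-1"] in_H1_cmult[of g "-1"]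
  by (simp add: diff_conv_add_uminus del: add_uminus_conv_diff)

lemma ev_add: "ev (v + w) = (\<lambda>x. ev v x + ev w x)"
  using ev_abs_h1[of "\<lambda>x. ev v x + ev w x"] abs_h1_add[OF in_H1_ev[of v] in_H1_ev[of w]]
  by (simp add: abs_h1_ev in_H1_add in_H1_ev continuous_ev continuous_on_add)

lemma ev_scaleR: "ev (r *\<^sub>R v) = (\<lambda>x. r * ev v x)"
  using ev_abs_h1[of "\<lambda>x. r * ev v x"] abs_h1_scaleR[OF in_H1_ev[of v], of r]
  by (simp add: abs_h1_ev in_H1_cmult in_H1_ev continuous_ev continuous_on_mult_left)

lemma ev_diff: "ev (v - w) = (\<lambda>x. ev v x - ev w x)"
  using ev_add[of v "(-1) *\<^sub>R w"] ev_scaleR[of "-1" w] by simp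

lemma dv_add: "AE x in lebesgue. dv (v + w) x = dv v x + dv w x"
  unfolding dv_def[of "v + w"] ev_add
  by (rule weak_deriv_AE_eq) (intro has_weak_deriv_add has_weak_deriv_dv)

lemma dv_scaleR: "AE x in lebesgue. dv (r *\<^sub>R v) x = r * dv v x"
  unfolding dv_def[of "r *\<^sub>R v"] ev_scaleR
  by (rule weak_deriv_AE_eq) (intro has_weak_deriv_cmult has_weak_deriv_dv)

lemma dv_diff: "AE x in lebesgue. dv (v - w) x = dv v x - dv w x"
proof -
  have "AE x in lebesgue. dv (v + (-1) *\<^sub>R w) x = dv v x + dv ((-1) *\<^sub>R w) x" by (rule dv_add)
  with dv_scaleR[of "-1" w] show ?thesis by eventually_elim simp
qed

lemma inner_h1_ev:
  "inner v w = (LINT x|lebesgue. ev v x * ev w x) + (LINT x|lebesgue. dv v x * dv w x)"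
  using inner_h1.abs_eq[of "ev v" "ev w"] in_H1_ev by (simp add: abs_h1_ev H1_inner_def dv_def)

lemma norm_h1_power2: "(norm v)\<^sup>2 = (l2 (ev v))\<^sup>2 + (l2 (dv v))\<^sup>2" for v :: h1
  unfolding power2_norm_eq_inner inner_h1_ev l2_power2 by (simp add: power2_eq_square)

lemma l2_ev_le: "l2 (ev v) \<le> norm v" and l2_dv_le: "l2 (dv v) \<le> norm v"
  by (rule power2_le_imp_le; simp add: norm_h1_power2)+

lemma norm_h1_le: "norm v \<le> l2 (ev v) + l2 (dv v)" for v :: h1
  by (rule power2_le_imp_le) (simp_all add: norm_h1_power2 power2_sum l2_nonneg)

lemma l2_ev_diff: "l2 (\<lambda>x. ev v x - ev w x) \<le> norm (v - w)"
  using l2_ev_le[of "v - w"] by (simp add: ev_diff)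

lemma l2_dv_diff: "l2 (\<lambda>x. dv v x - dv w x) \<le> norm (v - w)"
proof -
  have "l2 (\<lambda>x. dv v x - dv w x) = l2 (dv (v - w))"
  proof (rule l2_cong_AE)
    show "AE x in lebesgue. dv v x - dv w x = dv (v - w) x" using dv_diff[of v w] by eventually_elim simp
  qed (intro square_integrable_diff square_integrable_dv)+
  then show ?thesis using l2_dv_le[of "v - w"] by simp
qed

lemma norm_abs_h1_le:
  assumes "in_H1 f" "has_weak_deriv f g" "square_integrable g"
  shows "norm (abs_h1 f) \<le> l2 f + l2 g"
proof -
  have "l2 (ev (abs_h1 f)) = l2 f"
    by (rule l2_cong_AE[OF square_integrable_ev in_H1_square_integrable[OF assms(1)] ev_abs_h1_AE[OF assms(1)]])
  moreover have "l2 (dv (abs_h1 f)) = l2 g"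
    by (rule l2_cong_AE[OF square_integrable_dv assms(3) dv_abs_h1_AE[OF assms(1,2)]])
  ultimately show ?thesis using norm_h1_le[of "abs_h1 f"] by simp
qed

subsection \<open>Completeness\<close>

text \<open>Values and weak derivatives converge separately in L^2, and closedness of weak
  differentiation ties the two limits together.\<close>

instance h1 :: banach
proof
  fix X :: "nat \<Rightarrow> h1" assume X: "Cauchy X"
  have c: "\<exists>N. \<forall>i\<ge>N. \<forall>j\<ge>N. L i j < e" if e: "e > 0" and L: "\<And>i j. L i j \<le> norm (X i - X j)" for e L
  proof -
    obtain N where "\<forall>i\<ge>N. \<forall>j\<ge>N. norm (X i - X j) < e" using CauchyD[OF X e] by blast
    then show ?thesis using L by (meson le_less_trans)
  qed
  obtain f where f: "square_integrable f" "(\<lambda>k. l2 (\<lambda>x. ev (X k) x - f x)) \<longlonglongrightarrow> 0"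
    using l2_complete[of "\<lambda>k. ev (X k)", OF square_integrable_ev c[OF _ l2_ev_diff]] by blast
  obtain g where g: "square_integrable g" "(\<lambda>k. l2 (\<lambda>x. dv (X k) x - g x)) \<longlonglongrightarrow> 0"
    using l2_complete[of "\<lambda>k. dv (X k)", OF square_integrable_dv c[OF _ l2_dv_diff]] by blast
  have w: "has_weak_deriv f g"
    by (rule has_weak_deriv_l2_limit[OF square_integrable_ev f square_integrable_dv g has_weak_deriv_dv])
  then have f1: "in_H1 f" using f g by (auto simp: in_H1_def)
  have "(\<lambda>k. X k - abs_h1 f) \<longlonglongrightarrow> 0"
  proof (rule Lim_null_comparison)
    show "(\<lambda>k. l2 (\<lambda>x. ev (X k) x - f x) + l2 (\<lambda>x. dv (X k) x - g x)) \<longlonglongrightarrow> 0"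
      using tendsto_add[OF f(2) g(2)] by simp
    show "\<forall>\<^sub>F k in sequentially. norm (X k - abs_h1 f) \<le> l2 (\<lambda>x. ev (X k) x - f x) + l2 (\<lambda>x. dv (X k) x - g x)"
    proof (intro always_eventually allI)
      fix k
      have e: "X k - abs_h1 f = abs_h1 (\<lambda>x. ev (X k) x - f x)"
        using abs_h1_diff[OF in_H1_ev[of "X k"] f1] by (simp add: abs_h1_ev)
      have "has_weak_deriv (\<lambda>x. ev (X k) x + (-1) * f x) (\<lambda>x. dv (X k) x + (-1) * g x)"
        by (intro has_weak_deriv_add has_weak_deriv_cmult has_weak_deriv_dv w)
      moreover have "in_H1 (\<lambda>x. ev (X k) x + (-1) * f x)"
        by (intro in_H1_add in_H1_cmult in_H1_ev f1)
      ultimately show "norm (X k - abs_h1 f) \<le> l2 (\<lambda>x. ev (X k) x - f x) + l2 (\<lambda>x. dv (X k) x - g x)"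
        unfolding e using square_integrable_diff[OF square_integrable_dv g(1)] by (intro norm_abs_h1_le) auto
    qed
  qed
  then have "X \<longlonglongrightarrow> abs_h1 f" by (rule LIM_zero_cancel)
  then show "convergent X" by (rule convergentI)
qed

subsection \<open>Sobolev embedding and decay\<close>

lemma integrable_power2_ev: "integrable lebesgue (\<lambda>x. (ev v x)\<^sup>2 + (dv v x)\<^sup>2)"
  using square_integrable_ev[of v] square_integrable_dv[of v] by (simp add: square_integrable_def)

text \<open>Compare the squares at \<open>x\<close> and \<open>y\<close> through the integral of
  their derivative and average over \<open>y\<close> in a unit interval. Keeping the bound local
  lets it serve both the sup bound and the decay at infinity.\<close>

lemma ev_power2_le_local:
  "(ev v x)\<^sup>2 \<le> 2 * (LINT y|lebesgue. indicator {x..x+1} y * ((ev v y)\<^sup>2 + (dv v y)\<^sup>2))"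
proof -
  define h where "h y = (ev v y)\<^sup>2 + (dv v y)\<^sup>2" for y
  have h: "set_integrable lebesgue {a..b} h" for a b
    unfolding set_integrable_def h_def
    by (rule integrable_mult_indicator) (auto intro: integrable_power2_ev)
  note hi = set_lebesgue_integral_eq_integral[OF h]
  define I where "I = integral {x..x+1} h"
  have hn: "h y \<ge> 0" for y by (simp add: h_def)
  have eI: "(LINT y|lebesgue. indicator {x..x+1} y * ((ev v y)\<^sup>2 + (dv v y)\<^sup>2)) = I"
    using hi(2)[of x "x+1"] by (simp add: I_def h_def set_lebesgue_integral_def)
  have p: "primitive (\<lambda>x. ev v x * ev v x) (\<lambda>x. dv v x * ev v x + ev v x * dv v x)"
    by (intro primitive_mult primitive_ev)
  have le: "(ev v x)\<^sup>2 \<le> (ev v y)\<^sup>2 + I" if y: "y \<in> {x..x+1}" for y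
  proof -
    have pi: "(\<lambda>x. dv v x * ev v x + ev v x * dv v x) integrable_on {x..y}"
      using p unfolding primitive_def by (blast intro: locally_integrable_integrable_on(1))
    have "\<bar>integral {x..y} (\<lambda>x. dv v x * ev v x + ev v x * dv v x)\<bar> \<le> integral {x..y} h"
      unfolding real_norm_def[symmetric]
    proof (rule Henstock_Kurzweil_Integration.integral_norm_bound_integral[OF pi hi(1)])
      fix z
      have "0 \<le> (\<bar>ev v z\<bar> - \<bar>dv v z\<bar>)\<^sup>2" by simp
      then have "2 * (\<bar>ev v z\<bar> * \<bar>dv v z\<bar>) \<le> h z" by (simp add: power2_diff h_def)
      then show "norm (dv v z * ev v z + ev v z * dv v z) \<le> h z"
        by (simp add: abs_mult[symmetric] mult.commute)
    qed
    also have "\<dots> \<le> I" unfolding I_def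
      by (rule integral_subset_le) (use y hi hn in auto)
    finally have "- integral {x..y} (\<lambda>x. dv v x * ev v x + ev v x * dv v x) \<le> I" by linarith
    moreover have "ev v y * ev v y - ev v x * ev v x = integral {x..y} (\<lambda>x. dv v x * ev v x + ev v x * dv v x)"
      using p y unfolding primitive_def by auto
    ultimately show ?thesis by (simp add: power2_eq_square)
  qed
  have c2: "continuous_on {x..x+1} (\<lambda>y. (ev v y)\<^sup>2)"
    by (intro continuous_intros continuous_on_subset[OF continuous_ev]) auto
  have "(ev v x)\<^sup>2 = integral {x..x+1} (\<lambda>y. (ev v x)\<^sup>2)" by simp
  also have "\<dots> \<le> integral {x..x+1} (\<lambda>y. (ev v y)\<^sup>2 + I)"
    by (rule integral_le) (use le c2 in \<open>auto intro!: integrable_continuous_real continuous_intros\<close>)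
  also have "\<dots> \<le> integral {x..x+1} (\<lambda>y. h y + I)"
  proof (rule integral_le)
    show "(\<lambda>y. h y + I) integrable_on {x..x + 1}" by (intro integrable_add hi(1)) auto
  qed (use c2 in \<open>auto intro!: integrable_continuous_real continuous_intros simp: h_def\<close>)
  also have "\<dots> = I + I"
    using hi(1) by (subst Henstock_Kurzweil_Integration.integral_add) (auto simp: I_def)
  finally show ?thesis unfolding eI by simp
qed

lemma abs_ev_le: "\<bar>ev v x\<bar> \<le> 2 * norm v"
proof -
  have "(LINT y|lebesgue. indicator {x..x+1} y * ((ev v y)\<^sup>2 + (dv v y)\<^sup>2)) \<le> (LINT y|lebesgue. (ev v y)\<^sup>2 + (dv v y)\<^sup>2)"
  proof (rule integral_mono)
    show "integrable lebesgue (\<lambda>y. indicator {x..x+1} y * ((ev v y)\<^sup>2 + (dv v y)\<^sup>2))"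
      using integrable_mult_indicator[OF _ integrable_power2_ev, of "{x..x+1}" v] by simp
  qed (auto simp: integrable_power2_ev indicator_def)
  also have "\<dots> = (norm v)\<^sup>2"
    using square_integrable_ev[of v] square_integrable_dv[of v]
    by (simp add: norm_h1_power2 l2_power2 square_integrable_def)
  finally have "(ev v x)\<^sup>2 \<le> 2 * (norm v)\<^sup>2" using ev_power2_le_local[of v x] by linarith
  also have "\<dots> \<le> (2 * norm v)\<^sup>2" by (simp add: power_mult_distrib)
  finally have "\<bar>ev v x\<bar>\<^sup>2 \<le> (2 * norm v)\<^sup>2" by simp
  then show ?thesis by (rule power2_le_imp_le) simp
qed

text \<open>Unit intervals that eventually leave every point carry H^1 mass tending to 0 by
  dominated convergence, and that mass controls the value at the left endpoint.\<close>

lemma ev_tendsto_0: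
  assumes s: "\<And>x. \<forall>\<^sub>F k in sequentially. x \<notin> {s k..s k + 1}"
  shows "(\<lambda>k::nat. ev v (s k)) \<longlonglongrightarrow> 0"
proof -
  have "(\<lambda>k. LINT y|lebesgue. indicator {s k..s k+1} y * ((ev v y)\<^sup>2 + (dv v y)\<^sup>2)) \<longlonglongrightarrow> (LINT y::real|lebesgue. 0)"
  proof (rule integral_dominated_convergence[where f = "\<lambda>_. 0" and w = "\<lambda>y. (ev v y)\<^sup>2 + (dv v y)\<^sup>2"])
    show "AE y in lebesgue. (\<lambda>k. indicator {s k..s k+1} y * ((ev v y)\<^sup>2 + (dv v y)\<^sup>2)) \<longlonglongrightarrow> 0"
    proof (intro AE_I2 tendsto_eventually)
      fix y
      show "\<forall>\<^sub>F k in sequentially. indicator {s k..s k+1} y * ((ev v y)\<^sup>2 + (dv v y)\<^sup>2) = 0"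
        using s[of y] by eventually_elim simp
    qed
    show "(\<lambda>y. indicator {s k..s k+1} y * ((ev v y)\<^sup>2 + (dv v y)\<^sup>2)) \<in> borel_measurable lebesgue" for k
      using borel_measurable_integrable[OF integrable_mult_indicator[OF _ integrable_power2_ev, of "{s k..s k+1}" v]] by simp
  qed (auto simp: integrable_power2_ev indicator_def)
  then have "(\<lambda>k. 2 * (LINT y|lebesgue. indicator {s k..s k+1} y * ((ev v y)\<^sup>2 + (dv v y)\<^sup>2))) \<longlonglongrightarrow> 0"
    by (intro tendsto_mult_right_zero) simp
  then have "(\<lambda>k. (ev v (s k))\<^sup>2) \<longlonglongrightarrow> 0"
    by (rule Lim_null_comparison[rotated]) (use ev_power2_le_local in auto)
  then have "(\<lambda>k. sqrt ((ev v (s k))\<^sup>2)) \<longlonglongrightarrow> sqrt 0" by (rule tendsto_real_sqrt)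
  then show ?thesis by (simp add: tendsto_rabs_zero_iff)
qed

lemma ev_tendsto_0_at_infinity:
  "(\<lambda>k::nat. ev v (real k)) \<longlonglongrightarrow> 0" "(\<lambda>k::nat. ev v (- real k)) \<longlonglongrightarrow> 0"
proof -
  have e: "\<forall>\<^sub>F k in sequentially. \<bar>x\<bar> + 1 < real k" for x
    using filterlim_at_top_dense filterlim_real_sequentially by blast
  show "(\<lambda>k::nat. ev v (real k)) \<longlonglongrightarrow> 0"
  proof (rule ev_tendsto_0)
    show "\<forall>\<^sub>F k in sequentially. x \<notin> {real k..real k + 1}" for x
      using e[of x] by eventually_elim auto
  qed
  show "(\<lambda>k::nat. ev v (- real k)) \<longlonglongrightarrow> 0"
  proof (rule ev_tendsto_0)
    show "\<forall>\<^sub>F k in sequentially. x \<notin> {- real k..- real k + 1}" for x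
      using e[of x] by eventually_elim auto
  qed
qed

text \<open>Integrability lets the integral be exhausted along integer endpoints, where the boundary
  terms share a limit and cancel.\<close>

lemma integral_derivative_eq_0:
  assumes p: "primitive w w'" and i: "integrable lebesgue w'"
    and l: "(\<lambda>k::nat. w (real k)) \<longlonglongrightarrow> c" "(\<lambda>k::nat. w (- real k)) \<longlonglongrightarrow> c"
  shows "(LINT x|lebesgue. w' x) = 0"
proof -
  have "(\<lambda>k. LINT x|lebesgue. indicator {- real k..real k} x *\<^sub>R w' x) \<longlonglongrightarrow> (LINT x|lebesgue. w' x)"
  proof (rule integral_dominated_convergence[where w = "\<lambda>x. \<bar>w' x\<bar>"])
    show "AE x in lebesgue. (\<lambda>k. indicator {- real k..real k} x *\<^sub>R w' x) \<longlonglongrightarrow> w' x"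
    proof (intro AE_I2 tendsto_eventually)
      fix x :: real
      have "\<forall>\<^sub>F k in sequentially. \<bar>x\<bar> < real k"
        using filterlim_at_top_dense filterlim_real_sequentially by blast
      then show "\<forall>\<^sub>F k in sequentially. indicator {- real k..real k} x *\<^sub>R w' x = w' x"
        by eventually_elim (auto simp: indicator_def)
    qed
    show "(\<lambda>x. indicator {- real k..real k} x *\<^sub>R w' x) \<in> borel_measurable lebesgue" for k
      by (rule borel_measurable_integrable[OF integrable_mult_indicator[OF _ i]]) simp
  qed (use i in \<open>auto simp: indicator_def\<close>)
  moreover have "(LINT x|lebesgue. indicator {- real k..real k} x *\<^sub>R w' x) = w (real k) - w (- real k)" for k
  proof -
    have "set_integrable lebesgue {-real k..real k} w'"
      using p by (simp add: primitive_def locally_integrable_def)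
    from set_lebesgue_integral_eq_integral(2)[OF this] show ?thesis
      using p by (simp add: primitive_def set_lebesgue_integral_def)
  qed
  ultimately have "(\<lambda>k. w (real k) - w (- real k)) \<longlonglongrightarrow> (LINT x|lebesgue. w' x)" by simp
  moreover have "(\<lambda>k. w (real k) - w (- real k)) \<longlonglongrightarrow> c - c" by (intro tendsto_diff l)
  ultimately show ?thesis using LIMSEQ_unique by fastforce
qed

subsection \<open>Symmetric variational problems\<close>

text \<open>Symmetry makes the equation the stationarity condition of
  \<open>J u = B u u / 2 - f u\<close>. Coercivity bounds \<open>J\<close> below by completing the
  square and, through the parallelogram identity, makes minimizing sequences Cauchy.\<close>

lemma symmetric_lax_milgram:
  fixes B :: "'a::banach \<Rightarrow> 'a \<Rightarrow> real"
  assumes add: "\<And>u v w. B (u + v) w = B u w + B v w"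
    and scale: "\<And>r u w. B (r *\<^sub>R u) w = r * B u w"
    and sym: "\<And>u w. B u w = B w u"
    and bound: "\<And>u w. \<bar>B u w\<bar> \<le> C * norm u * norm w"
    and c: "c > 0" and coercive: "\<And>u. c * (norm u)\<^sup>2 \<le> B u u"
    and f: "bounded_linear f"
  shows "\<exists>u. \<forall>w. B u w = f w"
proof -
  interpret f: bounded_linear f by (rule f)
  obtain K where K: "\<And>x. \<bar>f x\<bar> \<le> K * norm x" using f.bounded by (auto simp: mult.commute)
  have add': "B w (u + v) = B w u + B w v" and scale': "B w (r *\<^sub>R u) = r * B w u" for u v w r
    using add scale sym by metis+
  have minus: "B (- u) w = - B u w" "B w (- u) = - B w u" for u w
    using scale[of "-1"] scale'[of _ "-1"] by auto
  have diff: "B (u - v) w = B u w - B v w" "B w (u - v) = B w u - B w v" for u v w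
    using add[of u "- v"] add'[of w u "- v"] by (auto simp: minus)
  define J where "J u = B u u / 2 - f u" for u
  have low: "J u \<ge> - K\<^sup>2 / (2 * c)" for u
  proof -
    have "0 \<le> (c * norm u - K)\<^sup>2 / (2 * c)" using c by simp
    also have "\<dots> = c * (norm u)\<^sup>2 / 2 - K * norm u + K\<^sup>2 / (2 * c)"
      using c by (simp add: power2_diff field_simps power2_eq_square)
    finally show ?thesis using coercive[of u] K[of u] by (simp add: J_def)
  qed
  define m where "m = (INF u. J u)"
  have bdd: "bdd_below (range J)" by (rule bdd_belowI2[OF low])
  have m: "m \<le> J u" for u unfolding m_def using bdd by (intro cINF_lower) auto
  have "\<exists>u. J u < m + 1 / real (Suc k)" for k
    using cINF_less_iff[OF _ bdd, of "m + 1 / real (Suc k)"] by (auto simp: m_def[symmetric])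
  then obtain u where u: "\<And>k. J (u k) < m + 1 / real (Suc k)" by metis
  \<comment> \<open>Two near-minimizers must be close, since their midpoint cannot lie below the
    infimum \<open>m\<close>.\<close>
  have par: "c / 4 * (norm (v - w))\<^sup>2 \<le> J v + J w - 2 * m" for v w
  proof -
    have "J v + J w - 2 * J ((1/2) *\<^sub>R (v + w)) = B (v - w) (v - w) / 4"
      using sym[of v w] by (simp add: J_def add add' scale scale' diff f.add f.scaleR field_simps)
    then show ?thesis using coercive[of "v - w"] m[of "(1/2) *\<^sub>R (v + w)"] by simp
  qed
  have "Cauchy u"
  proof (rule CauchyI)
    fix e :: real assume e: "e > 0"
    obtain N where N: "1 / real (Suc N) < c * e\<^sup>2 / 8"
      using e c by (metis nat_approx_posE divide_pos_pos mult_pos_pos zero_less_numeral zero_less_power)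
    have "norm (u i - u j) < e" if "i \<ge> N" "j \<ge> N" for i j
    proof -
      have l: "1 / real (Suc k) \<le> 1 / real (Suc N)" if "k \<ge> N" for k
        using that by (intro divide_left_mono) auto
      have "c / 4 * (norm (u i - u j))\<^sup>2 < c / 4 * e\<^sup>2"
        using par[of "u i" "u j"] u[of i] u[of j] l[OF that(1)] l[OF that(2)] N by linarith
      then have "(norm (u i - u j))\<^sup>2 < e\<^sup>2" using c by simp
      then show ?thesis by (rule power2_less_imp_less) (use e in simp)
    qed
    then show "\<exists>N. \<forall>i\<ge>N. \<forall>j\<ge>N. norm (u i - u j) < e" by blast
  qed
  then obtain v where v: "u \<longlonglongrightarrow> v" using Cauchy_convergent_iff convergent_def by blast
  have "bounded_bilinear B"
  proof
    show "\<exists>C. \<forall>u w. norm (B u w) \<le> norm u * norm w * C"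
      using bound by (intro exI[of _ C]) (simp add: mult_ac)
  qed (auto simp: add add' scale scale')
  from bounded_bilinear.tendsto[OF this v v] have "(\<lambda>k. J (u k)) \<longlonglongrightarrow> J v"
    unfolding J_def by (intro tendsto_diff tendsto_divide tendsto_const f.tendsto v) simp_all
  moreover have "(\<lambda>k. J (u k)) \<longlonglongrightarrow> m"
  proof (rule tendsto_sandwich)
    show "\<forall>\<^sub>F k in sequentially. m \<le> J (u k)" using m by simp
    show "\<forall>\<^sub>F k in sequentially. J (u k) \<le> m + 1 / real (Suc k)"
      using u by (intro always_eventually allI less_imp_le)
    show "(\<lambda>k. m + 1 / real (Suc k)) \<longlonglongrightarrow> m"
      using tendsto_add[OF tendsto_const LIMSEQ_Suc[OF lim_1_over_n], of m] by simp
  qed simp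
  ultimately have Jv: "J v = m" by (rule LIMSEQ_unique)
  have "B v w = f w" for w
  proof -
    define a where "a = B v w - f w"
    have q: "0 \<le> t * a + t\<^sup>2 * B w w / 2" for t
    proof -
      have "J (v + t *\<^sub>R w) = J v + t * a + t\<^sup>2 * B w w / 2"
        using sym[of v w] by (simp add: J_def a_def add add' scale scale' f.add f.scaleR field_simps power2_eq_square)
      then show ?thesis using m[of "v + t *\<^sub>R w"] Jv by simp
    qed
    \<comment> \<open>The shift keeps \<open>b\<close> positive even when \<open>B w w = 0\<close>.
      The value t = -a/b minimizes t a + t^2 b / 2, with minimum -a^2/(2b), so nonnegativity forces
      \<open>a = 0\<close>.\<close>
    define b where "b = \<bar>B w w\<bar> + 1"
    have b: "b > 0" "B w w \<le> b" by (auto simp: b_def)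
    have "0 \<le> - (a\<^sup>2 / b) + (a / b)\<^sup>2 * B w w / 2" using q[of "- a / b"] by (simp add: power2_eq_square)
    also have "\<dots> \<le> - (a\<^sup>2 / b) + (a / b)\<^sup>2 * b / 2"
      using b by (intro add_left_mono divide_right_mono mult_left_mono) auto
    also have "\<dots> = - (a\<^sup>2 / (2 * b))" using b by (simp add: field_simps power2_eq_square)
    finally have "a\<^sup>2 / (2 * b) \<le> 0" by simp
    then have "a = 0" using b by (simp add: divide_le_0_iff)
    then show ?thesis by (simp add: a_def)
  qed
  then show ?thesis by blast
qed

subsection \<open>Ordinary differential equations in Banach spaces\<close>

definition ball_retraction :: "real \<Rightarrow> 'a::real_normed_vector \<Rightarrow> 'a" where
  "ball_retraction r v = (r / max r (norm v)) *\<^sub>R v"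

lemma norm_ball_retraction: "r > 0 \<Longrightarrow> norm (ball_retraction r v) \<le> r"
  by (auto simp: ball_retraction_def max_def field_simps)

lemma ball_retraction_eq: "r > 0 \<Longrightarrow> norm v \<le> r \<Longrightarrow> ball_retraction r v = v"
  by (simp add: ball_retraction_def max_def)

text \<open>Changing the vector at a fixed scale and the scale at a fixed vector each cost at most
  \<open>norm (v - w)\<close>. In a general normed space the radial retraction need not be
  nonexpansive.\<close>

lemma ball_retraction_lipschitz:
  assumes r: "r > 0"
  shows "norm (ball_retraction r v - ball_retraction r w) \<le> 2 * norm (v - w)"
proof -
  define a b where "a = max r (norm v)" and "b = max r (norm w)"
  have ab: "a > 0" "b > 0" "r \<le> a" "norm w \<le> b" using r by (auto simp: a_def b_def)
  have "ball_retraction r v - ball_retraction r w = (r / a) *\<^sub>R (v - w) + (r / a - r / b) *\<^sub>R w"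
    by (simp add: ball_retraction_def a_def b_def algebra_simps)
  then have "norm (ball_retraction r v - ball_retraction r w) \<le> \<bar>r / a\<bar> * norm (v - w) + \<bar>r / a - r / b\<bar> * norm w"
    by (metis norm_triangle_ineq norm_scaleR)
  also have "\<bar>r / a\<bar> * norm (v - w) \<le> 1 * norm (v - w)"
    using r ab by (intro mult_right_mono) (auto simp: field_simps)
  also have "\<bar>r / a - r / b\<bar> * norm w \<le> norm (v - w)"
  proof -
    have "r / a - r / b = (r / a) * ((b - a) / b)" using ab by (simp add: field_simps)
    then have "\<bar>r / a - r / b\<bar> * norm w = (r / a) * (norm w / b) * \<bar>b - a\<bar>"
      using r ab by (simp add: abs_mult)
    also have "\<dots> \<le> 1 * 1 * \<bar>b - a\<bar>"
      using r ab by (intro mult_right_mono mult_mono) auto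
    also have "\<bar>b - a\<bar> \<le> \<bar>norm w - norm v\<bar>" by (auto simp: a_def b_def max_def)
    also have "\<dots> \<le> norm (v - w)" by (metis norm_minus_commute norm_triangle_ineq3)
    finally show ?thesis by simp
  qed
  finally show ?thesis by simp
qed

lemma at_within_halfline: "t < T \<Longrightarrow> at t within {0..T} = at t within {0..}" for t :: real
  by (rule at_within_nhd[of _ "{..<T}"]) auto

lemma at_within_halfline_interior: "0 < t \<Longrightarrow> at t within {0..} = at t" for t :: real
  by (rule at_within_nhd[of _ "{0<..}"]) auto

text \<open>The strict inequality \<open>t < T\<close> matters: at the right endpoint the integral
  equation on \<open>{0..T}\<close> gives only a one-sided derivative.\<close>

lemma integral_equation_imp_ode:
  fixes V :: "real \<Rightarrow> 'a::banach"
  assumes f: "continuous_on {0..T} f" and V: "\<And>t. 0 \<le> t \<Longrightarrow> t \<le> T \<Longrightarrow> V t = v0 + integral {0..t} f"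
    and t: "0 \<le> t" "t < T"
  shows "(V has_vector_derivative f t) (at t within {0..})"
proof -
  have "((\<lambda>t. integral {0..t} f) has_vector_derivative f t) (at t within {0..T})"
    by (rule integral_has_vector_derivative[OF f]) (use t in auto)
  then have "((\<lambda>t. v0 + integral {0..t} f) has_vector_derivative 0 + f t) (at t within {0..T})"
    by (intro has_vector_derivative_add has_vector_derivative_const)
  then have "(V has_vector_derivative 0 + f t) (at t within {0..T})"
    by (rule has_vector_derivative_transform[rotated 2]) (use t V in auto)
  then show ?thesis using at_within_halfline[OF t(2)] by simp
qed

text \<open>The Picard operator is a contraction of the bounded continuous functions in the unknown
  \<open>exp (- K t) (V t - v0)\<close> once \<open>K\<close> exceeds the Lipschitz constant.\<close>

lemma global_lipschitz_ode:
  fixes X :: "'a::banach \<Rightarrow> 'a"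
  assumes lip: "\<And>v w. norm (X v - X w) \<le> L * norm (v - w)" and M: "\<And>v. norm (X v) \<le> M"
    and L: "L \<ge> 0"
  shows "\<exists>V. V 0 = v0 \<and> (\<forall>t\<ge>0. (V has_vector_derivative X (V t)) (at t within {0..}))"
proof -
  \<comment> \<open>Integrating \<open>L * exp (K * s)\<close> and weighting by
    \<open>exp (- K * t)\<close> leaves the factor \<open>L / K\<close>, which this choice keeps at
    most 1/2; the added 1 covers \<open>L = 0\<close>.\<close>
  define K where "K = 2 * L + 1"
  have K: "K > 0" "L / K \<le> 1/2" using L by (auto simp: K_def field_simps)
  have M0: "M \<ge> 0" using M[of 0] norm_ge_zero order_trans by blast
  have Xc: "continuous_on S X" for S
    by (rule lipschitz_on_continuous_on[of L]) (auto intro!: lipschitz_onI simp: dist_norm lip L)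
  define Y where "Y w s = X (v0 + exp (K * s) *\<^sub>R apply_bcontfun w s)" for w :: "real \<Rightarrow>\<^sub>C 'a" and s
  have Yc: "continuous_on S (Y w)" for S w
    unfolding Y_def by (intro continuous_on_compose2[OF Xc[of UNIV]] continuous_intros) auto
  have Yi: "Y w integrable_on {0..t}" for w t by (rule integrable_continuous_interval[OF Yc])
  \<comment> \<open>Bounded continuous functions live on the whole line; \<open>max 0 t\<close>
    continues the operator by its value at time 0.\<close>
  define T where "T w t = exp (- K * max 0 t) *\<^sub>R integral {0..max 0 t} (Y w)" for w t
  have T: "T w \<in> bcontfun" for w
  proof (rule bcontfun_normI)
    have "continuous_on UNIV (\<lambda>t. integral {0..max 0 t} (Y w))"
    proof (intro continuous_at_imp_continuous_on ballI)
      fix t :: real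
      have "continuous_on {0..\<bar>t\<bar>+1} (\<lambda>t. integral {0..t} (Y w))"
        by (rule indefinite_integral_continuous_1[OF Yi])
      then have "continuous_on {..<\<bar>t\<bar>+1} (\<lambda>t. integral {0..max 0 t} (Y w))"
        by (rule continuous_on_compose2) (auto intro!: continuous_intros)
      then show "isCont (\<lambda>t. integral {0..max 0 t} (Y w)) t"
        by (subst (asm) continuous_on_eq_continuous_at) auto
    qed
    then show "continuous_on UNIV (T w)" unfolding T_def by (intro continuous_intros)
    fix t :: real
    define s where "s = max 0 t"
    have s: "s \<ge> 0" by (simp add: s_def)
    have "norm (integral {0..s} (Y w)) \<le> M * (s - 0)"
      by (rule integral_bound) (use s Yc M in \<open>auto simp: Y_def\<close>)
    then have "norm (T w t) \<le> exp (- K * s) * (M * s)"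
      unfolding T_def s_def[symmetric] by (simp add: mult_left_mono)
    also have "\<dots> \<le> M / K"
    proof -
      \<comment> \<open>The integral may grow like \<open>M * s\<close>; this inequality shows that
        the exponential weight reduces it to at most \<open>M / K\<close>. The global bound on the
        field is what makes the operator act on bounded functions.\<close>
      have "K * s \<le> exp (K * s)" using exp_ge_add_one_self[of "K * s"] by linarith
      then have "M * (K * s) \<le> M * exp (K * s)" using M0 by (rule mult_left_mono)
      then show ?thesis using K by (simp add: exp_minus field_simps)
    qed
    finally show "norm (T w t) \<le> M / K" .
  qed
  define P where "P w = Bcontfun (T w)" for w
  have P: "apply_bcontfun (P w) = T w" for w
    unfolding P_def by (rule Bcontfun_inverse[OF T])
  have "dist (P w) (P z) \<le> 1/2 * dist w z" for w z
  proof (rule dist_bound)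
    fix t :: real
    define s where "s = max 0 t"
    have s: "s \<ge> 0" by (simp add: s_def)
    have d: "((\<lambda>y. L * dist w z * exp (K * y)) has_integral (L * dist w z * exp (K * s) / K - L * dist w z * exp (K * 0) / K)) {0..s}"
      by (rule fundamental_theorem_of_calculus[OF s])
        (use K in \<open>auto intro!: derivative_eq_intros simp: has_real_derivative_iff_has_vector_derivative[symmetric]\<close>)
    have "norm (integral {0..s} (\<lambda>y. Y w y - Y z y)) \<le> integral {0..s} (\<lambda>y. L * dist w z * exp (K * y))"
    proof (rule Henstock_Kurzweil_Integration.integral_norm_bound_integral)
      fix y
      have "norm (Y w y - Y z y) \<le> L * norm ((v0 + exp (K * y) *\<^sub>R w y) - (v0 + exp (K * y) *\<^sub>R z y))"
        unfolding Y_def by (rule lip)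
      also have "(v0 + exp (K * y) *\<^sub>R w y) - (v0 + exp (K * y) *\<^sub>R z y) = exp (K * y) *\<^sub>R (w y - z y)"
        by (simp add: scaleR_diff_right)
      also have "L * norm \<dots> \<le> L * (exp (K * y) * dist w z)"
        using L dist_bounded[of w y z] by (simp add: dist_norm mult_left_mono)
      finally show "norm (Y w y - Y z y) \<le> L * dist w z * exp (K * y)" by (simp add: mult_ac)
    qed (use d Yi in \<open>auto intro: integrable_diff\<close>)
    also have "\<dots> \<le> L / K * exp (K * s) * dist w z"
      unfolding integral_unique[OF d] using K L by (simp add: field_simps)
    also have "\<dots> \<le> 1/2 * exp (K * s) * dist w z" using K by (intro mult_right_mono) auto
    finally have "norm (integral {0..s} (Y w) - integral {0..s} (Y z)) \<le> 1/2 * exp (K * s) * dist w z"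
      by (simp add: Henstock_Kurzweil_Integration.integral_diff[OF Yi Yi])
    then have "exp (- K * s) * norm (integral {0..s} (Y w) - integral {0..s} (Y z))
       \<le> exp (- K * s) * (1/2 * exp (K * s) * dist w z)" by (rule mult_left_mono) simp
    also have "\<dots> = 1/2 * dist w z" by (simp add: exp_minus)
    also have "exp (- K * s) * norm (integral {0..s} (Y w) - integral {0..s} (Y z)) = dist (P w t) (P z t)"
      unfolding P T_def s_def[symmetric] dist_norm[where 'a='a] scaleR_diff_right[symmetric] by simp
    finally show "dist (P w t) (P z t) \<le> 1/2 * dist w z" .
  qed
  then obtain w where w: "P w = w" using banach_fix_type[of "1/2" P] by auto
  define V where "V t = v0 + exp (K * t) *\<^sub>R apply_bcontfun w t" for t
  have V: "V t = v0 + integral {0..t} (\<lambda>s. X (V s))" if "t \<ge> 0" for t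
  proof -
    have "w t = exp (- K * t) *\<^sub>R integral {0..t} (Y w)"
      using P[of w] that unfolding w T_def by (simp add: fun_eq_iff)
    then have "exp (K * t) *\<^sub>R w t = integral {0..t} (Y w)" by (simp add: exp_minus)
    then show ?thesis unfolding V_def Y_def by simp
  qed
  have "continuous_on S (\<lambda>s. X (V s))" for S using Yc[of S w] unfolding Y_def V_def .
  then have "(V has_vector_derivative X (V t)) (at t within {0..})" if "t \<ge> 0" for t
    by (rule integral_equation_imp_ode[of "t + 1" "\<lambda>s. X (V s)"]) (use V that in auto)
  moreover have "V 0 = v0" using V[of 0] by simp
  ultimately show ?thesis by blast
qed

text \<open>The inner product makes the squared distance differentiable, also where it vanishes, and
  the weight \<open>exp (- 2 * L * t)\<close> makes it nonincreasing.\<close>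

lemma ode_unique_inner:
  fixes V W :: "real \<Rightarrow> 'a::real_inner"
  assumes V: "\<And>t. 0 \<le> t \<Longrightarrow> (V has_vector_derivative V' t) (at t within {0..})"
    and W: "\<And>t. 0 \<le> t \<Longrightarrow> (W has_vector_derivative W' t) (at t within {0..})"
    and L: "\<And>t. 0 \<le> t \<Longrightarrow> norm (V' t - W' t) \<le> L * norm (V t - W t)"
    and 0: "V 0 = W 0" and t: "0 \<le> t"
  shows "V t = W t"
proof -
  define D where "D t = V t - W t" for t
  define D' where "D' t = V' t - W' t" for t
  have D: "(D has_vector_derivative D' t) (at t within {0..})" if "0 \<le> t" for t
    unfolding D_def D'_def by (intro has_vector_derivative_diff V W that)
  have Dc: "continuous_on {0..} D"
    by (rule continuous_on_vector_derivative[of _ _ D']) (simp add: D)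
  define F where "F t = exp (- 2 * L * t) * (D t \<bullet> D t)" for t
  have "F 0 \<ge> F t"
  proof (rule DERIV_nonpos_imp_decreasing_open[OF t])
    show "continuous_on {0..t} F"
      unfolding F_def by (intro continuous_intros continuous_on_subset[OF Dc]) auto
    fix s assume s: "0 < s" "s < t"
    have "at s within {0..} = at s" using s by (intro at_within_halfline_interior)
    then have "(D has_derivative (\<lambda>h. h *\<^sub>R D' s)) (at s)"
      using D[of s] s by (simp add: has_vector_derivative_def)
    from has_derivative_inner[OF this this]
    have i: "((\<lambda>t. D t \<bullet> D t) has_real_derivative 2 * (D s \<bullet> D' s)) (at s)"
      unfolding has_field_derivative_def by (rule has_derivative_eq_rhs) (auto simp: inner_commute fun_eq_iff)
    have e: "((\<lambda>t. exp (- 2 * L * t)) has_real_derivative exp (- 2 * L * s) * (- 2 * L)) (at s)"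
      by (auto intro!: derivative_eq_intros)
    have "(F has_real_derivative exp (- 2 * L * s) * (- 2 * L) * (D s \<bullet> D s) + 2 * (D s \<bullet> D' s) * exp (- 2 * L * s)) (at s)"
      unfolding F_def by (rule DERIV_mult[OF e i])
    moreover have "D s \<bullet> D' s \<le> L * (D s \<bullet> D s)"
    proof -
      have "D s \<bullet> D' s \<le> norm (D s) * norm (D' s)" by (rule norm_cauchy_schwarz)
      also have "\<dots> \<le> norm (D s) * (L * norm (D s))"
        using L[of s] s by (intro mult_left_mono) (auto simp: D_def D'_def)
      finally show ?thesis by (simp add: power2_norm_eq_inner[symmetric] power2_eq_square mult_ac)
    qed
    then have "exp (- 2 * L * s) * (2 * (D s \<bullet> D' s - L * (D s \<bullet> D s))) \<le> 0"
      by (intro mult_nonneg_nonpos) auto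
    ultimately show "\<exists>y. (F has_real_derivative y) (at s) \<and> y \<le> 0"
      by (intro exI conjI) (auto simp: algebra_simps)
  qed
  then have "D t \<bullet> D t \<le> 0" using 0 by (simp add: F_def D_def mult_le_0_iff)
  then have "D t \<bullet> D t = 0" using inner_ge_zero[of "D t"] by linarith
  then show ?thesis by (simp add: D_def)
qed

text \<open>At the first time when \<open>g\<close> reaches \<open>r\<close>, the improved bound
  \<eta> holds at all earlier times and passes to the limit from the left; the gap between \<eta>
  and \<open>r\<close> is the contradiction. The first time exists because the set of such times is
  closed.\<close>

lemma continuity_bootstrap:
  fixes g :: "real \<Rightarrow> real"
  assumes g: "continuous_on {0..} g" and 0: "g 0 < r" and \<eta>: "\<eta> < r"
    and step: "\<And>T. 0 \<le> T \<Longrightarrow> (\<And>s. 0 \<le> s \<Longrightarrow> s \<le> T \<Longrightarrow> g s \<le> r) \<Longrightarrow> g T \<le> \<eta>"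
    and t: "0 \<le> t"
  shows "g t \<le> \<eta>"
proof -
  define S where "S = {t \<in> {0..}. r \<le> g t}"
  have "S = {}"
  proof (rule ccontr)
    assume ne: "S \<noteq> {}"
    have "closed S" unfolding S_def by (intro continuous_on_closed_Collect_le[OF continuous_on_const g]) auto
    have bdd: "bdd_below S" by (rule bdd_belowI[of _ 0]) (auto simp: S_def)
    define T where "T = Inf S"
    have "T \<in> S" unfolding T_def by (rule closed_contains_Inf[OF ne bdd \<open>closed S\<close>])
    then have T: "T > 0" "r \<le> g T" using 0 by (auto simp: S_def less_le)
    have below: "g s < r" if "0 \<le> s" "s < T" for s
      using cInf_lower[OF _ bdd, of s] that by (fastforce simp: T_def S_def)
    have le: "g s \<le> \<eta>" if "0 \<le> s" "s < T" for s
      using step[OF that(1)] below that by (meson le_less_trans less_imp_le)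
    have "continuous (at T within {0..}) g" using g T by (simp add: continuous_on_eq_continuous_within)
    moreover have "at T within {0..} = at T" using T by (intro at_within_halfline_interior)
    ultimately have "isCont g T" by simp
    then have "(g \<longlongrightarrow> g T) (at_left T)" by (simp add: continuous_within filterlim_at_split)
    moreover have "\<forall>\<^sub>F s in at_left T. g s \<le> \<eta>"
      using eventually_at_left_real[OF T(1)] by eventually_elim (auto intro: le)
    ultimately have "g T \<le> \<eta>" by (rule tendsto_upperbound) simp
    then show False using T \<eta> by simp
  qed
  then have "g s < r" if "0 \<le> s" for s using that by (force simp: S_def)
  then show ?thesis using step[OF t] by (meson less_imp_le)
qed

subsection \<open>Scalar estimates near \<open>1\<close>\<close>

lemma mean_value_pos:
  fixes F :: "real \<Rightarrow> real"
  assumes F: "\<And>y. y > 0 \<Longrightarrow> (F has_real_derivative F' y) (at y)" and xy: "x > 0" "y > 0"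
  shows "\<exists>z. min x y \<le> z \<and> z \<le> max x y \<and> F y - F x = F' z * (y - x)"
proof (cases x y rule: linorder_cases)
  case less
  then obtain z where "x < z" "z < y" "F y - F x = (y - x) * F' z"
    using MVT2[of x y F F'] F xy by auto
  then show ?thesis by (intro exI[of _ z]) auto
next
  case greater
  then obtain z where "y < z" "z < x" "F x - F y = (x - y) * F' z"
    using MVT2[of y x F F'] F xy by auto
  then show ?thesis by (intro exI[of _ z]) (auto simp: algebra_simps)
qed auto

text \<open>One constant for every scalar estimate: sup bounds control weights, Lipschitz bounds
  control their dependence on the profile, and the quadratic remainder serves the differentiability
  of the energy.\<close>

definition taylor_bounded :: "(real \<Rightarrow> real) \<Rightarrow> (real \<Rightarrow> real) \<Rightarrow> real \<Rightarrow> bool" where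
  "taylor_bounded F F' C \<longleftrightarrow>
     (\<forall>y>0. (F has_real_derivative F' y) (at y)) \<and> continuous_on {0<..} F' \<and>
     (\<forall>y\<in>{1/2..3/2}. \<bar>F y\<bar> \<le> C \<and> \<bar>F' y\<bar> \<le> C) \<and>
     (\<forall>x\<in>{1/2..3/2}. \<forall>y\<in>{1/2..3/2}. \<bar>F y - F x\<bar> \<le> C * \<bar>y - x\<bar> \<and> \<bar>F' y - F' x\<bar> \<le> C * \<bar>y - x\<bar> \<and>
        \<bar>F y - F x - F' x * (y - x)\<bar> \<le> C * (y - x)\<^sup>2)"

lemma taylor_bounded_mono:
  "taylor_bounded F F' C \<Longrightarrow> C \<le> D \<Longrightarrow> taylor_bounded F F' D"
  unfolding taylor_bounded_def
  by (meson abs_ge_zero mult_right_mono order_trans zero_le_power2)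

text \<open>\<open>C\<close> bounds the function and two derivatives on a compact interval. The
  remainder uses the mean value theorem twice, which loses only the factor 1/2 of Taylor's
  formula.\<close>

lemma taylor_boundedI:
  assumes F: "\<And>y. y > 0 \<Longrightarrow> (F has_real_derivative F' y) (at y)"
    and F': "\<And>y. y > 0 \<Longrightarrow> (F' has_real_derivative F'' y) (at y)"
    and F'': "continuous_on {0<..} F''"
  shows "\<exists>C. taylor_bounded F F' C"
proof -
  have c: "continuous_on {0<..} F" "continuous_on {0<..} F'"
    using F F' by (auto intro!: continuous_at_imp_continuous_on intro: DERIV_isCont)
  have bnd: "\<exists>B. \<forall>y\<in>{1/2..3/2}. \<bar>H y\<bar> \<le> B" if "continuous_on {0<..} H" for H :: "real \<Rightarrow> real"
  proof -
    have "compact (H ` {1/2..3/2})"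
      by (intro compact_continuous_image continuous_on_subset[OF that]) auto
    then have "bounded (H ` {1/2..3/2})" by (rule compact_imp_bounded)
    then show ?thesis by (auto simp: bounded_iff)
  qed
  obtain B0 B1 B2 where B: "\<And>y. y \<in> {1/2..3/2} \<Longrightarrow> \<bar>F y\<bar> \<le> B0 \<and> \<bar>F' y\<bar> \<le> B1 \<and> \<bar>F'' y\<bar> \<le> B2"
    using bnd[OF c(1)] bnd[OF c(2)] bnd[OF F''] by metis
  define C where "C = max B0 (max B1 B2)"
  have C: "\<bar>F y\<bar> \<le> C" "\<bar>F' y\<bar> \<le> C" "\<bar>F'' y\<bar> \<le> C" if "y \<in> {1/2..3/2}" for y
    using B[OF that] by (auto simp: C_def)
  have lip: "\<bar>H y - H x\<bar> \<le> C * \<bar>y - x\<bar>"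
    if H: "\<And>y. y > 0 \<Longrightarrow> (H has_real_derivative H' y) (at y)" "\<And>y. y \<in> {1/2..3/2} \<Longrightarrow> \<bar>H' y\<bar> \<le> C"
      and xy: "x \<in> {1/2..3/2}" "y \<in> {1/2..3/2}" for H H' x y
  proof -
    obtain z where z: "min x y \<le> z" "z \<le> max x y" "H y - H x = H' z * (y - x)"
      using mean_value_pos[of H H' x y] H(1) xy by auto
    then have "\<bar>H' z\<bar> \<le> C" using xy by (intro H(2)) (auto simp: min_def max_def split: if_splits)
    then show ?thesis unfolding z(3) abs_mult by (rule mult_right_mono) simp
  qed
  have "\<bar>F y - F x - F' x * (y - x)\<bar> \<le> C * (y - x)\<^sup>2"
    if xy: "x \<in> {1/2..3/2}" "y \<in> {1/2..3/2}" for x y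
  proof -
    obtain z where z: "min x y \<le> z" "z \<le> max x y" "F y - F x = F' z * (y - x)"
      using mean_value_pos[of F F' x y] F xy by auto
    then have zI: "z \<in> {1/2..3/2}" using xy by (auto simp: min_def max_def split: if_splits)
    have "C \<ge> 0" using C(1)[OF xy(1)] by linarith
    have "F y - F x - F' x * (y - x) = (F' z - F' x) * (y - x)" using z(3) by (simp add: algebra_simps)
    then have "\<bar>F y - F x - F' x * (y - x)\<bar> = \<bar>F' z - F' x\<bar> * \<bar>y - x\<bar>" by (simp add: abs_mult)
    also have "\<dots> \<le> (C * \<bar>z - x\<bar>) * \<bar>y - x\<bar>"
      using lip[OF F' C(3) xy(1) zI] by (intro mult_right_mono) auto
    also have "\<dots> \<le> (C * \<bar>y - x\<bar>) * \<bar>y - x\<bar>"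
      using z \<open>C \<ge> 0\<close> by (intro mult_right_mono mult_left_mono) (auto simp: min_def max_def split: if_splits)
    finally show ?thesis by (simp add: power2_eq_square abs_mult_self_eq mult.assoc)
  qed
  then show ?thesis
    unfolding taylor_bounded_def using F c(2) C lip[OF F C(2)] lip[OF F' C(3)] by (intro exI[of _ C]) blast
qed

lemma taylor_bounded_powr: "\<exists>C. taylor_bounded (\<lambda>y. c * y powr a) (\<lambda>y. c * (a * y powr (a - 1))) C"
proof (rule taylor_boundedI)
  show "continuous_on {0<..} (\<lambda>y::real. c * (a * ((a - 1) * y powr (a - 1 - 1))))"
    by (intro continuous_intros) auto
qed (auto intro!: derivative_eq_intros)

text \<open>Compactness, rather than monotonicity, treats exponents of either sign at once.\<close>

lemma powr_lower_bound: "\<exists>\<alpha>>0. \<forall>y\<in>{1/2..3/2}. \<alpha> \<le> y powr a" for a :: real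
proof -
  have "continuous_on {1/2..3/2} (\<lambda>y::real. y powr a)" by (intro continuous_intros) auto
  then obtain x :: real where x: "x \<in> {1/2..3/2}" "\<forall>y\<in>{1/2..3/2}. x powr a \<le> y powr a"
    using continuous_attains_inf[of "{1/2..3/2::real}" "\<lambda>y. y powr a"] by auto
  then show ?thesis by (intro exI[of _ "x powr a"]) auto
qed

text \<open>Abstract antiderivatives avoid explicit formulas, which become logarithmic for
  exceptional exponents such as n + m = 1.\<close>

lemma antiderivative_pos:
  fixes f :: "real \<Rightarrow> real"
  assumes "continuous_on {0<..} f"
  shows "\<exists>F. (\<forall>y>0. (F has_real_derivative f y) (at y)) \<and> F 1 = 0"
proof -
  have "isCont f x" if "x > 0" for x
    using assms that by (simp add: continuous_on_eq_continuous_at)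
  then obtain F where "\<forall>x::real. 0 < ereal x \<longrightarrow> ereal x < \<infinity> \<longrightarrow> (F has_vector_derivative f x) (at x)"
    using einterval_antiderivative[of 0 "\<infinity>" f] by (auto simp: zero_ereal_def)
  then have "\<forall>y>0. ((\<lambda>y. F y - F 1) has_real_derivative f y) (at y)"
    by (auto simp: has_real_derivative_iff_has_vector_derivative intro!: derivative_eq_intros)
  then show ?thesis by (intro exI[of _ "\<lambda>y. F y - F 1"]) auto
qed

subsection \<open>Weighted forms on \<open>H\<^sup>1\<close>\<close>

lemma
  assumes h: "continuous_on UNIV h" and b: "\<And>x. \<bar>h x\<bar> \<le> A" and f: "square_integrable f"
  shows square_integrable_weight: "square_integrable (\<lambda>x. h x * f x)"
    and l2_weight: "l2 (\<lambda>x. h x * f x) \<le> A * l2 f"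
proof -
  have m: "(\<lambda>x. h x * f x) \<in> borel_measurable lebesgue"
    by (intro borel_measurable_times continuous_imp_measurable_lebesgue[OF h] square_integrable_measurable[OF f])
  have le: "AE x in lebesgue. \<bar>h x * f x\<bar> \<le> A * \<bar>f x\<bar>"
    using b by (intro AE_I2) (simp add: abs_mult mult_right_mono)
  have A: "A \<ge> 0" using b[of 0] by linarith
  show "square_integrable (\<lambda>x. h x * f x)" by (rule square_integrable_dominated[OF f m le])
  show "l2 (\<lambda>x. h x * f x) \<le> A * l2 f" by (rule l2_dominated[OF f m le A])
qed

lemma
  assumes h: "square_integrable h"
  shows bounded_linear_integral_ev: "bounded_linear (\<lambda>w. LINT x|lebesgue. h x * ev w x)"
    and bounded_linear_integral_dv: "bounded_linear (\<lambda>w. LINT x|lebesgue. h x * dv w x)"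
proof -
  note i = square_integrable_mult[OF h square_integrable_ev] square_integrable_mult[OF h square_integrable_dv]
  have c: "\<bar>LINT x|lebesgue. h x * ev w x\<bar> \<le> norm w * l2 h" "\<bar>LINT x|lebesgue. h x * dv w x\<bar> \<le> norm w * l2 h" for w
    using l2_Cauchy_Schwarz[OF h square_integrable_ev[of w]] mult_left_mono[OF l2_ev_le[of w] l2_nonneg[of h]]
      l2_Cauchy_Schwarz[OF h square_integrable_dv[of w]] mult_left_mono[OF l2_dv_le[of w] l2_nonneg[of h]]
    by (simp_all add: mult.commute)
  have cong: "(LINT x|lebesgue. h x * f x) = (LINT x|lebesgue. h x * g x)"
    if "square_integrable f" "square_integrable g" "AE x in lebesgue. f x = g x" for f g
    by (rule integral_mult_cong_AE[OF h that(1) h that(2)]) (use that(3) in auto)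
  show "bounded_linear (\<lambda>w. LINT x|lebesgue. h x * ev w x)"
  proof (rule bounded_linear_intro[where K = "l2 h"])
    show "norm (LINT x|lebesgue. h x * ev w x) \<le> norm w * l2 h" for w using c by simp
  qed (use i in \<open>simp_all add: ev_add ev_scaleR distrib_left mult.left_commute\<close>)
  show "bounded_linear (\<lambda>w. LINT x|lebesgue. h x * dv w x)"
  proof (rule bounded_linear_intro[where K = "l2 h"])
    show "(LINT x|lebesgue. h x * dv (v + w) x) = (LINT x|lebesgue. h x * dv v x) + (LINT x|lebesgue. h x * dv w x)" for v w
      using i by (subst cong[OF _ _ dv_add]) (auto intro: square_integrable_add square_integrable_dv simp: distrib_left)
    show "(LINT x|lebesgue. h x * dv (r *\<^sub>R w) x) = r *\<^sub>R (LINT x|lebesgue. h x * dv w x)" for r w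
      using i by (subst cong[OF _ _ dv_scaleR]) (auto intro: square_integrable_cmult square_integrable_dv simp: mult.left_commute)
    show "norm (LINT x|lebesgue. h x * dv w x) \<le> norm w * l2 h" for w using c by simp
  qed
qed

text \<open>Here the pairing uses the sup bound on \<open>ev w\<close> in place of Cauchy-Schwarz.
  It is meant for the energy term containing \<open>(dv v x)\<^sup>2\<close>, which is integrable
  but in general not square integrable.\<close>

lemma bounded_linear_integral_ev_L1:
  assumes h: "integrable lebesgue h"
  shows "bounded_linear (\<lambda>w. LINT x|lebesgue. h x * ev w x)"
proof -
  have i: "integrable lebesgue (\<lambda>x. h x * ev w x)" for w
  proof (rule Bochner_Integration.integrable_bound[where f = "\<lambda>x. (2 * norm w) * h x"])
    show "AE x in lebesgue. norm (h x * ev w x) \<le> norm ((2 * norm w) * h x)"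
      using mult_left_mono[OF abs_ev_le[of w]] by (intro AE_I2) (simp add: abs_mult mult.commute)
  qed (use h borel_measurable_times[OF borel_measurable_integrable[OF h] measurable_ev] in auto)
  show ?thesis
  proof (rule bounded_linear_intro[where K = "2 * (LINT x|lebesgue. \<bar>h x\<bar>)"])
    fix w
    have "norm (LINT x|lebesgue. h x * ev w x) \<le> (LINT x|lebesgue. (2 * norm w) * \<bar>h x\<bar>)"
    proof (rule Bochner_Integration.integral_norm_bound_integral[OF i])
      show "norm (h x * ev w x) \<le> (2 * norm w) * \<bar>h x\<bar>" for x
        using mult_left_mono[OF abs_ev_le[of w x], of "\<bar>h x\<bar>"] by (simp add: abs_mult mult.commute)
    qed (use h in auto)
    then show "norm (LINT x|lebesgue. h x * ev w x) \<le> norm w * (2 * (LINT x|lebesgue. \<bar>h x\<bar>))"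
      by (simp add: mult_ac)
  qed (use i in \<open>simp_all add: ev_add ev_scaleR distrib_left mult.left_commute\<close>)
qed

definition wform :: "(real \<Rightarrow> real) \<Rightarrow> (real \<Rightarrow> real) \<Rightarrow> h1 \<Rightarrow> h1 \<Rightarrow> real" where
  "wform a b u w = (LINT x|lebesgue. a x * dv u x * dv w x) + (LINT x|lebesgue. b x * ev u x * ev w x)"

lemma wform_commute: "wform a b u w = wform a b w u"
  unfolding wform_def by (simp add: mult.assoc mult.commute[of "dv u _"] mult.commute[of "ev u _"])

context
  fixes a b :: "real \<Rightarrow> real" and A :: real
  assumes a: "continuous_on UNIV a" "\<And>x. \<bar>a x\<bar> \<le> A" and b: "continuous_on UNIV b" "\<And>x. \<bar>b x\<bar> \<le> A"
begin

lemma bounded_linear_wform: "bounded_linear (wform a b u)"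
  unfolding wform_def
  by (intro bounded_linear_add bounded_linear_integral_dv bounded_linear_integral_ev
      square_integrable_weight[OF a] square_integrable_weight[OF b] square_integrable_ev square_integrable_dv)

lemma bounded_linear_wform_left: "bounded_linear (\<lambda>u. wform a b u w)"
  using bounded_linear_wform[of w] by (subst wform_commute)

lemma abs_wform_le: "\<bar>wform a b u w\<bar> \<le> 2 * A * norm u * norm w"
proof -
  have A: "A \<ge> 0" using a(2)[of 0] by linarith
  have "\<bar>LINT x|lebesgue. a x * dv u x * dv w x\<bar> \<le> l2 (\<lambda>x. a x * dv u x) * l2 (dv w)"
    by (rule l2_Cauchy_Schwarz[OF square_integrable_weight[OF a square_integrable_dv] square_integrable_dv])
  also have "\<dots> \<le> (A * norm u) * norm w"
    using l2_weight[OF a square_integrable_dv, of u] mult_left_mono[OF l2_dv_le[of u] A] A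
    by (intro mult_mono l2_dv_le) (auto simp: l2_nonneg)
  finally have 1: "\<bar>LINT x|lebesgue. a x * dv u x * dv w x\<bar> \<le> A * norm u * norm w" .
  have "\<bar>LINT x|lebesgue. b x * ev u x * ev w x\<bar> \<le> l2 (\<lambda>x. b x * ev u x) * l2 (ev w)"
    by (rule l2_Cauchy_Schwarz[OF square_integrable_weight[OF b square_integrable_ev] square_integrable_ev])
  also have "\<dots> \<le> (A * norm u) * norm w"
    using l2_weight[OF b square_integrable_ev, of u] mult_left_mono[OF l2_ev_le[of u] A] A
    by (intro mult_mono l2_ev_le) (auto simp: l2_nonneg)
  finally show ?thesis using 1 unfolding wform_def by linarith
qed

lemma wform_coercive:
  assumes "\<And>x. c \<le> a x" "\<And>x. c \<le> b x"
  shows "c * (norm u)\<^sup>2 \<le> wform a b u u"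
proof -
  have le: "c * (l2 f)\<^sup>2 \<le> (LINT x|lebesgue. h x * f x * f x)"
    if f: "square_integrable f" and h: "continuous_on UNIV h" "\<And>x. \<bar>h x\<bar> \<le> A" "\<And>x. c \<le> h x" for f h
  proof -
    have "c * (l2 f)\<^sup>2 = (LINT x|lebesgue. c * (f x)\<^sup>2)" by (simp add: l2_power2)
    also have "\<dots> \<le> (LINT x|lebesgue. h x * f x * f x)"
    proof (rule integral_mono)
      show "c * (f x)\<^sup>2 \<le> h x * f x * f x" for x
        using h(3) by (simp add: power2_eq_square mult.assoc mult_right_mono)
      show "integrable lebesgue (\<lambda>x. h x * f x * f x)"
        by (rule square_integrable_mult[OF square_integrable_weight[OF h(1,2) f] f])
    qed (use f in \<open>simp add: square_integrable_def\<close>)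
    finally show ?thesis .
  qed
  show ?thesis
    using le[OF square_integrable_dv a assms(1), of u] le[OF square_integrable_ev b assms(2), of u]
    by (simp add: wform_def norm_h1_power2 distrib_left)
qed

end

text \<open>A change of base point becomes a change of weights, so two forms can be compared through
  the sup norm of the weight difference.\<close>

lemma wform_diff_weights:
  assumes "continuous_on UNIV a" "\<And>x. \<bar>a x\<bar> \<le> A" "continuous_on UNIV b" "\<And>x. \<bar>b x\<bar> \<le> A"
    and "continuous_on UNIV a'" "\<And>x. \<bar>a' x\<bar> \<le> A" "continuous_on UNIV b'" "\<And>x. \<bar>b' x\<bar> \<le> A"
  shows "wform (\<lambda>x. a x - a' x) (\<lambda>x. b x - b' x) u w = wform a b u w - wform a' b' u w"
proof -
  have i: "integrable lebesgue (\<lambda>x. h x * f x * g x)"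
    if "continuous_on UNIV h" "\<And>x. \<bar>h x\<bar> \<le> A" "square_integrable f" "square_integrable g" for h f g
    by (rule square_integrable_mult[OF square_integrable_weight[OF that(1-3)] that(4)])
  note j = i[OF assms(1,2) square_integrable_dv[of u] square_integrable_dv[of w]]
    i[OF assms(5,6) square_integrable_dv[of u] square_integrable_dv[of w]]
    i[OF assms(3,4) square_integrable_ev[of u] square_integrable_ev[of w]]
    i[OF assms(7,8) square_integrable_ev[of u] square_integrable_ev[of w]]
  show ?thesis using j by (simp add: wform_def left_diff_distrib)
qed

subsection \<open>Composition with scalar functions\<close>

definition phi :: "h1 \<Rightarrow> real \<Rightarrow> real" where "phi v x = 1 + ev v x"

text \<open>The embedding constant 2 and the radius 1/4 give a deviation of at most 1/2 from 1; this
  fixes the interval of all scalar estimates.\<close>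

lemma phi_mem: "norm v \<le> 1/4 \<Longrightarrow> phi v x \<in> {1/2..3/2}"
  using abs_ev_le[of v x] by (auto simp: phi_def)

lemma phi_pos: "norm v \<le> 1/4 \<Longrightarrow> phi v x > 0"
  using phi_mem[of v x] by auto

lemma continuous_phi: "continuous_on UNIV (phi v)"
  unfolding phi_def by (intro continuous_intros continuous_ev)

lemma abs_phi_diff_le: "\<bar>phi v x - phi w x\<bar> \<le> 2 * norm (v - w)"
  using abs_ev_le[of "v - w" x] by (simp add: phi_def ev_diff)

lemma primitive_phi: "primitive (phi v) (dv v)"
  using primitive_ev[of v] by (simp add: primitive_def phi_def)

lemma primitive_phi_compose:
  assumes v: "norm v \<le> 1/4" and F: "\<And>y. y > 0 \<Longrightarrow> (F has_real_derivative F' y) (at y)"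
    and F': "continuous_on {0<..} F'"
  shows "primitive (\<lambda>x. F (phi v x)) (\<lambda>x. F' (phi v x) * dv v x)"
  by (rule primitive_chain[OF primitive_phi])
    (use phi_pos[OF v] F in \<open>auto intro: continuous_on_subset[OF F']\<close>)

lemma continuous_phi_compose:
  assumes v: "norm v \<le> 1/4" and F: "continuous_on {0<..} F"
  shows "continuous_on UNIV (\<lambda>x. F (phi v x))"
  by (rule continuous_on_compose2[OF F continuous_phi]) (use phi_pos[OF v] in auto)

context
  fixes F F' C assumes tb: "taylor_bounded F F' C"
begin

lemma taylor_bounded_DERIV: "y > 0 \<Longrightarrow> (F has_real_derivative F' y) (at y)"
  and taylor_bounded_continuous: "continuous_on {0<..} F'"
  using tb by (auto simp: taylor_bounded_def)

lemma taylor_bounded_continuous0: "continuous_on {0<..} F"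
  using taylor_bounded_DERIV by (auto intro!: continuous_at_imp_continuous_on intro: DERIV_isCont)

lemma taylor_bounded_phi:
  assumes v: "norm v \<le> 1/4"
  shows "continuous_on UNIV (\<lambda>x. F (phi v x))" "\<bar>F (phi v x)\<bar> \<le> C"
    and "continuous_on UNIV (\<lambda>x. F' (phi v x))" "\<bar>F' (phi v x)\<bar> \<le> C"
  using continuous_phi_compose[OF v] taylor_bounded_continuous taylor_bounded_continuous0 phi_mem[OF v] tb
  by (auto simp: taylor_bounded_def)

lemma taylor_bounded_phi_diff:
  assumes v: "norm v \<le> 1/4" and w: "norm w \<le> 1/4"
  shows "\<bar>F (phi v x) - F (phi w x)\<bar> \<le> 2 * C * norm (v - w)"
    and "\<bar>F' (phi v x) - F' (phi w x)\<bar> \<le> 2 * C * norm (v - w)"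
proof -
  have C: "C \<ge> 0" using taylor_bounded_phi(2)[OF v, of 0] by linarith
  have "C * \<bar>phi v x - phi w x\<bar> \<le> C * (2 * norm (v - w))"
    by (intro mult_left_mono abs_phi_diff_le C)
  moreover have "\<bar>F (phi v x) - F (phi w x)\<bar> \<le> C * \<bar>phi v x - phi w x\<bar>"
    "\<bar>F' (phi v x) - F' (phi w x)\<bar> \<le> C * \<bar>phi v x - phi w x\<bar>"
    using tb phi_mem[OF v] phi_mem[OF w] by (auto simp: taylor_bounded_def)
  ultimately show "\<bar>F (phi v x) - F (phi w x)\<bar> \<le> 2 * C * norm (v - w)"
    "\<bar>F' (phi v x) - F' (phi w x)\<bar> \<le> 2 * C * norm (v - w)" by linarith+
qed

lemma primitive_taylor_bounded:
  "norm v \<le> 1/4 \<Longrightarrow> primitive (\<lambda>x. F (phi v x)) (\<lambda>x. F' (phi v x) * dv v x)"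
  by (rule primitive_phi_compose[OF _ taylor_bounded_DERIV taylor_bounded_continuous])

lemma square_integrable_deriv_phi:
  "norm v \<le> 1/4 \<Longrightarrow> square_integrable (\<lambda>x. F' (phi v x) * dv v x)"
  by (intro square_integrable_weight[OF taylor_bounded_phi(3,4)] square_integrable_dv)

text \<open>Vanishing at 1 gives |F(phi)| <= C |v|, from which the square integrability of the
  values comes.\<close>

lemma in_H1_phi_compose:
  assumes v: "norm v \<le> 1/4" and 0: "F 1 = 0"
  shows "in_H1 (\<lambda>x. F (phi v x))"
proof (rule in_H1_primitive[OF primitive_taylor_bounded[OF v] _ square_integrable_deriv_phi[OF v]])
  show "square_integrable (\<lambda>x. F (phi v x))"
  proof (rule square_integrable_dominated[OF square_integrable_ev[of v]])
    show "AE x in lebesgue. \<bar>F (phi v x)\<bar> \<le> C * \<bar>ev v x\<bar>"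
    proof (intro AE_I2)
      fix x
      have "\<bar>F (phi v x) - F 1\<bar> \<le> C * \<bar>phi v x - 1\<bar>"
        using tb phi_mem[OF v, of x] unfolding taylor_bounded_def by simp
      then show "\<bar>F (phi v x)\<bar> \<le> C * \<bar>ev v x\<bar>" by (simp add: 0 phi_def)
    qed
  qed (rule continuous_imp_measurable_lebesgue[OF taylor_bounded_phi(1)[OF v]])
qed

text \<open>One factor changes at a time: the weight in the sup norm, the derivative in L^2. The two
  pieces give C and 2C/4, rounded up to 2C.\<close>

lemma l2_deriv_phi_diff:
  assumes v: "norm v \<le> 1/4" and w: "norm w \<le> 1/4"
  shows "l2 (\<lambda>x. F' (phi v x) * dv v x - F' (phi w x) * dv w x) \<le> 2 * C * norm (v - w)"
proof -
  have C: "C \<ge> 0" using taylor_bounded_phi(2)[OF v, of 0] by linarith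
  let ?f = "\<lambda>x. F' (phi v x) * (dv v x - dv w x)" and ?g = "\<lambda>x. (F' (phi v x) - F' (phi w x)) * dv w x"
  note d = square_integrable_diff[OF square_integrable_dv[of v] square_integrable_dv[of w]]
  have c: "continuous_on UNIV (\<lambda>x. F' (phi v x) - F' (phi w x))"
    by (intro continuous_on_diff taylor_bounded_phi v w)
  have "l2 (\<lambda>x. F' (phi v x) * dv v x - F' (phi w x) * dv w x) = l2 (\<lambda>x. ?f x + ?g x)"
    by (simp add: algebra_simps)
  also have "\<dots> \<le> l2 ?f + l2 ?g"
    by (intro l2_add_le square_integrable_weight[OF taylor_bounded_phi(3,4)[OF v] d]
        square_integrable_weight[OF c taylor_bounded_phi_diff(2)[OF v w] square_integrable_dv])
  also have "l2 ?f \<le> C * norm (v - w)"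
    using l2_weight[OF taylor_bounded_phi(3,4)[OF v] d] mult_left_mono[OF l2_dv_diff[of v w] C] by linarith
  also have "l2 ?g \<le> 2 * C * norm (v - w) * l2 (dv w)"
    by (rule l2_weight[OF c taylor_bounded_phi_diff(2)[OF v w] square_integrable_dv])
  also have "\<dots> \<le> 2 * C * norm (v - w) * (1/4)"
    using l2_dv_le[of w] w C by (intro mult_left_mono) auto
  finally have "l2 (\<lambda>x. F' (phi v x) * dv v x - F' (phi w x) * dv w x) \<le> 3/2 * (C * norm (v - w))" by simp
  also have "\<dots> \<le> 2 * (C * norm (v - w))" using C by (intro mult_right_mono) auto
  finally show ?thesis by simp
qed

end

subsection \<open>The elliptic solution operator\<close>

lemma le_of_quadratic_le:
  fixes w c d :: real
  assumes "c * w\<^sup>2 \<le> d * w" "c > 0" "d \<ge> 0" "w \<ge> 0"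
  shows "w \<le> d / c"
proof (cases "w = 0")
  case False
  then have "c * w \<le> d" using assms by (simp add: power2_eq_square mult.assoc[symmetric])
  then show ?thesis using assms by (simp add: field_simps)
qed (use assms in simp)

text \<open>The lower bounds for the exponents n and m make the elliptic form coercive; those for
  -2m and -n-m make the energy dominate the squared norm. \<open>K\<close> is an antiderivative of g
  times the derivative of y powr n, so that g(phi) (phi^n)_z is the total derivative of
  K(phi).\<close>

locale magma =
  fixes n m \<alpha> C :: real and g G K :: "real \<Rightarrow> real"
  assumes pn: "taylor_bounded (\<lambda>y. y powr n) (\<lambda>y. n * y powr (n - 1)) C"
    and pm: "taylor_bounded (\<lambda>y. y powr m) (\<lambda>y. m * y powr (m - 1)) C"
    and pk: "taylor_bounded (\<lambda>y. 1/2 * y powr (-2*m)) (\<lambda>y. - m * y powr (-2*m - 1)) C"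
    and pg: "taylor_bounded g (\<lambda>y. y powr (-n-m)) C"
    and pG: "taylor_bounded G g C"
    and K: "\<And>y. y > 0 \<Longrightarrow> (K has_real_derivative g y * (n * y powr (n - 1))) (at y)"
    and g1: "g 1 = 0" and G1: "G 1 = 0"
    and \<alpha>: "\<alpha> > 0"
    and lower: "\<And>y. y \<in> {1/2..3/2} \<Longrightarrow> \<alpha> \<le> y powr n" "\<And>y. y \<in> {1/2..3/2} \<Longrightarrow> \<alpha> \<le> y powr m"
      "\<And>y. y \<in> {1/2..3/2} \<Longrightarrow> \<alpha> \<le> y powr (-2*m)" "\<And>y. y \<in> {1/2..3/2} \<Longrightarrow> \<alpha> \<le> y powr (-n-m)"
begin

lemma C_nonneg: "C \<ge> 0"
  using order_trans[OF abs_ge_zero taylor_bounded_phi(2)[OF pn, of 0 0]] by simp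

definition source :: "h1 \<Rightarrow> real \<Rightarrow> real" where
  "source v x = n * phi v x powr (n - 1) * dv v x"

definition form :: "h1 \<Rightarrow> h1 \<Rightarrow> h1 \<Rightarrow> real" where
  "form v = wform (\<lambda>x. phi v x powr n) (\<lambda>x. phi v x powr m)"

definition elliptic :: "h1 \<Rightarrow> h1 \<Rightarrow> bool" where
  "elliptic v u \<longleftrightarrow> (\<forall>w. form v u w = - (LINT x|lebesgue. source v x * ev w x))"

text \<open>Meaningful on the ball of radius 1/4, where existence and uniqueness hold;
  \<open>vfield\<close> inherits this restriction.\<close>

definition sol :: "h1 \<Rightarrow> h1" where
  "sol v = (SOME u. elliptic v u)"

lemma square_integrable_source: "norm v \<le> 1/4 \<Longrightarrow> square_integrable (source v)"
  unfolding source_def by (rule square_integrable_deriv_phi[OF pn])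

lemma l2_source: "norm v \<le> 1/4 \<Longrightarrow> l2 (source v) \<le> C * norm v"
  unfolding source_def
  using l2_weight[OF taylor_bounded_phi(3,4)[OF pn] square_integrable_dv, of v v] mult_left_mono[OF l2_dv_le[of v] C_nonneg]
  by fastforce

lemma form_coercive: "norm v \<le> 1/4 \<Longrightarrow> \<alpha> * (norm u)\<^sup>2 \<le> form v u u"
  unfolding form_def
  by (rule wform_coercive[OF taylor_bounded_phi(1,2)[OF pn] taylor_bounded_phi(1,2)[OF pm]])
    (use lower phi_mem in auto)

lemma bounded_linear_form:
  assumes "norm v \<le> 1/4"
  shows "bounded_linear (form v u)" "bounded_linear (\<lambda>u. form v u w)"
  unfolding form_def
  using bounded_linear_wform[OF taylor_bounded_phi(1,2)[OF pn assms] taylor_bounded_phi(1,2)[OF pm assms]]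
    bounded_linear_wform_left[OF taylor_bounded_phi(1,2)[OF pn assms] taylor_bounded_phi(1,2)[OF pm assms]] by auto

lemma elliptic_exists:
  assumes v: "norm v \<le> 1/4" shows "\<exists>u. elliptic v u"
  unfolding elliptic_def
proof (rule symmetric_lax_milgram[where c = \<alpha> and C = "2 * C"])
  show "\<bar>form v u w\<bar> \<le> 2 * C * norm u * norm w" for u w
    unfolding form_def
    by (rule abs_wform_le[OF taylor_bounded_phi(1,2)[OF pn v] taylor_bounded_phi(1,2)[OF pm v]])
  show "bounded_linear (\<lambda>w. - (LINT x|lebesgue. source v x * ev w x))"
    by (intro bounded_linear_minus bounded_linear_integral_ev square_integrable_source v)
  show "form v u w = form v w u" for u w unfolding form_def by (rule wform_commute)
qed (use \<alpha> form_coercive[OF v] linear_simps[OF bounded_linear_form(2)[OF v]] in auto)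

lemma elliptic_unique:
  assumes v: "norm v \<le> 1/4" and "elliptic v u" "elliptic v u'" shows "u = u'"
proof -
  have "form v (u - u') (u - u') = 0"
    using assms(2,3) linear_simps(2)[OF bounded_linear_form(2)[OF v], of u u'] by (simp add: elliptic_def)
  then have "\<alpha> * (norm (u - u'))\<^sup>2 \<le> 0" using form_coercive[OF v, of "u - u'"] by simp
  then show ?thesis using \<alpha> by (simp add: mult_le_0_iff)
qed

lemma elliptic_sol: "norm v \<le> 1/4 \<Longrightarrow> elliptic v (sol v)"
  unfolding sol_def by (rule someI_ex[OF elliptic_exists])

lemma form_sol: "norm v \<le> 1/4 \<Longrightarrow> form v (sol v) w = - (LINT x|lebesgue. source v x * ev w x)"
  using elliptic_sol by (simp add: elliptic_def)

lemma norm_sol_le: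
  assumes v: "norm v \<le> 1/4" shows "norm (sol v) \<le> C / \<alpha>"
proof -
  have "\<alpha> * (norm (sol v))\<^sup>2 \<le> \<bar>LINT x|lebesgue. source v x * ev (sol v) x\<bar>"
    using form_coercive[OF v, of "sol v"] by (simp add: form_sol[OF v])
  also have "\<dots> \<le> l2 (source v) * l2 (ev (sol v))"
    by (rule l2_Cauchy_Schwarz[OF square_integrable_source[OF v] square_integrable_ev])
  also have "\<dots> \<le> (C * norm v) * norm (sol v)"
    by (intro mult_mono l2_source[OF v] l2_ev_le) (auto simp: C_nonneg l2_nonneg)
  also have "\<dots> \<le> (C * 1) * norm (sol v)"
    using v C_nonneg by (intro mult_right_mono mult_left_mono) auto
  finally show ?thesis using le_of_quadratic_le[of \<alpha> "norm (sol v)" C] \<alpha> C_nonneg by simp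
qed

definition sol_lip :: real where "sol_lip = (2 * C + 4 * C * (C / \<alpha>)) / \<alpha>"

lemma sol_lip_nonneg: "sol_lip \<ge> 0"
  using C_nonneg \<alpha> by (simp add: sol_lip_def)

text \<open>Subtracting the two equations leaves, for the difference \<open>w\<close> of the
  solutions, the change \<open>I\<close> of the source and the change \<open>R\<close> of the form
  applied to the old solution \<open>sol v'\<close>. Testing with \<open>w\<close> itself,
  coercivity absorbs one factor \<open>norm w\<close>.\<close>

lemma sol_lipschitz:
  assumes v: "norm v \<le> 1/4" and v': "norm v' \<le> 1/4"
  shows "norm (sol v - sol v') \<le> sol_lip * norm (v - v')"
proof -
  define w where "w = sol v - sol v'"
  define d where "d = norm (v - v')"
  note n1 = taylor_bounded_phi(1,2)[OF pn v] and m1 = taylor_bounded_phi(1,2)[OF pm v]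
  note n2 = taylor_bounded_phi(1,2)[OF pn v'] and m2 = taylor_bounded_phi(1,2)[OF pm v']
  define R where "R = wform (\<lambda>x. phi v x powr n - phi v' x powr n) (\<lambda>x. phi v x powr m - phi v' x powr m) (sol v') w"
  define I where "I = (LINT x|lebesgue. (source v x - source v' x) * ev w x)"
  have "form v w w = form v (sol v) w - form v (sol v') w"
    unfolding w_def by (rule linear_simps(2)[OF bounded_linear_form(2)[OF v]])
  also have "form v (sol v') w = form v' (sol v') w + R"
    unfolding R_def form_def wform_diff_weights[OF n1 m1 n2 m2] by simp
  also have "form v (sol v) w - (form v' (sol v') w + R) = - I - R"
    using square_integrable_mult[OF square_integrable_source[OF v] square_integrable_ev[of w]]
      square_integrable_mult[OF square_integrable_source[OF v'] square_integrable_ev[of w]]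
    by (simp add: form_sol[OF v] form_sol[OF v'] I_def left_diff_distrib)
  finally have "\<alpha> * (norm w)\<^sup>2 \<le> \<bar>I\<bar> + \<bar>R\<bar>" using form_coercive[OF v, of w] by linarith
  moreover have "\<bar>I\<bar> \<le> (2 * C * d) * norm w"
  proof -
    have "\<bar>I\<bar> \<le> l2 (\<lambda>x. source v x - source v' x) * l2 (ev w)"
      unfolding I_def
      by (intro l2_Cauchy_Schwarz square_integrable_diff square_integrable_source v v' square_integrable_ev)
    also have "\<dots> \<le> (2 * C * d) * norm w"
      using l2_deriv_phi_diff[OF pn v v'] C_nonneg unfolding d_def source_def
      by (intro mult_mono l2_ev_le) (auto simp: l2_nonneg)
    finally show ?thesis .
  qed
  moreover have "\<bar>R\<bar> \<le> (4 * C * (C / \<alpha>) * d) * norm w"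
  proof -
    have "\<bar>R\<bar> \<le> 2 * (2 * C * d) * norm (sol v') * norm w"
      unfolding R_def d_def
      by (intro abs_wform_le continuous_on_diff n1(1) n2(1) m1(1) m2(1) taylor_bounded_phi_diff(1)[OF pn v v'] taylor_bounded_phi_diff(1)[OF pm v v'])
    also have "\<dots> \<le> 2 * (2 * C * d) * (C / \<alpha>) * norm w"
      using C_nonneg by (intro mult_right_mono mult_left_mono norm_sol_le v') (auto simp: d_def)
    finally show ?thesis by (simp add: mult_ac)
  qed
  ultimately have "\<alpha> * (norm w)\<^sup>2 \<le> ((2 * C + 4 * C * (C / \<alpha>)) * d) * norm w"
    by (simp add: distrib_right)
  from le_of_quadratic_le[OF this \<alpha>] have "norm w \<le> (2 * C + 4 * C * (C / \<alpha>)) * d / \<alpha>"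
    using C_nonneg \<alpha> by (simp add: d_def)
  then show ?thesis by (simp add: w_def d_def sol_lip_def)
qed

subsection \<open>The vector field\<close>

definition field_fun :: "h1 \<Rightarrow> real \<Rightarrow> real" where
  "field_fun v x = phi v x powr m * ev (sol v) x"

definition field_deriv :: "h1 \<Rightarrow> real \<Rightarrow> real" where
  "field_deriv v x = m * phi v x powr (m - 1) * dv v x * ev (sol v) x + phi v x powr m * dv (sol v) x"

definition vfield :: "h1 \<Rightarrow> h1" where "vfield v = abs_h1 (field_fun v)"

context
  fixes v :: h1 assumes v: "norm v \<le> 1/4"
begin

lemma primitive_field: "primitive (field_fun v) (field_deriv v)"
  using primitive_mult[OF primitive_taylor_bounded[OF pm v] primitive_ev[of "sol v"]]
  unfolding field_fun_def field_deriv_def by simp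

lemma abs_ev_sol_le: "\<bar>ev (sol v) x\<bar> \<le> 2 * (C / \<alpha>)"
  using abs_ev_le[of "sol v" x] norm_sol_le[OF v] by linarith

lemma square_integrable_field_deriv: "square_integrable (field_deriv v)"
proof -
  have "square_integrable (\<lambda>x. ev (sol v) x * (m * phi v x powr (m - 1) * dv v x) + phi v x powr m * dv (sol v) x)"
    by (intro square_integrable_add square_integrable_weight[OF continuous_ev abs_ev_sol_le]
        square_integrable_weight[OF taylor_bounded_phi(1,2)[OF pm v]] square_integrable_deriv_phi[OF pm v] square_integrable_dv)
  moreover have "field_deriv v = (\<lambda>x. ev (sol v) x * (m * phi v x powr (m - 1) * dv v x) + phi v x powr m * dv (sol v) x)"
    by (simp add: fun_eq_iff field_deriv_def)
  ultimately show ?thesis by simp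
qed

lemma in_H1_field: "in_H1 (field_fun v)"
proof (rule in_H1_primitive[OF primitive_field _ square_integrable_field_deriv])
  show "square_integrable (field_fun v)"
    unfolding field_fun_def by (intro square_integrable_weight[OF taylor_bounded_phi(1,2)[OF pm v]] square_integrable_ev)
qed

lemma ev_vfield: "ev (vfield v) = field_fun v"
  unfolding vfield_def by (rule ev_abs_h1[OF in_H1_field primitive_continuous[OF primitive_field]])

lemma dv_vfield: "AE x in lebesgue. dv (vfield v) x = field_deriv v x"
  unfolding vfield_def by (rule dv_abs_h1_AE[OF in_H1_field primitive_has_weak_deriv[OF primitive_field]])

end

text \<open>The two leading terms bound the change of the values of the field in L^2; the bracket
  collects the four pieces of the change of its derivative.\<close>

definition field_lip :: real where
  "field_lip = C * sol_lip + 2 * C * (C / \<alpha>) + (2 * (C / \<alpha>) * (2 * C) + 2 * sol_lip * C + C * sol_lip + 2 * C * (C / \<alpha>))"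

text \<open>Differences of products are telescoped so that in every piece one factor is bounded
  uniformly and the other lies in L^2. The uniform bound on the solution and on its change comes
  from the Sobolev embedding.\<close>

lemma vfield_lipschitz:
  assumes v: "norm v \<le> 1/4" and w: "norm w \<le> 1/4"
  shows "norm (vfield v - vfield w) \<le> field_lip * norm (v - w)"
proof -
  define d where "d = norm (v - w)"
  have d: "d \<ge> 0" by (simp add: d_def)
  define p where "p = sol v"
  define q where "q = sol w"
  have pq: "norm (p - q) \<le> sol_lip * d" unfolding p_def q_def d_def by (rule sol_lipschitz[OF v w])
  have q: "norm q \<le> C / \<alpha>" unfolding q_def by (rule norm_sol_le[OF w])
  note cv = taylor_bounded_phi[OF pm v] and cw = taylor_bounded_phi[OF pm w]
  have cd: "continuous_on UNIV (\<lambda>x. phi v x powr m - phi w x powr m)"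
    by (intro continuous_on_diff cv cw)
  note bd = taylor_bounded_phi_diff(1)[OF pm v w, folded d_def]
  note l2d = l2_deriv_phi_diff[OF pm v w, folded d_def]
  note sv = square_integrable_deriv_phi[OF pm v] and sw = square_integrable_deriv_phi[OF pm w]
  have ce: "continuous_on UNIV (\<lambda>x. ev p x - ev q x)" by (intro continuous_on_diff continuous_ev)
  have be: "\<bar>ev p x - ev q x\<bar> \<le> 2 * sol_lip * d" for x
    using abs_ev_le[of "p - q" x] pq by (simp add: ev_diff)
  note be' = abs_ev_sol_le[OF v, folded p_def]
  note se = square_integrable_diff[OF square_integrable_ev[of p] square_integrable_ev[of q]]
  note sd = square_integrable_diff[OF square_integrable_dv[of p] square_integrable_dv[of q]]
  have l2q: "l2 (ev q) \<le> C / \<alpha>" "l2 (dv q) \<le> C / \<alpha>"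
    using l2_ev_le[of q] l2_dv_le[of q] q by linarith+
  have l2e: "l2 (\<lambda>x. ev p x - ev q x) \<le> sol_lip * d" "l2 (\<lambda>x. dv p x - dv q x) \<le> sol_lip * d"
    using l2_ev_diff[of p q] l2_dv_diff[of p q] pq by linarith+
  have l2w: "l2 (\<lambda>x. m * phi w x powr (m - 1) * dv w x) \<le> C"
  proof -
    have "l2 (\<lambda>x. m * phi w x powr (m - 1) * dv w x) \<le> C * l2 (dv w)"
      by (rule l2_weight[OF cw(3,4) square_integrable_dv])
    also have "\<dots> \<le> C * 1" using l2_dv_le[of w] w C_nonneg by (intro mult_left_mono) auto
    finally show ?thesis by simp
  qed
  let ?a = "\<lambda>x. phi v x powr m * (ev p x - ev q x)"
  let ?b = "\<lambda>x. (phi v x powr m - phi w x powr m) * ev q x"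
  have "l2 (\<lambda>x. field_fun v x - field_fun w x) = l2 (\<lambda>x. ?a x + ?b x)"
    by (simp add: field_fun_def p_def q_def algebra_simps)
  also have "\<dots> \<le> l2 ?a + l2 ?b"
    by (intro l2_add_le square_integrable_weight[OF cv(1,2)] square_integrable_weight[OF cd bd] se square_integrable_ev)
  also have "\<dots> \<le> C * l2 (\<lambda>x. ev p x - ev q x) + 2 * C * d * l2 (ev q)"
    by (intro add_mono l2_weight[OF cv(1,2)] l2_weight[OF cd bd] se square_integrable_ev)
  also have "\<dots> \<le> C * (sol_lip * d) + 2 * C * d * (C / \<alpha>)"
    using C_nonneg d by (intro add_mono mult_left_mono l2e l2q) auto
  finally have 1: "l2 (\<lambda>x. field_fun v x - field_fun w x) \<le> (C * sol_lip + 2 * C * (C / \<alpha>)) * d"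
    by (simp add: algebra_simps)
  let ?c1 = "\<lambda>x. ev p x * (m * phi v x powr (m - 1) * dv v x - m * phi w x powr (m - 1) * dv w x)"
  let ?c2 = "\<lambda>x. (ev p x - ev q x) * (m * phi w x powr (m - 1) * dv w x)"
  let ?c3 = "\<lambda>x. phi v x powr m * (dv p x - dv q x)"
  let ?c4 = "\<lambda>x. (phi v x powr m - phi w x powr m) * dv q x"
  have s: "square_integrable ?c1" "square_integrable ?c2" "square_integrable ?c3" "square_integrable ?c4"
    by (intro square_integrable_weight[OF continuous_ev be'] square_integrable_diff sv sw,
        intro square_integrable_weight[OF ce be] sw,
        intro square_integrable_weight[OF cv(1,2)] sd,
        intro square_integrable_weight[OF cd bd] square_integrable_dv)
  have "l2 (\<lambda>x. field_deriv v x - field_deriv w x) = l2 (\<lambda>x. ?c1 x + (?c2 x + (?c3 x + ?c4 x)))"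
    by (simp add: field_deriv_def p_def q_def algebra_simps)
  also have "\<dots> \<le> l2 ?c1 + (l2 ?c2 + (l2 ?c3 + l2 ?c4))"
    by (intro order_trans[OF l2_add_le] add_left_mono square_integrable_add s order_refl)
  also have "l2 ?c1 \<le> 2 * (C / \<alpha>) * l2 (\<lambda>x. m * phi v x powr (m - 1) * dv v x - m * phi w x powr (m - 1) * dv w x)"
    by (intro l2_weight[OF continuous_ev be'] square_integrable_diff sv sw)
  also have "\<dots> \<le> 2 * (C / \<alpha>) * (2 * C * d)"
    using C_nonneg \<alpha> by (intro mult_left_mono l2d) auto
  also have "l2 ?c2 \<le> 2 * sol_lip * d * l2 (\<lambda>x. m * phi w x powr (m - 1) * dv w x)"
    by (intro l2_weight[OF ce be] sw)
  also have "\<dots> \<le> 2 * sol_lip * d * C"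
    using sol_lip_nonneg d by (intro mult_left_mono l2w) auto
  also have "l2 ?c3 \<le> C * l2 (\<lambda>x. dv p x - dv q x)"
    by (intro l2_weight[OF cv(1,2)] sd)
  also have "\<dots> \<le> C * (sol_lip * d)"
    using C_nonneg by (intro mult_left_mono l2e) auto
  also have "l2 ?c4 \<le> 2 * C * d * l2 (dv q)"
    by (intro l2_weight[OF cd bd] square_integrable_dv)
  also have "\<dots> \<le> 2 * C * d * (C / \<alpha>)"
    using C_nonneg d by (intro mult_left_mono l2q) auto
  finally have 2: "l2 (\<lambda>x. field_deriv v x - field_deriv w x)
      \<le> (2 * (C / \<alpha>) * (2 * C) + 2 * sol_lip * C + C * sol_lip + 2 * C * (C / \<alpha>)) * d"
    by (simp add: algebra_simps)
  have "vfield v - vfield w = abs_h1 (\<lambda>x. field_fun v x - field_fun w x)"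
    unfolding vfield_def by (rule abs_h1_diff[OF in_H1_field[OF v] in_H1_field[OF w]])
  moreover have "norm (abs_h1 (\<lambda>x. field_fun v x - field_fun w x))
      \<le> l2 (\<lambda>x. field_fun v x - field_fun w x) + l2 (\<lambda>x. field_deriv v x - field_deriv w x)"
  proof (rule norm_abs_h1_le)
    show "in_H1 (\<lambda>x. field_fun v x - field_fun w x)"
      using in_H1_add[OF in_H1_field[OF v] in_H1_cmult[OF in_H1_field[OF w], of "-1"]] by simp
    show "has_weak_deriv (\<lambda>x. field_fun v x - field_fun w x) (\<lambda>x. field_deriv v x - field_deriv w x)"
      using has_weak_deriv_add[OF primitive_has_weak_deriv[OF primitive_field[OF v]]
          has_weak_deriv_cmult[OF primitive_has_weak_deriv[OF primitive_field[OF w]], of "-1"]] by simp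
    show "square_integrable (\<lambda>x. field_deriv v x - field_deriv w x)"
      by (intro square_integrable_diff square_integrable_field_deriv v w)
  qed
  ultimately show ?thesis using 1 2 by (simp add: field_lip_def d_def distrib_right)
qed

lemma field_lip_nonneg: "field_lip \<ge> 0"
  using C_nonneg \<alpha> sol_lip_nonneg by (simp add: field_lip_def)

end

lemma norm_power2_eq_integral:
  "c * (norm w)\<^sup>2 = (LINT x|lebesgue. c * (ev w x)\<^sup>2 + c * (dv w x)\<^sup>2)"
  "integrable lebesgue (\<lambda>x. c * (ev w x)\<^sup>2 + d * (dv w x)\<^sup>2)" for w :: h1
  using square_integrable_ev[of w] square_integrable_dv[of w]
  by (simp_all add: norm_h1_power2 l2_power2 square_integrable_def distrib_left)

context magma
begin

subsection \<open>The conserved energy\<close>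

definition kin :: "h1 \<Rightarrow> real \<Rightarrow> real" where "kin v x = 1/2 * phi v x powr (-2*m)"

definition kin' :: "h1 \<Rightarrow> real \<Rightarrow> real" where "kin' v x = - m * phi v x powr (-2*m - 1)"

definition energy :: "h1 \<Rightarrow> real" where
  "energy v = (LINT x|lebesgue. G (phi v x) + kin v x * (dv v x)\<^sup>2)"

text \<open>The differential of \<open>energy\<close> at \<open>v\<close> in direction
  \<open>w\<close>, kept as three integrals because the middle one pairs with \<open>w\<close>
  through the sup norm and the outer ones through L^2.\<close>

definition energy_deriv :: "h1 \<Rightarrow> h1 \<Rightarrow> real" where
  "energy_deriv v w = (LINT x|lebesgue. g (phi v x) * ev w x)
     + (LINT x|lebesgue. (kin' v x * (dv v x)\<^sup>2) * ev w x) + (LINT x|lebesgue. (2 * kin v x * dv v x) * dv w x)"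

text \<open>After subtracting the parabola, value and slope vanish at 1 and the second derivative is
  nonnegative. Two mean value steps suffice because \<open>z\<close> lies between 1 and
  \<open>y\<close>, so that \<open>z - 1\<close> and \<open>y - 1\<close> have compatible
  signs.\<close>

lemma potential_lower:
  assumes y: "y \<in> {1/2..3/2}" shows "\<alpha> / 2 * (y - 1)\<^sup>2 \<le> G y"
proof -
  define q where "q y = G y - \<alpha> / 2 * (y - 1)\<^sup>2" for y
  define q' where "q' y = g y - \<alpha> * (y - 1)" for y
  have q: "(q has_real_derivative q' y) (at y)" if "y > 0" for y
    unfolding q_def q'_def
    by (rule DERIV_cong[OF DERIV_diff[OF taylor_bounded_DERIV[OF pG that]]])
      (auto intro!: derivative_eq_intros)
  have q': "(q' has_real_derivative y powr (-n-m) - \<alpha>) (at y)" if "y > 0" for y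
    unfolding q'_def
    by (rule DERIV_cong[OF DERIV_diff[OF taylor_bounded_DERIV[OF pg that]]])
      (auto intro!: derivative_eq_intros)
  obtain z where z: "min 1 y \<le> z" "z \<le> max 1 y" "q y - q 1 = q' z * (y - 1)"
    using mean_value_pos[of q q' 1 y] q y by auto
  then have zI: "z \<in> {1/2..3/2}" using y by (auto simp: min_def max_def split: if_splits)
  obtain s where s: "min 1 z \<le> s" "s \<le> max 1 z" "q' z - q' 1 = (s powr (-n-m) - \<alpha>) * (z - 1)"
    using mean_value_pos[of q' "\<lambda>y. y powr (-n-m) - \<alpha>" 1 z] q' zI by auto
  then have "s \<in> {1/2..3/2}" using zI by (auto simp: min_def max_def split: if_splits)
  then have "s powr (-n-m) - \<alpha> \<ge> 0" using lower(4) by simp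
  moreover have "(z - 1) * (y - 1) \<ge> 0"
    using z(1,2) by (auto simp: min_def max_def split: if_splits intro: mult_nonneg_nonneg mult_nonpos_nonpos)
  moreover have "q y = (s powr (-n-m) - \<alpha>) * ((z - 1) * (y - 1))"
    using z(3) s(3) g1 G1 by (simp add: q_def q'_def)
  ultimately have "q y \<ge> 0" by simp
  then show ?thesis by (simp add: q_def)
qed

lemma potential_upper:
  assumes y: "y \<in> {1/2..3/2}" shows "\<bar>G y\<bar> \<le> C * (y - 1)\<^sup>2"
proof -
  have "\<bar>G y - G 1 - g 1 * (y - 1)\<bar> \<le> C * (y - 1)\<^sup>2"
    using pG y unfolding taylor_bounded_def by simp
  then show ?thesis by (simp add: g1 G1)
qed

context
  fixes v :: h1 assumes v: "norm v \<le> 1/4"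
begin

lemma continuous_kin: "continuous_on UNIV (kin v)" and kin_le: "\<bar>kin v x\<bar> \<le> C"
  and continuous_kin': "continuous_on UNIV (kin' v)" and kin'_le: "\<bar>kin' v x\<bar> \<le> C"
  using taylor_bounded_phi[OF pk v] unfolding kin_def kin'_def by auto

lemma integrable_bounded_dv_power2:
  assumes h: "continuous_on UNIV h" "\<And>x. \<bar>h x\<bar> \<le> A"
  shows "integrable lebesgue (\<lambda>x. h x * (dv v x)\<^sup>2)"
  using square_integrable_mult[OF square_integrable_weight[OF h square_integrable_dv[of v]] square_integrable_dv[of v]]
  by (simp add: power2_eq_square mult.assoc)

lemma integrable_potential: "integrable lebesgue (\<lambda>x. G (phi v x))"
proof (rule Bochner_Integration.integrable_bound[where f = "\<lambda>x. C * (ev v x)\<^sup>2"])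
  show "AE x in lebesgue. norm (G (phi v x)) \<le> norm (C * (ev v x)\<^sup>2)"
    using potential_upper[OF phi_mem[OF v]] C_nonneg by (intro AE_I2) (simp add: phi_def abs_mult)
  show "(\<lambda>x. G (phi v x)) \<in> borel_measurable lebesgue"
    by (intro continuous_imp_measurable_lebesgue taylor_bounded_phi(1)[OF pG v])
qed (use square_integrable_ev[of v] in \<open>simp add: square_integrable_def\<close>)

lemma integrable_energy: "integrable lebesgue (\<lambda>x. G (phi v x) + kin v x * (dv v x)\<^sup>2)"
  by (intro Bochner_Integration.integrable_add integrable_potential
      integrable_bounded_dv_power2[OF continuous_kin kin_le])

lemma energy_lower: "\<alpha> / 2 * (norm v)\<^sup>2 \<le> energy v"
  unfolding energy_def norm_power2_eq_integral(1)
proof (rule integral_mono[OF norm_power2_eq_integral(2) integrable_energy])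
  fix x
  have "\<alpha> / 2 * (ev v x)\<^sup>2 \<le> G (phi v x)" using potential_lower[OF phi_mem[OF v], of x] by (simp add: phi_def)
  moreover have "\<alpha> / 2 * (dv v x)\<^sup>2 \<le> kin v x * (dv v x)\<^sup>2"
    using lower(3)[OF phi_mem[OF v], of x] by (intro mult_right_mono) (auto simp: kin_def)
  ultimately show "\<alpha> / 2 * (ev v x)\<^sup>2 + \<alpha> / 2 * (dv v x)\<^sup>2 \<le> G (phi v x) + kin v x * (dv v x)\<^sup>2" by linarith
qed

lemma energy_upper: "energy v \<le> C * (norm v)\<^sup>2"
  unfolding energy_def norm_power2_eq_integral(1)
proof (rule integral_mono[OF integrable_energy norm_power2_eq_integral(2)])
  fix x
  have "G (phi v x) \<le> C * (ev v x)\<^sup>2" using potential_upper[OF phi_mem[OF v], of x] by (simp add: phi_def)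
  moreover have "kin v x * (dv v x)\<^sup>2 \<le> C * (dv v x)\<^sup>2"
    using kin_le[of x] by (intro mult_right_mono) auto
  ultimately show "G (phi v x) + kin v x * (dv v x)\<^sup>2 \<le> C * (ev v x)\<^sup>2 + C * (dv v x)\<^sup>2" by linarith
qed

lemma square_integrable_g: "square_integrable (\<lambda>x. g (phi v x))"
  by (rule in_H1_square_integrable[OF in_H1_phi_compose[OF pg v g1]])

lemma square_integrable_kin_dv: "square_integrable (\<lambda>x. 2 * kin v x * dv v x)"
  using square_integrable_cmult[OF square_integrable_weight[OF continuous_kin kin_le square_integrable_dv], of 2]
  by (simp add: mult.assoc)

lemma bounded_linear_energy_deriv: "bounded_linear (energy_deriv v)"
  unfolding energy_deriv_def
  by (intro bounded_linear_add bounded_linear_integral_ev bounded_linear_integral_dv bounded_linear_integral_ev_L1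
      square_integrable_g square_integrable_kin_dv integrable_bounded_dv_power2[OF continuous_kin' kin'_le])

text \<open>The choice \<open>g' = \<phi> powr (- n - m)\<close> makes \<open>g(\<phi>)\<close> a test function for which the elliptic
  equation reproduces the derivative of the energy along the flow, up to the integral of the
  total derivative \<open>(K(\<phi>))\<^sub>z\<close>.\<close>

lemma energy_deriv_vfield: "energy_deriv v (vfield v) = 0"
proof -
  define u where "u = sol v"
  have H: "in_H1 (\<lambda>x. g (phi v x))" by (rule in_H1_phi_compose[OF pg v g1])
  define \<gamma> where "\<gamma> = abs_h1 (\<lambda>x. g (phi v x))"
  have e\<gamma>: "ev \<gamma> = (\<lambda>x. g (phi v x))"
    unfolding \<gamma>_def by (rule ev_abs_h1[OF H taylor_bounded_phi(1)[OF pg v]])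
  have d\<gamma>: "AE x in lebesgue. dv \<gamma> x = phi v x powr (-n-m) * dv v x"
    unfolding \<gamma>_def by (rule dv_abs_h1_AE[OF H primitive_has_weak_deriv[OF primitive_taylor_bounded[OF pg v]]])
  have "(LINT x|lebesgue. g (phi v x) * (n * phi v x powr (n - 1)) * dv v x) = 0"
  proof (rule integral_derivative_eq_0)
    have "continuous_on {0<..} (\<lambda>y. g y * (n * y powr (n - 1)))"
      by (intro continuous_on_mult taylor_bounded_continuous0[OF pg] taylor_bounded_continuous[OF pn])
    from primitive_phi_compose[OF v K this]
    show "primitive (\<lambda>x. K (phi v x)) (\<lambda>x. g (phi v x) * (n * phi v x powr (n - 1)) * dv v x)" by simp
    show "integrable lebesgue (\<lambda>x. g (phi v x) * (n * phi v x powr (n - 1)) * dv v x)"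
      using square_integrable_mult[OF square_integrable_g square_integrable_source[OF v]]
      by (simp add: source_def mult.assoc)
    have "isCont K 1" using K[of 1] DERIV_isCont by auto
    have "(\<lambda>k. K (phi v (s k))) \<longlonglongrightarrow> K 1" if "(\<lambda>k. ev v (s k)) \<longlonglongrightarrow> 0" for s :: "nat \<Rightarrow> real"
    proof (rule isCont_tendsto_compose[OF \<open>isCont K 1\<close>])
      show "(\<lambda>k. phi v (s k)) \<longlonglongrightarrow> 1" using tendsto_add[OF tendsto_const that, of 1] by (simp add: phi_def)
    qed
    then show "(\<lambda>k. K (phi v (real k))) \<longlonglongrightarrow> K 1" "(\<lambda>k. K (phi v (- real k))) \<longlonglongrightarrow> K 1"
      using ev_tendsto_0_at_infinity by auto
  qed
  then have "form v u \<gamma> = 0"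
    unfolding u_def form_sol[OF v] e\<gamma> by (simp add: source_def mult_ac)
  moreover have "form v u \<gamma> = energy_deriv v (vfield v)"
  proof -
    note i1 = square_integrable_mult[OF square_integrable_weight[OF taylor_bounded_phi(1,2)[OF pn v] square_integrable_dv[of u]] square_integrable_dv[of \<gamma>]]
    note i2 = square_integrable_mult[OF square_integrable_weight[OF taylor_bounded_phi(1,2)[OF pm v] square_integrable_ev[of u]] square_integrable_ev[of \<gamma>]]
    note j1 = square_integrable_mult[OF square_integrable_g square_integrable_ev[of "vfield v"]]
    note j3 = square_integrable_mult[OF square_integrable_kin_dv square_integrable_dv[of "vfield v"]]
    have ck: "continuous_on UNIV (\<lambda>x. ev (vfield v) x * kin' v x)"
      by (intro continuous_on_mult continuous_ev continuous_kin')
    have "\<bar>ev (vfield v) x * kin' v x\<bar> \<le> (2 * norm (vfield v)) * C" for x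
      unfolding abs_mult using abs_ev_le kin'_le by (intro mult_mono) auto
    from integrable_bounded_dv_power2[OF ck this]
    have j2: "integrable lebesgue (\<lambda>x. (kin' v x * (dv v x)\<^sup>2) * ev (vfield v) x)"
      by (simp add: mult_ac)
    have "form v u \<gamma> = (LINT x|lebesgue. phi v x powr n * dv u x * dv \<gamma> x + phi v x powr m * ev u x * ev \<gamma> x)"
      using i1 i2 by (simp add: form_def wform_def)
    also have "\<dots> = (LINT x|lebesgue. g (phi v x) * ev (vfield v) x + (kin' v x * (dv v x)\<^sup>2) * ev (vfield v) x
        + (2 * kin v x * dv v x) * dv (vfield v) x)"
    proof (rule integral_cong_AE)
      show "AE x in lebesgue. phi v x powr n * dv u x * dv \<gamma> x + phi v x powr m * ev u x * ev \<gamma> x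
        = g (phi v x) * ev (vfield v) x + (kin' v x * (dv v x)\<^sup>2) * ev (vfield v) x + (2 * kin v x * dv v x) * dv (vfield v) x"
        using d\<gamma> dv_vfield[OF v]
      proof eventually_elim
        case (elim x)
        define y where "y = phi v x"
        have y: "y > 0" using phi_pos[OF v] by (simp add: y_def)
        \<comment> \<open>By these identities the two terms in u phi_z^2 carry the same power of phi
          with coefficients -m and m and cancel, while the surviving power phi^(-m) is that of phi^n
          times g'(phi).\<close>
        have p1: "y powr n * y powr (-n-m) = y powr (-m)" by (simp add: powr_add[symmetric])
        have p2: "y powr (-2*m) * y powr m = y powr (-m)" by (simp add: powr_add[symmetric])
        have p3: "y powr (-2*m - 1) * y powr m = y powr (-m - 1)" by (simp add: powr_add[symmetric])
        have p4: "y powr (-2*m) * y powr (m - 1) = y powr (-m - 1)" by (simp add: powr_add[symmetric])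
        have "g y * (y powr m * ev u x) + (- m * y powr (-2*m - 1) * (dv v x)\<^sup>2) * (y powr m * ev u x)
            + (y powr (-2*m) * dv v x) * (m * y powr (m - 1) * dv v x * ev u x + y powr m * dv u x)
          = g y * (y powr m * ev u x) - m * (dv v x)\<^sup>2 * ev u x * (y powr (-2*m - 1) * y powr m)
            + m * (dv v x)\<^sup>2 * ev u x * (y powr (-2*m) * y powr (m - 1)) + dv v x * dv u x * (y powr (-2*m) * y powr m)"
          by (simp add: power2_eq_square algebra_simps)
        also have "\<dots> = g y * (y powr m * ev u x) + dv v x * dv u x * (y powr n * y powr (-n-m))"
          unfolding p1 p2 p3 p4 by simp
        finally show ?case
          unfolding elim e\<gamma> ev_vfield[OF v] field_fun_def field_deriv_def kin_def kin'_def u_def[symmetric] y_def[symmetric]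
          by (simp add: mult_ac)
      qed
    qed (use i1 i2 j1 j2 j3 in \<open>auto intro!: borel_measurable_integrable\<close>)
    also have "\<dots> = energy_deriv v (vfield v)"
      using j1 j2 j3 by (simp add: energy_deriv_def)
    finally show ?thesis .
  qed
  ultimately show ?thesis by simp
qed

end

text \<open>Expanded pointwise, every remainder term is at least quadratic in the increment and
  contains at most two derivative factors once the products are split; anything beyond that is a
  power of the uniformly small increment of the values.\<close>

lemma energy_taylor:
  assumes a: "norm a \<le> 1/4" and b: "norm b \<le> 1/4"
  shows "\<bar>energy b - energy a - energy_deriv a (b - a)\<bar> \<le> 4 * C * (norm (b - a))\<^sup>2"
proof -
  define w where "w = b - a"
  define W where "W = 2 * norm w"
  have W: "\<bar>ev w x\<bar> \<le> W" for x unfolding W_def by (rule abs_ev_le)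
  note ia = integrable_energy[OF a] and ib = integrable_energy[OF b]
  note j1 = square_integrable_mult[OF square_integrable_g[OF a] square_integrable_ev[of w]]
  note j3 = square_integrable_mult[OF square_integrable_kin_dv[OF a] square_integrable_dv[of w]]
  have ck: "continuous_on UNIV (\<lambda>x. ev w x * kin' a x)"
    by (intro continuous_on_mult continuous_ev continuous_kin' a)
  have "\<bar>ev w x * kin' a x\<bar> \<le> W * C" for x
    unfolding abs_mult using W kin'_le[OF a] order_trans[OF abs_ge_zero W] by (intro mult_mono) auto
  from integrable_bounded_dv_power2[OF a ck this]
  have j2: "integrable lebesgue (\<lambda>x. (kin' a x * (dv a x)\<^sup>2) * ev w x)"
    by (simp add: mult_ac)
  let ?R = "\<lambda>x. (G (phi b x) + kin b x * (dv b x)\<^sup>2) - (G (phi a x) + kin a x * (dv a x)\<^sup>2)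
     - (g (phi a x) * ev w x + (kin' a x * (dv a x)\<^sup>2) * ev w x + (2 * kin a x * dv a x) * dv w x)"
  have iR: "integrable lebesgue ?R"
    by (intro Bochner_Integration.integrable_add Bochner_Integration.integrable_diff ia ib j1 j2 j3)
  have eq: "energy b - energy a - energy_deriv a w = (LINT x|lebesgue. ?R x)"
    using ia ib j1 j2 j3 by (simp add: energy_def energy_deriv_def)
  let ?S = "\<lambda>x. (C * (ev w x)\<^sup>2 + 2 * C * (dv w x)\<^sup>2) + 2 * C * W\<^sup>2 * (dv a x)\<^sup>2"
  have iS: "integrable lebesgue ?S"
    by (intro Bochner_Integration.integrable_add norm_power2_eq_integral(2) integrable_mult_right)
      (use square_integrable_dv[of a] in \<open>simp add: square_integrable_def\<close>)
  have "\<bar>energy b - energy a - energy_deriv a w\<bar> \<le> (LINT x|lebesgue. \<bar>?R x\<bar>)"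
    unfolding eq by (rule integral_abs_bound)
  also have "\<dots> \<le> (LINT x|lebesgue. ?S x)"
  proof (rule integral_mono_AE)
    show "AE x in lebesgue. \<bar>?R x\<bar> \<le> ?S x"
      using dv_diff[of b a]
    proof eventually_elim
      case (elim x)
      define p q r where "p = ev w x" and "q = dv a x" and "r = dv w x"
      have db: "dv b x = q + r" using elim by (simp add: q_def r_def w_def)
      have pb: "phi b x - phi a x = p" by (simp add: phi_def p_def w_def ev_diff)
      have m: "phi a x \<in> {1/2..3/2}" "phi b x \<in> {1/2..3/2}" using phi_mem a b by auto
      have t1: "\<bar>G (phi b x) - G (phi a x) - g (phi a x) * p\<bar> \<le> C * p\<^sup>2"
        using pG m unfolding taylor_bounded_def pb[symmetric] by blast
      have t2: "\<bar>kin b x - kin a x - kin' a x * p\<bar> \<le> C * p\<^sup>2"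
        using pk m unfolding taylor_bounded_def pb[symmetric] kin_def kin'_def by blast
      have t3: "\<bar>kin b x - kin a x\<bar> \<le> C * \<bar>p\<bar>"
        using pk m unfolding taylor_bounded_def pb[symmetric] kin_def kin'_def by blast
      have t4: "\<bar>kin b x\<bar> \<le> C" by (rule kin_le[OF b])
      have "?R x = (G (phi b x) - G (phi a x) - g (phi a x) * p)
         + (kin b x - kin a x - kin' a x * p) * q\<^sup>2 + (kin b x - kin a x) * (2 * q * r) + kin b x * r\<^sup>2"
        unfolding db p_def[symmetric] q_def[symmetric] r_def[symmetric] by (simp add: power2_sum algebra_simps)
      also have "\<bar>\<dots>\<bar> \<le> \<bar>G (phi b x) - G (phi a x) - g (phi a x) * p\<bar>
         + \<bar>kin b x - kin a x - kin' a x * p\<bar> * q\<^sup>2 + \<bar>kin b x - kin a x\<bar> * (2 * \<bar>q * r\<bar>) + \<bar>kin b x\<bar> * r\<^sup>2"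
        by (intro order_trans[OF abs_triangle_ineq] add_mono) (auto simp: abs_mult)
      also have "\<dots> \<le> C * p\<^sup>2 + C * p\<^sup>2 * q\<^sup>2 + C * \<bar>p\<bar> * (2 * \<bar>q * r\<bar>) + C * r\<^sup>2"
        by (intro add_mono mult_right_mono t1 t2 t3 t4) auto
      \<comment> \<open>\<open>q\<close> and \<open>r\<close> are only square integrable. Splitting
        the product of \<open>p * q\<close> and \<open>r\<close> leaves squares of each, and the
        remaining factor p^2 can be replaced by its uniform bound W^2.\<close>
      also have "C * \<bar>p\<bar> * (2 * \<bar>q * r\<bar>) \<le> C * (p\<^sup>2 * q\<^sup>2 + r\<^sup>2)"
      proof -
        have "0 \<le> (\<bar>p\<bar> * \<bar>q\<bar> - \<bar>r\<bar>)\<^sup>2" by simp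
        then have "\<bar>p\<bar> * (2 * \<bar>q * r\<bar>) \<le> p\<^sup>2 * q\<^sup>2 + r\<^sup>2"
          by (simp add: power2_diff power_mult_distrib abs_mult mult_ac)
        then show ?thesis using C_nonneg by (simp add: mult.assoc mult_left_mono)
      qed
      also have "C * p\<^sup>2 + C * p\<^sup>2 * q\<^sup>2 + C * (p\<^sup>2 * q\<^sup>2 + r\<^sup>2) + C * r\<^sup>2
          = C * p\<^sup>2 + 2 * C * r\<^sup>2 + 2 * C * p\<^sup>2 * q\<^sup>2" by (simp add: algebra_simps)
      also have "2 * C * p\<^sup>2 * q\<^sup>2 \<le> 2 * C * W\<^sup>2 * q\<^sup>2"
      proof -
        have "\<bar>p\<bar>\<^sup>2 \<le> W\<^sup>2" using W[of x] by (intro power_mono) (auto simp: p_def)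
        then show ?thesis using C_nonneg by (intro mult_right_mono mult_left_mono) auto
      qed
      finally show ?case by (simp add: p_def q_def r_def)
    qed
  qed (use iR iS in auto)
  also have "\<dots> = C * (l2 (ev w))\<^sup>2 + 2 * C * (l2 (dv w))\<^sup>2 + 2 * C * W\<^sup>2 * (l2 (dv a))\<^sup>2"
    using square_integrable_ev[of w] square_integrable_dv[of w] square_integrable_dv[of a]
    by (simp add: l2_power2 square_integrable_def)
  also have "\<dots> \<le> 2 * C * (norm w)\<^sup>2 + 2 * C * W\<^sup>2 * (1/4)\<^sup>2"
  proof (rule add_mono)
    show "C * (l2 (ev w))\<^sup>2 + 2 * C * (l2 (dv w))\<^sup>2 \<le> 2 * C * (norm w)\<^sup>2"
      using C_nonneg by (simp add: norm_h1_power2 distrib_left)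
    have "(l2 (dv a))\<^sup>2 \<le> (1/4)\<^sup>2"
      using l2_dv_le[of a] a by (intro power_mono) (auto simp: l2_nonneg)
    then show "2 * C * W\<^sup>2 * (l2 (dv a))\<^sup>2 \<le> 2 * C * W\<^sup>2 * (1/4)\<^sup>2"
      using C_nonneg by (intro mult_left_mono) auto
  qed
  \<comment> \<open>With \<open>W = 2 * norm w\<close> the second summand is C/2 times the squared
    norm, so 5C/2 would do.\<close>
  also have "\<dots> \<le> 4 * C * (norm w)\<^sup>2"
    using C_nonneg by (simp add: W_def power_mult_distrib power_divide field_simps)
  finally show ?thesis by (simp add: w_def)
qed

text \<open>Differentiability is taken within the closed ball, since the bootstrap admits curves
  that touch its boundary.\<close>

lemma energy_has_derivative:
  assumes a: "norm a \<le> 1/4"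
  shows "(energy has_derivative energy_deriv a) (at a within cball 0 (1/4))"
proof (rule has_derivativeI_sandwich[of 1 _ _ _ _ "\<lambda>b. 4 * C * norm (b - a)"])
  show "bounded_linear (energy_deriv a)" by (rule bounded_linear_energy_deriv[OF a])
  show "norm (energy b - energy a - energy_deriv a (b - a)) / norm (b - a) \<le> 4 * C * norm (b - a)"
    if "b \<in> cball 0 (1/4)" "b \<noteq> a" for b
    using energy_taylor[OF a, of b] that by (simp add: field_simps power2_eq_square)
  have "((\<lambda>b. 4 * C * norm (b - a)) \<longlongrightarrow> 4 * C * norm (a - a)) (at a within cball 0 (1/4))"
    by (intro tendsto_intros)
  then show "((\<lambda>b. 4 * C * norm (b - a)) \<longlongrightarrow> 0) (at a within cball 0 (1/4))" by simp
qed simp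

text \<open>The differential equation is assumed only before \<open>T\<close>, as it comes from an
  integral equation valid up to \<open>T\<close>; continuity carries the identity to the
  endpoint.\<close>

lemma energy_conserved:
  assumes T: "0 \<le> T" and small: "\<And>t. 0 \<le> t \<Longrightarrow> t \<le> T \<Longrightarrow> norm (V t) \<le> 1/4"
    and c: "continuous_on {0..T} V"
    and V: "\<And>t. 0 \<le> t \<Longrightarrow> t < T \<Longrightarrow> (V has_vector_derivative vfield (V t)) (at t within {0..})"
  shows "energy (V T) = energy (V 0)"
proof (cases "T = 0")
  case False
  with T have T': "0 < T" by simp
  have sub: "V ` {0..T} \<subseteq> cball 0 (1/4)" using small by auto
  note E = has_derivative_subset[OF energy_has_derivative sub]
  have "(energy \<circ> V) T = (energy \<circ> V) 0"
  proof (rule DERIV_isconst_end[OF T'])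
    have Ec: "continuous_on (cball 0 (1/4)) energy"
      unfolding continuous_on_eq_continuous_within
      using energy_has_derivative has_derivative_continuous by (metis dist_0_norm mem_cball)
    show "continuous_on {0..T} (energy \<circ> V)"
      by (rule continuous_on_compose[OF c continuous_on_subset[OF Ec sub]])
    fix t assume t: "0 < t" "t < T"
    have "(V has_vector_derivative vfield (V t)) (at t within {0..T})"
      by (rule has_vector_derivative_within_subset[OF V]) (use t in auto)
    from vector_derivative_diff_chain_within[OF this E]
    have "((energy \<circ> V) has_vector_derivative energy_deriv (V t) (vfield (V t))) (at t within {0..T})"
      using small t by auto
    then show "((energy \<circ> V) has_real_derivative 0) (at t)"
      using energy_deriv_vfield[OF small, of t] t
      by (simp add: has_real_derivative_iff_has_vector_derivative at_within_Icc_at)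
  qed
  then show ?thesis by simp
qed simp

end

subsection \<open>Existence and uniqueness of the flow\<close>

lemma abs_h1_phi: "abs_h1 (\<lambda>z. phi v z - 1) = v"
  by (simp add: phi_def abs_h1_ev)

lemma phi_abs_h1:
  assumes "continuous_on UNIV f" "in_H1 (\<lambda>z. f z - 1)"
  shows "phi (abs_h1 (\<lambda>z. f z - 1)) = f"
  using ev_abs_h1[OF assms(2)] assms(1) by (simp add: phi_def fun_eq_iff continuous_on_diff)

context magma
begin

text \<open>This passes from functions to classes. The chosen weak derivative of phi^n agrees with
  \<open>source v\<close> almost everywhere by the chain rule, and testing with functions or with
  classes is the same because every class has a representative.\<close>

lemma elliptic_weak_solution_phi:
  assumes v: "norm v \<le> 1/4"
  shows "elliptic_weak_solution n m (phi v) u \<longleftrightarrow> in_H1 u \<and> elliptic v (abs_h1 u)"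
proof (cases "in_H1 u")
  case u: True
  note n = taylor_bounded_phi(1,2)[OF pn v] and m = taylor_bounded_phi(1,2)[OF pm v]
  note d = dv_abs_h1_AE[OF _ in_H1_has_weak_deriv] and e = ev_abs_h1_AE
  note s = weak_deriv_square_integrable in_H1_square_integrable
  have p: "primitive (\<lambda>x. phi v x powr n) (source v)"
    unfolding source_def by (rule primitive_taylor_bounded[OF pn v])
  have src: "AE x in lebesgue. weak_deriv (\<lambda>x. phi v x powr n) x = source v x"
    by (rule weak_deriv_AE_eq[OF primitive_has_weak_deriv[OF p]])
  have "locally_integrable (weak_deriv (\<lambda>x. phi v x powr n))"
    using weak_deriv_has_weak_deriv[OF primitive_has_weak_deriv[OF p]] by (simp add: has_weak_deriv_def)
  from locally_integrable_measurable[OF this] src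
  have ss: "square_integrable (weak_deriv (\<lambda>x. phi v x powr n))"
    by (intro square_integrable_cong_AE[OF square_integrable_source[OF v]]) (auto elim: eventually_mono)
  have "(LINT z|lebesgue. phi v z powr n * weak_deriv u z * weak_deriv w z)
        = (LINT z|lebesgue. phi v z powr n * dv (abs_h1 u) z * dv (abs_h1 w) z)" if w: "in_H1 w" for w
    by (intro integral_mult_cong_AE square_integrable_weight[OF n] s square_integrable_dv u w)
      (use d[OF u u] d[OF w w] in \<open>auto elim: eventually_mono\<close>)
  moreover have "(LINT z|lebesgue. phi v z powr m * u z * w z)
        = (LINT z|lebesgue. phi v z powr m * ev (abs_h1 u) z * ev (abs_h1 w) z)" if w: "in_H1 w" for w
    by (intro integral_mult_cong_AE square_integrable_weight[OF m] s square_integrable_ev u w)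
      (use e[OF u] e[OF w] in \<open>auto elim: eventually_mono\<close>)
  moreover have "(LINT z|lebesgue. weak_deriv (\<lambda>z. phi v z powr n) z * w z)
        = (LINT z|lebesgue. source v z * ev (abs_h1 w) z)" if w: "in_H1 w" for w
    by (intro integral_mult_cong_AE ss s square_integrable_source v square_integrable_ev w src)
      (use e[OF w] in \<open>auto elim: eventually_mono\<close>)
  ultimately have eq: "elliptic_weak_solution n m (phi v) u \<longleftrightarrow>
      (\<forall>w. in_H1 w \<longrightarrow> form v (abs_h1 u) (abs_h1 w) = - (LINT z|lebesgue. source v z * ev (abs_h1 w) z))"
    using u by (simp add: elliptic_weak_solution_def form_def wform_def)
  show ?thesis
    unfolding eq elliptic_def using u in_H1_ev abs_h1_ev by metis
qed (simp add: elliptic_weak_solution_def)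

lemma continuous_vfield: "continuous_on (cball 0 (1/4)) vfield"
  by (rule lipschitz_on_continuous_on[of field_lip])
    (auto intro!: lipschitz_onI simp: dist_norm vfield_lipschitz field_lip_nonneg)

text \<open>The equation is required only while the curve stays in the ball, which is all that is
  known both of the truncated flow and of an arbitrary solution. Within the ball, \<alpha>/2 times
  the squared norm is at most the conserved energy, hence at most C \<delta>^2.\<close>

lemma flow_stays_small:
  assumes \<eta>: "0 < \<eta>" "\<eta> < 1/4" and \<delta>: "\<delta> < 1/4" "C * \<delta>\<^sup>2 \<le> \<alpha> / 2 * \<eta>\<^sup>2"
    and c: "continuous_on {0..} V" and 0: "norm (V 0) \<le> \<delta>"
    and step: "\<And>T t. (\<And>s. 0 \<le> s \<Longrightarrow> s \<le> T \<Longrightarrow> norm (V s) \<le> 1/4) \<Longrightarrow> 0 \<le> t \<Longrightarrow> t < T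
      \<Longrightarrow> (V has_vector_derivative vfield (V t)) (at t within {0..})"
    and t: "0 \<le> t"
  shows "norm (V t) \<le> \<eta>"
proof (rule continuity_bootstrap[of "\<lambda>t. norm (V t)" "1/4"])
  show "continuous_on {0..} (\<lambda>t. norm (V t))" by (intro continuous_on_norm c)
  show "norm (V T) \<le> \<eta>" if T: "0 \<le> T" and small: "\<And>s. 0 \<le> s \<Longrightarrow> s \<le> T \<Longrightarrow> norm (V s) \<le> 1/4" for T
  proof -
    have "\<alpha> / 2 * (norm (V T))\<^sup>2 \<le> energy (V T)" by (rule energy_lower[OF small[OF T order_refl]])
    also have "\<dots> = energy (V 0)"
      by (rule energy_conserved[OF T small continuous_on_subset[OF c] step[OF small]]) auto
    also have "\<dots> \<le> C * (norm (V 0))\<^sup>2" by (rule energy_upper[OF small[OF order_refl T]])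
    also have "\<dots> \<le> C * \<delta>\<^sup>2" using 0 C_nonneg by (intro mult_left_mono power_mono) auto
    also note \<delta>(2)
    finally have "(norm (V T))\<^sup>2 \<le> \<eta>\<^sup>2" using \<alpha> by simp
    then show ?thesis by (rule power2_le_imp_le) (use \<eta> in simp)
  qed
qed (use \<eta> \<delta> 0 t in auto)

lemma flow_exists:
  assumes \<eta>: "0 < \<eta>" "\<eta> < 1/4" and \<delta>: "\<delta> < 1/4" "C * \<delta>\<^sup>2 \<le> \<alpha> / 2 * \<eta>\<^sup>2" and v0: "norm v0 \<le> \<delta>"
  shows "\<exists>V. V 0 = v0 \<and> (\<forall>t\<ge>0. norm (V t) \<le> \<eta>) \<and>
    (\<forall>t\<ge>0. (V has_vector_derivative vfield (V t)) (at t within {0..}))"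
proof -
  define P :: "h1 \<Rightarrow> h1" where "P = ball_retraction (1/4)"
  have P: "norm (P v) \<le> 1/4" for v unfolding P_def by (rule norm_ball_retraction) simp
  have lip: "norm (vfield (P v) - vfield (P w)) \<le> (field_lip * 2) * norm (v - w)" for v w
  proof -
    have "norm (vfield (P v) - vfield (P w)) \<le> field_lip * norm (P v - P w)"
      by (rule vfield_lipschitz[OF P P])
    also have "\<dots> \<le> field_lip * (2 * norm (v - w))"
      unfolding P_def by (intro mult_left_mono ball_retraction_lipschitz field_lip_nonneg) simp
    finally show ?thesis by simp
  qed
  \<comment> \<open>The boundedness demanded by the weighted Picard argument follows from the
    Lipschitz bound, since the truncated argument stays within distance 1 of 0.\<close>
  have bnd: "norm (vfield (P v)) \<le> norm (vfield 0) + field_lip * 1" for v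
  proof -
    have "norm (vfield (P v) - vfield 0) \<le> field_lip * norm (P v - 0)"
      by (rule vfield_lipschitz[OF P]) simp
    also have "\<dots> \<le> field_lip * 1" using P[of v] by (intro mult_left_mono field_lip_nonneg) auto
    finally show ?thesis using norm_triangle_ineq2[of "vfield (P v)" "vfield 0"] by linarith
  qed
  obtain V where V: "V 0 = v0" "\<And>t. t \<ge> 0 \<Longrightarrow> (V has_vector_derivative vfield (P (V t))) (at t within {0..})"
    using global_lipschitz_ode[of "\<lambda>v. vfield (P v)", OF lip bnd] field_lip_nonneg by auto
  have c: "continuous_on {0..} V"
    by (rule continuous_on_vector_derivative[of _ _ "\<lambda>t. vfield (P (V t))"]) (simp add: V)
  have PV: "P (V t) = V t" if "norm (V t) \<le> 1/4" for t
    unfolding P_def using that by (intro ball_retraction_eq) auto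
  have bound: "norm (V t) \<le> \<eta>" if "t \<ge> 0" for t
  proof (rule flow_stays_small[OF \<eta> \<delta> c _ _ that])
    fix T t :: real
    assume "\<And>s. 0 \<le> s \<Longrightarrow> s \<le> T \<Longrightarrow> norm (V s) \<le> 1/4" "0 \<le> t" "t < T"
    then show "(V has_vector_derivative vfield (V t)) (at t within {0..})" using V(2)[of t] PV[of t] by simp
  qed (use V v0 in simp)
  moreover have "(V has_vector_derivative vfield (V t)) (at t within {0..})" if "t \<ge> 0" for t
    using V(2)[OF that] PV[of t] bound[OF that] \<eta> by simp
  ultimately show ?thesis using V(1) by blast
qed

lemma flow_magma_solution:
  assumes V: "\<And>t. t \<ge> 0 \<Longrightarrow> (V has_vector_derivative vfield (V t)) (at t within {0..})"
    and small: "\<And>t. t \<ge> 0 \<Longrightarrow> norm (V t) \<le> 1/4" and V0: "V 0 = abs_h1 (\<lambda>z. \<phi>\<^sub>0 z - 1)"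
  shows "magma_solution n m \<phi>\<^sub>0 (\<lambda>t. phi (V t))"
  unfolding magma_solution_def abs_h1_phi V0[symmetric]
proof (intro conjI allI impI exI[of _ "\<lambda>s. ev (sol (V s))"])
  fix t :: real assume t: "t \<ge> 0"
  show "continuous_on UNIV (phi (V t))" by (rule continuous_phi)
  show "0 < phi (V t) z" for z by (rule phi_pos[OF small[OF t]])
  show "in_H1 (\<lambda>z. phi (V t) z - 1)" using in_H1_ev[of "V t"] by (simp add: phi_def)
  show "elliptic_weak_solution n m (phi (V t)) (ev (sol (V t)))"
    using elliptic_sol[OF small[OF t]] by (simp add: elliptic_weak_solution_phi[OF small[OF t]] in_H1_ev abs_h1_ev)
  show "AE z in lebesgue. v z = ev (sol (V t)) z" if "elliptic_weak_solution n m (phi (V t)) v" for v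
  proof -
    have v: "in_H1 v" "elliptic (V t) (abs_h1 v)" using that by (auto simp: elliptic_weak_solution_phi[OF small[OF t]])
    have "abs_h1 v = sol (V t)" by (rule elliptic_unique[OF small[OF t] v(2) elliptic_sol[OF small[OF t]]])
    then show ?thesis using ev_abs_h1_AE[OF v(1)] by (auto elim: eventually_mono)
  qed
  show "in_H1 (\<lambda>z. phi (V t) z powr m * ev (sol (V t)) z)"
    using in_H1_field[OF small[OF t]] by (simp add: field_fun_def[abs_def])
  have "((\<lambda>s. vfield (V s)) has_integral (V t - V 0)) {0..t}"
    by (rule fundamental_theorem_of_calculus[OF t]) (auto intro: has_vector_derivative_within_subset[OF V])
  then show "((\<lambda>s. abs_h1 (\<lambda>z. phi (V s) z powr m * ev (sol (V s)) z)) has_integral (V t - V 0)) {0..t}"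
    by (simp add: vfield_def field_fun_def[abs_def])
next
  have c: "continuous_on {0..} V"
    by (rule continuous_on_vector_derivative[of _ _ "\<lambda>t. vfield (V t)"]) (simp add: V)
  have "continuous_on {0..} (\<lambda>t. vfield (V t))"
    by (rule continuous_on_compose2[OF continuous_vfield c]) (use small in auto)
  then show "C1_on_halfline V"
    unfolding C1_on_halfline_def using V by (intro exI[of _ "\<lambda>t. vfield (V t)"]) auto
qed

text \<open>Uniqueness for the elliptic problem identifies phi^m u with \<open>vfield\<close> only
  inside the ball. There the integrand becomes continuous and the integral equation turns into the
  differential equation, which is what the bootstrap needs to keep the solution inside.\<close>

lemma magma_solution_flow:
  assumes \<eta>: "0 < \<eta>" "\<eta> < 1/4" and \<delta>: "\<delta> < 1/4" "C * \<delta>\<^sup>2 \<le> \<alpha> / 2 * \<eta>\<^sup>2"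
    and \<phi>\<^sub>0: "norm (abs_h1 (\<lambda>z. \<phi>\<^sub>0 z - 1)) \<le> \<delta>" and sol: "magma_solution n m \<phi>\<^sub>0 \<phi>"
  shows "\<exists>W. W 0 = abs_h1 (\<lambda>z. \<phi>\<^sub>0 z - 1) \<and> (\<forall>t\<ge>0. \<phi> t = phi (W t) \<and> norm (W t) \<le> \<eta> \<and>
    (W has_vector_derivative vfield (W t)) (at t within {0..}))"
proof -
  define v0 where "v0 = abs_h1 (\<lambda>z. \<phi>\<^sub>0 z - 1)"
  define W where "W t = abs_h1 (\<lambda>z. \<phi> t z - 1)" for t
  have W: "\<phi> t = phi (W t)" if "t \<ge> 0" for t
    unfolding W_def by (rule phi_abs_h1[symmetric]) (use sol that in \<open>auto simp: magma_solution_def\<close>)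
  have "C1_on_halfline W" using sol unfolding magma_solution_def W_def by blast
  then obtain W' where "\<And>t. t \<ge> 0 \<Longrightarrow> (W has_vector_derivative W' t) (at t within {0..})"
    unfolding C1_on_halfline_def by blast
  then have c: "continuous_on {0..} W"
    by (intro continuous_on_vector_derivative[of _ _ W']) simp
  obtain u where u: "\<And>s. s \<ge> 0 \<Longrightarrow> elliptic_weak_solution n m (\<phi> s) (u s)"
      "\<And>s. s \<ge> 0 \<Longrightarrow> in_H1 (\<lambda>z. \<phi> s z powr m * u s z)"
    and int: "\<And>t. t \<ge> 0 \<Longrightarrow> ((\<lambda>s. abs_h1 (\<lambda>z. \<phi> s z powr m * u s z)) has_integral (W t - v0)) {0..t}"
    using sol unfolding magma_solution_def W_def v0_def by blast
  \<comment> \<open>At time 0 the interval degenerates, and the integral equation becomes the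
    initial condition.\<close>
  have "((\<lambda>s. abs_h1 (\<lambda>z. \<phi> s z powr m * u s z)) has_integral 0) {0..0}"
    by (subst atLeastAtMost_singleton) (rule has_integral_refl)
  from has_integral_unique[OF int[OF order_refl] this] have W0: "W 0 = v0" by simp
  have field: "abs_h1 (\<lambda>z. \<phi> s z powr m * u s z) = vfield (W s)" if s: "s \<ge> 0" and small: "norm (W s) \<le> 1/4" for s
  proof -
    have us: "in_H1 (u s)" "elliptic (W s) (abs_h1 (u s))"
      using u(1)[OF s] by (auto simp: W[OF s] elliptic_weak_solution_phi[OF small])
    have "abs_h1 (u s) = sol (W s)" by (rule elliptic_unique[OF small us(2) elliptic_sol[OF small]])
    then have "AE z in lebesgue. \<phi> s z powr m * u s z = field_fun (W s) z"
      using ev_abs_h1_AE[OF us(1)] by (auto simp: field_fun_def W[OF s] elim: eventually_mono)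
    then show ?thesis unfolding vfield_def by (rule h1_rel_imp_abs_eq[OF u(2)[OF s] in_H1_field[OF small]])
  qed
  have step: "(W has_vector_derivative vfield (W t)) (at t within {0..})"
    if small: "\<And>s. 0 \<le> s \<Longrightarrow> s \<le> T \<Longrightarrow> norm (W s) \<le> 1/4" and t: "0 \<le> t" "t < T" for T t
  proof (rule integral_equation_imp_ode[OF _ _ t])
    show "continuous_on {0..T} (\<lambda>t. vfield (W t))"
      by (rule continuous_on_compose2[OF continuous_vfield continuous_on_subset[OF c]]) (use small in auto)
    show "W t = v0 + integral {0..t} (\<lambda>t. vfield (W t))" if t: "0 \<le> t" "t \<le> T" for t
    proof -
      have "((\<lambda>s. vfield (W s)) has_integral (W t - v0)) {0..t}"
        by (rule has_integral_eq[OF _ int[OF t(1)]]) (use field small t in auto)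
      then show ?thesis by (simp add: integral_unique)
    qed
  qed
  have bound: "norm (W t) \<le> \<eta>" if "t \<ge> 0" for t
    by (rule flow_stays_small[OF \<eta> \<delta> c _ step that]) (use W0 \<phi>\<^sub>0 in \<open>simp_all add: v0_def\<close>)
  have "norm (W t) \<le> 1/4" if "t \<ge> 0" for t using bound[OF that] \<eta> by linarith
  then have "(W has_vector_derivative vfield (W t)) (at t within {0..})" if "t \<ge> 0" for t
    by (rule step[of "t + 1"]) (use that in auto)
  then show ?thesis using W0 W bound unfolding v0_def by blast
qed

lemma stability:
  assumes \<eta>: "0 < \<eta>" "\<eta> < 1/4" and \<delta>: "\<delta> < 1/4" "C * \<delta>\<^sup>2 \<le> \<alpha> / 2 * \<eta>\<^sup>2"
    and \<phi>\<^sub>0: "in_H1 (\<lambda>z. \<phi>\<^sub>0 z - 1)" "norm (abs_h1 (\<lambda>z. \<phi>\<^sub>0 z - 1)) \<le> \<delta>"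
  shows "\<exists>\<phi>. magma_solution n m \<phi>\<^sub>0 \<phi> \<and> (AE z in lebesgue. \<phi> 0 z = \<phi>\<^sub>0 z) \<and>
    (\<forall>\<phi>'. magma_solution n m \<phi>\<^sub>0 \<phi>' \<longrightarrow> (\<forall>t\<ge>0. \<phi>' t = \<phi> t)) \<and>
    (\<forall>t\<ge>0. norm (abs_h1 (\<lambda>z. \<phi> t z - 1)) \<le> \<eta>)"
proof -
  obtain V where V: "V 0 = abs_h1 (\<lambda>z. \<phi>\<^sub>0 z - 1)" "\<And>t. t \<ge> 0 \<Longrightarrow> norm (V t) \<le> \<eta>"
    "\<And>t. t \<ge> 0 \<Longrightarrow> (V has_vector_derivative vfield (V t)) (at t within {0..})"
    using flow_exists[OF \<eta> \<delta> \<phi>\<^sub>0(2)] by blast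
  have small: "norm (V t) \<le> 1/4" if "t \<ge> 0" for t using V(2)[OF that] \<eta> by simp
  show ?thesis
  proof (intro exI[of _ "\<lambda>t. phi (V t)"] conjI allI impI)
    show "magma_solution n m \<phi>\<^sub>0 (\<lambda>t. phi (V t))" by (rule flow_magma_solution[OF V(3) small V(1)])
    show "AE z in lebesgue. phi (V 0) z = \<phi>\<^sub>0 z"
      using ev_abs_h1_AE[OF \<phi>\<^sub>0(1)] by (auto simp: phi_def V(1) elim: eventually_mono)
    show "norm (abs_h1 (\<lambda>z. phi (V t) z - 1)) \<le> \<eta>" if "t \<ge> 0" for t using V(2)[OF that] by (simp add: abs_h1_phi)
    fix \<phi>' and t :: real assume s: "magma_solution n m \<phi>\<^sub>0 \<phi>'" and t: "t \<ge> 0"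
    obtain W where W: "W 0 = abs_h1 (\<lambda>z. \<phi>\<^sub>0 z - 1)" "\<And>t. t \<ge> 0 \<Longrightarrow> \<phi>' t = phi (W t)"
      "\<And>t. t \<ge> 0 \<Longrightarrow> norm (W t) \<le> \<eta>" "\<And>t. t \<ge> 0 \<Longrightarrow> (W has_vector_derivative vfield (W t)) (at t within {0..})"
      using magma_solution_flow[OF \<eta> \<delta> \<phi>\<^sub>0(2) s] by blast
    have "W t = V t"
    proof (rule ode_unique_inner[OF W(4) V(3) _ _ t])
      show "norm (vfield (W t) - vfield (V t)) \<le> field_lip * norm (W t - V t)" if "t \<ge> 0" for t
        using W(3)[OF that] small[OF that] \<eta> by (intro vfield_lipschitz) auto
    qed (simp_all add: W(1) V(1))
    then show "\<phi>' t = phi (V t)" by (simp add: W(2)[OF t])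
  qed
qed

end

section \<open>Choice of the scalar functions and constants\<close>

lemma magma_exists: "\<exists>\<alpha> C g G K. magma n m \<alpha> C g G K"
proof -
  have pc: "continuous_on {0<..} (\<lambda>y::real. y powr a)" for a by (intro continuous_intros) auto
  obtain g where g: "\<And>y. y > 0 \<Longrightarrow> (g has_real_derivative y powr (-n-m)) (at y)" "g 1 = 0"
    using antiderivative_pos[OF pc] by blast
  have gc: "continuous_on {0<..} g"
    using g(1) by (auto intro!: continuous_at_imp_continuous_on intro: DERIV_isCont)
  obtain G where G: "\<And>y. y > 0 \<Longrightarrow> (G has_real_derivative g y) (at y)" "G 1 = 0"
    using antiderivative_pos[OF gc] by blast
  have "continuous_on {0<..} (\<lambda>y. g y * (n * y powr (n - 1)))"
    by (intro continuous_on_mult gc continuous_on_const pc)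
  then obtain K where K: "\<And>y. y > 0 \<Longrightarrow> (K has_real_derivative g y * (n * y powr (n - 1))) (at y)"
    using antiderivative_pos by blast
  have dp: "((\<lambda>y. y powr a) has_real_derivative a * y powr (a - 1)) (at y)" if "y > 0" for a y :: real
    using that by (auto intro!: derivative_eq_intros)
  have "(\<lambda>y. 1/2 * (-2*m * y powr (-2*m - 1))) = (\<lambda>y. - m * y powr (-2*m - 1))"
    by (simp add: fun_eq_iff)
  then have ek: "\<exists>C. taylor_bounded (\<lambda>y. 1/2 * y powr (-2*m)) (\<lambda>y. - m * y powr (-2*m - 1)) C"
    using taylor_bounded_powr[of "1/2" "-2*m"] by metis
  have eg: "\<exists>C. taylor_bounded g (\<lambda>y. y powr (-n-m)) C"
    by (rule taylor_boundedI[OF g(1) dp]) (assumption | intro continuous_on_mult continuous_on_const pc)+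
  have eG: "\<exists>C. taylor_bounded G g C"
    by (rule taylor_boundedI[OF G(1) g(1) pc]) assumption+
  obtain C1 C2 C3 C4 C5 where C:
    "taylor_bounded (\<lambda>y. y powr n) (\<lambda>y. n * y powr (n - 1)) C1"
    "taylor_bounded (\<lambda>y. y powr m) (\<lambda>y. m * y powr (m - 1)) C2"
    "taylor_bounded (\<lambda>y. 1/2 * y powr (-2*m)) (\<lambda>y. - m * y powr (-2*m - 1)) C3"
    "taylor_bounded g (\<lambda>y. y powr (-n-m)) C4"
    "taylor_bounded G g C5"
    using taylor_bounded_powr[of 1 n] taylor_bounded_powr[of 1 m] ek eg eG by auto
  define C where "C = Max {C1, C2, C3, C4, C5}"
  obtain a1 a2 a3 a4 where a: "a1 > 0" "a2 > 0" "a3 > 0" "a4 > 0"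
    "\<And>y. y \<in> {1/2..3/2} \<Longrightarrow> a1 \<le> y powr n" "\<And>y. y \<in> {1/2..3/2} \<Longrightarrow> a2 \<le> y powr m"
    "\<And>y. y \<in> {1/2..3/2} \<Longrightarrow> a3 \<le> y powr (-2*m)" "\<And>y. y \<in> {1/2..3/2} \<Longrightarrow> a4 \<le> y powr (-n-m)"
    using powr_lower_bound[of n] powr_lower_bound[of m] powr_lower_bound[of "-2*m"] powr_lower_bound[of "-n-m"] by metis
  define \<alpha> where "\<alpha> = Min {a1, a2, a3, a4}"
  have "magma n m \<alpha> C g G K"
  proof
    show "\<alpha> \<le> y powr n" "\<alpha> \<le> y powr m" "\<alpha> \<le> y powr (-2*m)" "\<alpha> \<le> y powr (-n-m)" if "y \<in> {1/2..3/2}" for y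
      using a(5-8)[OF that] by (auto simp: \<alpha>_def)
  qed (use C[THEN taylor_bounded_mono] a(1-4) g(2) G(2) K in \<open>auto simp: C_def \<alpha>_def\<close>)
  then show ?thesis by blast
qed

theorem corollary4p6:
  fixes n m :: real
  shows "\<exists>\<eta>\<^sub>c>0. \<forall>\<eta>. 0 < \<eta> \<and> \<eta> < \<eta>\<^sub>c \<longrightarrow>
    (\<exists>\<delta>>0. \<forall>\<phi>\<^sub>0 :: real \<Rightarrow> real.
       in_H1 (\<lambda>z. \<phi>\<^sub>0 z - 1) \<and> norm (abs_h1 (\<lambda>z. \<phi>\<^sub>0 z - 1)) \<le> \<delta> \<longrightarrow>
       (\<exists>\<phi>. magma_solution n m \<phi>\<^sub>0 \<phi> \<and>
            (AE z in lebesgue. \<phi> 0 z = \<phi>\<^sub>0 z) \<and>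
            (\<forall>\<phi>'. magma_solution n m \<phi>\<^sub>0 \<phi>' \<longrightarrow> (\<forall>t\<ge>0. \<phi>' t = \<phi> t)) \<and>
            (\<forall>t\<ge>0. norm (abs_h1 (\<lambda>z. \<phi> t z - 1)) \<le> \<eta>)))"
proof -
  obtain \<alpha> C g G K where "magma n m \<alpha> C g G K" using magma_exists by blast
  then interpret magma n m \<alpha> C g G K .
  show ?thesis
  \<comment> \<open>The threshold is the radius of the ball, the same for all n and m; the
    dependence on the exponents is carried by \<delta> through \<alpha> and
    \<open>C\<close>.\<close>
  proof (rule exI[of _ "1/4"], intro conjI allI impI)
    fix \<eta> :: real assume \<eta>: "0 < \<eta> \<and> \<eta> < 1/4"
    \<comment> \<open>Solved from (C + 1) \<delta>^2 <= \<alpha>/2 \<eta>^2, the condition that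
      makes the initial energy small enough; \<open>C + 1\<close> avoids dividing by 0, and 1/8
      places the data strictly inside the ball.\<close>
    define \<delta> where "\<delta> = min (1/8) (\<eta> * sqrt (\<alpha> / (2 * (C + 1))))"
    have \<delta>: "0 < \<delta>" "\<delta> < 1/4" using \<eta> \<alpha> C_nonneg by (auto simp: \<delta>_def min_def)
    have "C * \<delta>\<^sup>2 \<le> (C + 1) * (\<eta> * sqrt (\<alpha> / (2 * (C + 1))))\<^sup>2"
      using C_nonneg \<delta>(1) by (intro mult_mono power_mono) (auto simp: \<delta>_def)
    also have "\<dots> = \<alpha> / 2 * \<eta>\<^sup>2"
      using C_nonneg \<alpha> by (simp add: power_mult_distrib field_simps)
    finally have le: "C * \<delta>\<^sup>2 \<le> \<alpha> / 2 * \<eta>\<^sup>2" .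
    show "\<exists>\<delta>>0. \<forall>\<phi>\<^sub>0 :: real \<Rightarrow> real.
       in_H1 (\<lambda>z. \<phi>\<^sub>0 z - 1) \<and> norm (abs_h1 (\<lambda>z. \<phi>\<^sub>0 z - 1)) \<le> \<delta> \<longrightarrow>
       (\<exists>\<phi>. magma_solution n m \<phi>\<^sub>0 \<phi> \<and>
            (AE z in lebesgue. \<phi> 0 z = \<phi>\<^sub>0 z) \<and>
            (\<forall>\<phi>'. magma_solution n m \<phi>\<^sub>0 \<phi>' \<longrightarrow> (\<forall>t\<ge>0. \<phi>' t = \<phi> t)) \<and>
            (\<forall>t\<ge>0. norm (abs_h1 (\<lambda>z. \<phi> t z - 1)) \<le> \<eta>))"
      using stability[OF _ _ \<delta>(2) le] \<eta> \<delta>(1) by (intro exI[of _ \<delta>] conjI allI impI) auto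
  qed simp
qed

end
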